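(* For $n\in\mathbb{N}$, let $G(n)$ denote the number of integer sequences $n-1\ge d_1\ge d_2\ge\dotsb\ge d_n\ge 0$ that are the degree sequence of some simple graph on $n$ vertices. Then there is a constant $c>0$ such that \[ G(n)=(c+o(1))\,\frac{4^n}{n^{3/4}}\qquad\text{as } n\to\infty. \]
   Context: A simple graph has no loops or multiple edges; the degree of a vertex is the number of edges incident to it. *)

theory Defs
  imports Complex_Main "HOL-Library.Multiset" "HOL-Library.Landau_Symbols"
begin

text \<open>An edge is the set of its two distinct endpoints, so a set of edges admits neither loops
  nor multiple edges.\<close>

definition simple_graph :: "'a set \<Rightarrow> 'a set set \<Rightarrow> bool" where
  "simple_graph V E \<longleftrightarrow> finite V \<and> (\<forall>e\<in>E. e \<subseteq> V \<and> card e = 2)"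

definition vertex_degree :: "'a set set \<Rightarrow> 'a \<Rightarrow> nat" where
  "vertex_degree E v = card {e \<in> E. v \<in> e}"

text \<open>The sequence lists the degrees of all vertices, with repetition. Its order is left open here;
  the non-increasing order is imposed below.\<close>

definition is_degree_sequence :: "'a set \<Rightarrow> 'a set set \<Rightarrow> int list \<Rightarrow> bool" where
  "is_degree_sequence V E d \<longleftrightarrow> mset d = image_mset (\<lambda>v. int (vertex_degree E v)) (mset_set V)"

text \<open>Vertices are taken in \<open>nat\<close>, which contains a copy of every finite vertex set.\<close>

definition graphic_sequences :: "nat \<Rightarrow> int list set" where
  "graphic_sequences n = {d. length d = n \<and> sorted_wrt (\<ge>) d \<and> (\<forall>x\<in>set d. 0 \<le> x \<and> x \<le> int n - 1) \<and>
     (\<exists>(V :: nat set) E. simple_graph V E \<and> card V = n \<and> is_degree_sequence V E d)}"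

lemma finite_graphic_sequences: "finite (graphic_sequences n)"
  by (rule finite_subset[OF _ finite_lists_length_eq[of "{0..int n - 1}" n]])
    (auto simp: graphic_sequences_def)

definition num_graphic_sequences :: "nat \<Rightarrow> nat" where
  "num_graphic_sequences n = card (graphic_sequences n)"

end

(*
  By the Erdos--Gallai theorem a decreasing list d with entries in {0..n-1} is graphic iff its sum is
  even and the Erdos--Gallai inequalities hold. Encode d by the n-set U = {d_i + n - i} in {1..2n-1}
  and U by the walk of length n - 1 whose j-th step is [j not in U] - [2n - j in U]. The inequalities
  then say that all partial sums of the heights of this walk (the areas) are nonnegative, the parity of
  the sum of d is that of the total area, and the final height is 0 or -1.

  These walks are counted by generating functions in x, where a walk of length m has weight
  omega(area) / 4^m with omega = 1 or omega = (-1)^area; averaging the two cases imposes even area.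
  Let R, M, Z be the series of all bridges, of bridges with nonnegative areas, and of the latter with
  total area 0. Cutting a bridge at the last minimum of its area, and a nonnegative one at the last
  zero of its area, gives R = M P and M = Z P with the same P, hence M^2 = R Z; the half-bridges wanted
  have the series M/2 + M/(2R) - 1. For omega = 1 we have R = (1 - x)^(-1/2), so M = (1 - x)^(-1/4) g with
  g^2 = Z. A Fourier estimate gives Z_m = O(m^(-5/4)), and g inherits this decay because
  g = (1 - zeta)^(-1/2) has nonnegative coefficients, zeta being the series of primitive zero-area
  bridges. Hence M_n ~ g(1) n^(-3/4) / Gamma(1/4). For omega = (-1)^area the singularity of R moves
  outside the unit disc, and the contribution is of smaller order.
*)

theory Submission
  imports Defs "HOL-Analysis.Analysis" "HOL-Real_Asymp.Real_Asymp"
begin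

text \<open>The exponent 3/4 is 1/2 + 1/4: a walk of length m is a bridge with probability of order
  m^(-1/2), and a bridge keeps its areas nonnegative with probability of order m^(-1/4). The
  obstacle is that no closed form of M, P or Z is at hand. Two cuts sharing the factor P remove it,
  and M becomes the geometric mean of an explicit series and of Z, for which an upper bound on the
  coefficients suffices. Both cuts fall at height 0 because heights are the increments of the area
  and a step rises by at most 1; hence the pieces are again bridges. The bound m^(-5/4) is not
  sharp: the area has standard deviation of order m^(3/2). The exponent is chosen because it is
  summable, survives Cauchy products, and is the exact decay of the coefficients of (1 - x)^(1/4),
  the factor of M/R; a single class of series then holds all error terms. The constant obtained is c
  = g(1) / (4 Gamma(1/4)): one factor 1/2 comes from M/2, the other from the parity average.\<close>

unbundle no vec_syntax
unbundle fps_syntax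

section \<open>Lattice walks and their areas\<close>

text \<open>A pair of truth values encodes two simultaneous half-steps, so there are four possible steps:
  one up, one down and two level ones. The area is the sum of the heights of all nonempty prefixes.\<close>

definition step :: "bool \<times> bool \<Rightarrow> int" where
  "step s = of_bool (fst s) - of_bool (snd s)"

definition height :: "(bool \<times> bool) list \<Rightarrow> int" where
  "height xs = sum_list (map step xs)"

primrec area :: "(bool \<times> bool) list \<Rightarrow> int" where
  "area [] = 0"
| "area (s # xs) = (int (length xs) + 1) * step s + area xs"

definition nonneg :: "(bool \<times> bool) list \<Rightarrow> bool" where
  "nonneg xs \<longleftrightarrow> (\<forall>t\<le>length xs. area (take t xs) \<ge> 0)"

lemma step_bounds: "- 1 \<le> step s" "step s \<le> 1"
  by (auto simp: step_def)

lemma height_simps [simp]: "height [] = 0" "height (s # xs) = step s + height xs"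
  "height (xs @ ys) = height xs + height ys" "height (rev xs) = height xs"
  by (auto simp: height_def rev_map [symmetric] sum_list_rev)

lemma area_append: "area (xs @ ys) = area xs + int (length ys) * height xs + area ys"
  by (induction xs) (auto simp: algebra_simps)

lemma area_rev: "area (rev xs) = (int (length xs) + 1) * height xs - area xs"
  by (induction xs) (auto simp: area_append algebra_simps)

lemma height_take_Suc: "t < length xs \<Longrightarrow> height (take (Suc t) xs) = height (take t xs) + step (xs ! t)"
  by (simp add: take_Suc_conv_app_nth)

lemma area_take_Suc: "t < length xs \<Longrightarrow> area (take (Suc t) xs) = area (take t xs) + height (take (Suc t) xs)"
  by (simp add: take_Suc_conv_app_nth area_append)

lemma area_take_drop:
  assumes "height (take t xs) = 0" "t \<le> length xs"
  shows "area (take (t + s) xs) = area (take t xs) + area (take s (drop t xs))"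
    and "height (take (t + s) xs) = height (take s (drop t xs))"
  using assms by (auto simp: take_add area_append)

text \<open>Read backwards, a bridge shows at each cut the excess of the area there over the total
  area. Nonnegativity of the reversal thus makes the total area a minimum, which is how the part of
  a bridge before its last minimum becomes a \<open>nonneg_bridge\<close>.\<close>

lemma nonneg_rev:
  assumes "height xs = 0"
  shows "nonneg (rev xs) \<longleftrightarrow> (\<forall>t\<le>length xs. area xs \<le> area (take t xs))"
proof -
  have eq: "area (take (length xs - k) (rev xs)) = area (take k xs) - height (take k xs) - area xs"
    if k: "k \<le> length xs" for k
  proof -
    have "area xs = area (take k xs) + int (length xs - k) * height (take k xs) + area (drop k xs)"
      using area_append [of "take k xs" "drop k xs"] by simp
    moreover have "height (drop k xs) = - height (take k xs)"
      using height_simps(3) [of "take k xs" "drop k xs"] assms by simp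
    moreover have "take (length xs - k) (rev xs) = rev (drop k xs)"
      using k by (simp add: take_rev)
    ultimately show ?thesis
      using area_rev [of "drop k xs"] by (simp add: algebra_simps)
  qed
  have "nonneg (rev xs) \<longleftrightarrow> (\<forall>k\<le>length xs. area (take (length xs - k) (rev xs)) \<ge> 0)"
    unfolding nonneg_def by (metis diff_diff_cancel diff_le_self length_rev)
  also have "\<dots> \<longleftrightarrow> (\<forall>k\<le>length xs. area xs \<le> area (take k xs) - height (take k xs))"
    using eq by auto
  \<comment> \<open>For \<open>k > 0\<close> the difference is
    \<open>area (take (k - 1) xs)\<close>, the height being the last increment. The shift loses only
    the full prefix, where the inequality is trivial.\<close>
  also have "\<dots> \<longleftrightarrow> (\<forall>t\<le>length xs. area xs \<le> area (take t xs))"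
  proof (intro iffI allI impI)
    fix t assume A: "\<forall>k\<le>length xs. area xs \<le> area (take k xs) - height (take k xs)" and t: "t \<le> length xs"
    show "area xs \<le> area (take t xs)"
    proof (cases "t = length xs")
      case False
      with t A [rule_format, of "Suc t"] area_take_Suc [of t xs] show ?thesis by simp
    qed simp
  next
    fix k assume A: "\<forall>t\<le>length xs. area xs \<le> area (take t xs)" and k: "k \<le> length xs"
    show "area xs \<le> area (take k xs) - height (take k xs)"
      using A k area_take_Suc [of "k - 1" xs] by (cases k) auto
  qed
  finally show ?thesis .
qed

lemma nonneg_append:
  assumes "height ys = 0" "nonneg ys" "\<And>t. t \<le> length zs \<Longrightarrow> area (take t zs) \<ge> 0"
  shows "nonneg (ys @ zs)"
  unfolding nonneg_def
proof (intro allI impI)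
  fix t assume "t \<le> length (ys @ zs)"
  moreover have "area ys \<ge> 0"
    using assms(2) by (auto simp: nonneg_def dest: spec [of _ "length ys"])
  ultimately show "area (take t (ys @ zs)) \<ge> 0"
    using assms by (cases "t \<le> length ys") (auto simp: nonneg_def area_append)
qed

section \<open>Unique cuts of walks\<close>

definition excursion_above :: "(bool \<times> bool) list \<Rightarrow> bool" where
  "excursion_above xs \<longleftrightarrow> height xs = 1 \<and> (\<forall>t. 1 \<le> t \<and> t \<le> length xs \<longrightarrow> height (take t xs) \<ge> 1)"

definition nonneg_bridge :: "(bool \<times> bool) list \<Rightarrow> bool" where
  "nonneg_bridge xs \<longleftrightarrow> height xs = 0 \<and> nonneg xs"

definition zero_area_bridge :: "(bool \<times> bool) list \<Rightarrow> bool" where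
  "zero_area_bridge xs \<longleftrightarrow> nonneg_bridge xs \<and> area xs = 0"

definition positive_bridge :: "(bool \<times> bool) list \<Rightarrow> bool" where
  "positive_bridge xs \<longleftrightarrow> height xs = 0 \<and> (\<forall>t. 1 \<le> t \<and> t \<le> length xs \<longrightarrow> area (take t xs) > 0)"

lemma positive_bridgeD: "positive_bridge xs \<Longrightarrow> 0 < t \<Longrightarrow> t \<le> length xs \<Longrightarrow> area (take t xs) > 0"
  by (auto simp: positive_bridge_def)

definition primitive_bridge :: "(bool \<times> bool) list \<Rightarrow> bool" where
  "primitive_bridge xs \<longleftrightarrow> zero_area_bridge xs \<and> xs \<noteq> [] \<and>
     (\<forall>t. 0 < t \<and> t < length xs \<longrightarrow> \<not> (height (take t xs) = 0 \<and> area (take t xs) = 0))"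

lemma last_index_exists:
  assumes "P (0::nat)"
  obtains t where "t \<le> n" "P t" "\<And>s. t < s \<Longrightarrow> s \<le> n \<Longrightarrow> \<not> P s"
proof -
  define t where "t = Max {t. t \<le> n \<and> P t}"
  have fin: "finite {t. t \<le> n \<and> P t}" by simp
  have "t \<in> {t. t \<le> n \<and> P t}"
    unfolding t_def by (rule Max_in [OF fin]) (use assms in auto)
  moreover have "\<not> P s" if "t < s" "s \<le> n" for s
  proof
    assume "P s"
    then have "s \<le> t" unfolding t_def using that by (intro Max_ge fin) auto
    with that show False by simp
  qed
  ultimately show ?thesis using that by auto
qed

text \<open>The cut is at the last minimum of the area. The area increments are the heights, so there the
  height changes from nonpositive to positive; as steps are at most 1, it is 0 at the cut.\<close>

lemma split_bridge:
  assumes "height xs = 0"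
  shows "\<exists>!t. t \<le> length xs \<and> nonneg_bridge (rev (take t xs)) \<and> positive_bridge (drop t xs)"
proof -
  define m where "m = Min ((\<lambda>t. area (take t xs)) ` {..length xs})"
  have m: "m \<le> area (take t xs)" if "t \<le> length xs" for t
    unfolding m_def using that by (intro Min_le) auto
  have "m \<in> (\<lambda>t. area (take t xs)) ` {..length xs}"
    unfolding m_def by (intro Min_in) auto
  then obtain t0 where t0: "t0 \<le> length xs" "area (take t0 xs) = m" by auto
  \<comment> \<open>\<open>last_index_exists\<close> wants the property at index 0, so the search
    starts from some minimiser \<open>t0\<close>.\<close>
  obtain s where s: "s \<le> length xs - t0" "area (take (t0 + s) xs) = m"
    and s_max: "\<And>r. s < r \<Longrightarrow> r \<le> length xs - t0 \<Longrightarrow> area (take (t0 + r) xs) \<noteq> m"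
    using last_index_exists [of "\<lambda>s. area (take (t0 + s) xs) = m" "length xs - t0"] t0 by auto
  define t where "t = t0 + s"
  have t: "t \<le> length xs" "area (take t xs) = m" using s t0 by (auto simp: t_def)
  have t_max: "area (take r xs) > m" if "t < r" "r \<le> length xs" for r
  proof -
    have "s < r - t0" "r - t0 \<le> length xs - t0" "t0 + (r - t0) = r"
      using that unfolding t_def by auto
    then have "area (take r xs) \<noteq> m" using s_max [of "r - t0"] by simp
    then show ?thesis using m [of r] that by simp
  qed
  have h0: "height (take t xs) = 0"
  proof (cases "t = length xs")
    case False
    then have tl: "t < length xs" using t by simp
    have "height (take (Suc t) xs) > 0"
      using t_max [of "Suc t"] area_take_Suc [OF tl] t tl by auto
    moreover have "height (take t xs) \<le> 0"
      using area_take_Suc [of "t - 1" xs] m [of "t - 1"] t tl by (cases t) auto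
    ultimately show ?thesis
      using height_take_Suc [OF tl] step_bounds [of "xs ! t"] by auto
  qed (use assms in simp)
  have A: "nonneg_bridge (rev (take t xs))"
    unfolding nonneg_bridge_def using nonneg_rev [of "take t xs"] h0 m t by (auto simp: min_def)
  have B: "positive_bridge (drop t xs)"
    unfolding positive_bridge_def
  proof (intro conjI allI impI)
    show "height (drop t xs) = 0"
      using height_simps(3) [of "take t xs" "drop t xs"] assms h0 by simp
    fix r assume "1 \<le> r \<and> r \<le> length (drop t xs)"
    then show "area (take r (drop t xs)) > 0"
      using t_max [of "t + r"] area_take_drop(1) [OF h0, of r] t by auto
  qed
  show ?thesis
  proof (rule ex1I [of _ t])
    show "t \<le> length xs \<and> nonneg_bridge (rev (take t xs)) \<and> positive_bridge (drop t xs)"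
      using A B t by auto
  next
    have *: False if "u \<le> length xs" "nonneg_bridge (rev (take u xs))" "positive_bridge (drop u xs)"
      "v \<le> length xs" "nonneg_bridge (rev (take v xs))" "u < v" for u v
    proof -
      have h: "height (take u xs) = 0" "height (take v xs) = 0"
        using that(2,5) by (auto simp: nonneg_bridge_def)
      have "area (take v xs) \<le> area (take u (take v xs))"
        using nonneg_rev [OF h(2)] that by (simp add: nonneg_bridge_def)
      moreover have "area (take (v - u) (drop u xs)) > 0"
        using that by (intro positive_bridgeD) auto
      ultimately show False
        using area_take_drop(1) [OF h(1), of "v - u"] that by (simp add: min_def)
    qed
    fix u assume u: "u \<le> length xs \<and> nonneg_bridge (rev (take u xs)) \<and> positive_bridge (drop u xs)"
    show "u = t"
      using * [of u t] * [of t u] u A B t by (meson linorder_neqE_nat)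
  qed
qed

text \<open>As no area is negative, a zero of the area is a minimum, and the last one is at height 0
  for the same reason as in \<open>split_bridge\<close>.\<close>

lemma split_nonneg_bridge:
  assumes "nonneg_bridge xs"
  shows "\<exists>!t. t \<le> length xs \<and> zero_area_bridge (take t xs) \<and> positive_bridge (drop t xs)"
proof -
  have h: "height xs = 0" and nn: "\<And>t. t \<le> length xs \<Longrightarrow> area (take t xs) \<ge> 0"
    using assms by (auto simp: nonneg_bridge_def nonneg_def)
  obtain t where t: "t \<le> length xs" "area (take t xs) = 0"
    and t_max: "\<And>r. t < r \<Longrightarrow> r \<le> length xs \<Longrightarrow> area (take r xs) \<noteq> 0"
    using last_index_exists [of "\<lambda>t. area (take t xs) = 0" "length xs"] by auto
  have t_pos: "area (take r xs) > 0" if "t < r" "r \<le> length xs" for r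
    using t_max [OF that] nn [OF that(2)] by simp
  have h0: "height (take t xs) = 0"
  proof (cases "t = length xs")
    case False
    then have tl: "t < length xs" using t by simp
    have "height (take (Suc t) xs) > 0"
      using t_pos [of "Suc t"] area_take_Suc [OF tl] t tl by auto
    moreover have "height (take t xs) \<le> 0"
      using area_take_Suc [of "t - 1" xs] nn [of "t - 1"] t tl by (cases t) auto
    ultimately show ?thesis
      using height_take_Suc [OF tl] step_bounds [of "xs ! t"] by auto
  qed (use h in simp)
  have A: "zero_area_bridge (take t xs)"
    unfolding zero_area_bridge_def nonneg_bridge_def nonneg_def using h0 nn t by auto
  have B: "positive_bridge (drop t xs)"
    unfolding positive_bridge_def
  proof (intro conjI allI impI)
    show "height (drop t xs) = 0"
      using height_simps(3) [of "take t xs" "drop t xs"] h h0 by simp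
    fix r assume "1 \<le> r \<and> r \<le> length (drop t xs)"
    then show "area (take r (drop t xs)) > 0"
      using t_pos [of "t + r"] area_take_drop(1) [OF h0, of r] t by auto
  qed
  show ?thesis
  proof (rule ex1I [of _ t])
    show "t \<le> length xs \<and> zero_area_bridge (take t xs) \<and> positive_bridge (drop t xs)"
      using A B t by auto
  next
    have *: False if "u \<le> length xs" "zero_area_bridge (take u xs)" "positive_bridge (drop u xs)"
      "v \<le> length xs" "zero_area_bridge (take v xs)" "u < v" for u v
    proof -
      have h: "height (take u xs) = 0" "area (take u xs) = 0" "area (take v xs) = 0"
        using that(2,5) by (auto simp: zero_area_bridge_def nonneg_bridge_def)
      have "area (take (v - u) (drop u xs)) > 0"
        using that by (intro positive_bridgeD) auto
      then show False
        using area_take_drop(1) [OF h(1), of "v - u"] that h by simp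
    qed
    fix u assume u: "u \<le> length xs \<and> zero_area_bridge (take u xs) \<and> positive_bridge (drop u xs)"
    show "u = t"
      using * [of u t] * [of t u] u A B t by (meson linorder_neqE_nat)
  qed
qed

text \<open>Returns of the pair (height, area) to (0, 0) are renewals: from there on, heights and
  areas are those of the remaining walk alone. The cut is the last renewal before the end.\<close>

lemma split_zero_area_bridge:
  assumes "zero_area_bridge xs" "xs \<noteq> []"
  shows "\<exists>!t. t \<le> length xs \<and> zero_area_bridge (take t xs) \<and> primitive_bridge (drop t xs)"
proof -
  have h: "height xs = 0" "area xs = 0" and nn: "\<And>t. t \<le> length xs \<Longrightarrow> area (take t xs) \<ge> 0"
    using assms by (auto simp: zero_area_bridge_def nonneg_bridge_def nonneg_def)
  \<comment> \<open>The bound \<open>length xs - 1\<close> excludes the end of the walk, so that the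
    last piece is nonempty.\<close>
  obtain t where t: "t \<le> length xs - 1" "height (take t xs) = 0 \<and> area (take t xs) = 0"
    and t_max: "\<And>r. t < r \<Longrightarrow> r \<le> length xs - 1 \<Longrightarrow> \<not> (height (take r xs) = 0 \<and> area (take r xs) = 0)"
    using last_index_exists [of "\<lambda>t. height (take t xs) = 0 \<and> area (take t xs) = 0" "length xs - 1"] by auto
  have tl: "t < length xs" using t assms(2) by (cases xs) auto
  have A: "zero_area_bridge (take t xs)"
    unfolding zero_area_bridge_def nonneg_bridge_def nonneg_def using nn t tl by auto
  have td: "area (take r (drop t xs)) = area (take (t + r) xs)"
    "height (take r (drop t xs)) = height (take (t + r) xs)" for r
    using area_take_drop [of t xs r] t tl by auto
  have hd: "height (drop t xs) = 0" "area (drop t xs) = 0"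
    using td [of "length xs - t"] h tl by auto
  have B: "primitive_bridge (drop t xs)"
    unfolding primitive_bridge_def zero_area_bridge_def nonneg_bridge_def nonneg_def
    using hd tl nn t_max by (auto simp: td)
  show ?thesis
  proof (rule ex1I [of _ t])
    show "t \<le> length xs \<and> zero_area_bridge (take t xs) \<and> primitive_bridge (drop t xs)"
      using A B tl by auto
  next
    have *: False if u: "u \<le> length xs" "zero_area_bridge (take u xs)" "primitive_bridge (drop u xs)"
      and v: "v < length xs" "zero_area_bridge (take v xs)" "u < v" for u v
    proof -
      have h: "height (take u xs) = 0" "area (take u xs) = 0" "area (take v xs) = 0" "height (take v xs) = 0"
        using u v by (auto simp: zero_area_bridge_def nonneg_bridge_def)
      have "height (take (v - u) (drop u xs)) = 0 \<and> area (take (v - u) (drop u xs)) = 0"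
        using area_take_drop [OF h(1), of "v - u"] u v h by simp
      then show False
        using u(3) v unfolding primitive_bridge_def by (auto dest: spec [of _ "v - u"])
    qed
    fix u assume u: "u \<le> length xs \<and> zero_area_bridge (take u xs) \<and> primitive_bridge (drop u xs)"
    then have "u < length xs" by (auto simp: primitive_bridge_def)
    then show "u = t"
      using * [of u t] * [of t u] u A B tl by (meson linorder_neqE_nat less_imp_le)
  qed
qed

text \<open>The cut is at the last visit to a height at most 0. The rest stays at height 1 or more
  and so cannot violate nonnegativity of the areas; the same cut therefore serves walks with and
  without that condition.\<close>

lemma split_height_one:
  assumes "height xs = 1"
  shows "\<exists>!t. t \<le> length xs \<and> height (take t xs) = 0 \<and> excursion_above (drop t xs)"
proof -
  obtain t where t: "t \<le> length xs" "height (take t xs) \<le> 0"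
    and t_max: "\<And>r. t < r \<Longrightarrow> r \<le> length xs \<Longrightarrow> \<not> height (take r xs) \<le> 0"
    using last_index_exists [of "\<lambda>t. height (take t xs) \<le> 0" "length xs"] by auto
  have tl: "t < length xs" using t assms by (cases "t = length xs") auto
  have h0: "height (take t xs) = 0"
    using t_max [of "Suc t"] height_take_Suc [OF tl] step_bounds [of "xs ! t"] t tl by auto
  have hd: "height (take r (drop t xs)) = height (take (t + r) xs)" for r
    using area_take_drop(2) [OF h0, of r] tl by auto
  have B: "excursion_above (drop t xs)"
    unfolding excursion_above_def
  proof (intro conjI allI impI)
    show "height (drop t xs) = 1"
      using hd [of "length xs - t"] assms tl by simp
    fix r assume "1 \<le> r \<and> r \<le> length (drop t xs)"
    then have "t < t + r" "t + r \<le> length xs" using tl by auto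
    then have "\<not> height (take (t + r) xs) \<le> 0" by (rule t_max)
    then show "1 \<le> height (take r (drop t xs))" by (simp add: hd)
  qed
  show ?thesis
  proof (rule ex1I [of _ t])
    show "t \<le> length xs \<and> height (take t xs) = 0 \<and> excursion_above (drop t xs)"
      using h0 B tl by auto
  next
    have *: False if u: "u \<le> length xs" "height (take u xs) = 0" "excursion_above (drop u xs)"
      and v: "v \<le> length xs" "height (take v xs) = 0" "u < v" for u v
    proof -
      have "height (take (v - u) (drop u xs)) \<ge> 1"
        using u v unfolding excursion_above_def by (auto dest: spec [of _ "v - u"])
      then show False
        using area_take_drop(2) [OF u(2,1), of "v - u"] v by simp
    qed
    fix u assume u: "u \<le> length xs \<and> height (take u xs) = 0 \<and> excursion_above (drop u xs)"
    then show "u = t"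
      using * [of u t] * [of t u] u h0 B tl by (meson linorder_neqE_nat less_imp_le)
  qed
qed

lemma excursion_above_area:
  assumes "excursion_above xs" "t \<le> length xs"
  shows "area (take t xs) \<ge> 0"
  using assms(2)
proof (induction t)
  case (Suc t)
  then show ?case
    using area_take_Suc [of t xs] assms(1) by (auto simp: excursion_above_def dest: spec [of _ "Suc t"])
qed simp

lemma nonneg_append_excursion:
  assumes "height ys = 0" "excursion_above zs"
  shows "nonneg (ys @ zs) \<longleftrightarrow> nonneg ys"
proof
  assume A: "nonneg (ys @ zs)"
  show "nonneg ys"
    unfolding nonneg_def
  proof (intro allI impI)
    fix t assume "t \<le> length ys"
    then show "0 \<le> area (take t ys)" using A unfolding nonneg_def by (auto dest: spec [of _ t])
  qed
qed (use assms nonneg_append excursion_above_area in blast)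

section \<open>Weighted generating functions\<close>

text \<open>Multiplicativity splits the weight at a cut of height 0, where areas add up. Evenness is
  there for \<open>gf_bridge\<close>, which reverses the first piece: reversal negates the area of a
  bridge.\<close>

locale area_weight =
  fixes \<omega> :: "int \<Rightarrow> real"
  assumes weight_add: "\<omega> (a + b) = \<omega> a * \<omega> b" and weight_minus: "\<omega> (- a) = \<omega> a"
    and weight_0: "\<omega> 0 = 1"
begin

definition gf :: "((bool \<times> bool) list \<Rightarrow> bool) \<Rightarrow> real fps" where
  "gf P = Abs_fps (\<lambda>m. (\<Sum>xs | length xs = m \<and> P xs. \<omega> (area xs)) / 4 ^ m)"

end

lemma finite_walks [simp]: "finite {xs :: (bool \<times> bool) list. length xs = m \<and> P xs}"
  by (rule finite_subset [OF _ finite_lists_length_eq [of UNIV m]]) auto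

context area_weight
begin

text \<open>Existence of the cut makes joining surjective, uniqueness makes it injective. The
  involution \<open>\<phi>\<close> is the identity or, for a bridge cut at its last minimum,
  reversal of the first piece.\<close>

lemma gf_mult:
  assumes len: "\<And>ys. length (\<phi> ys) = length ys" and inv: "\<And>ys. \<phi> (\<phi> ys) = ys"
    and split: "\<And>xs. C xs \<Longrightarrow> \<exists>!t. t \<le> length xs \<and> A (\<phi> (take t xs)) \<and> B (drop t xs)"
    and join: "\<And>ys zs. A ys \<Longrightarrow> B zs \<Longrightarrow> C (\<phi> ys @ zs)"
    and weight: "\<And>ys zs. A ys \<Longrightarrow> B zs \<Longrightarrow> \<omega> (area (\<phi> ys @ zs)) = \<omega> (area ys) * \<omega> (area zs)"
  shows "gf C = gf A * gf B"
proof (rule fps_ext)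
  fix m
  let ?D = "SIGMA i:{0..m}. {ys. length ys = i \<and> A ys} \<times> {zs. length zs = m - i \<and> B zs}"
  let ?f = "\<lambda>(i, ys, zs). \<phi> ys @ zs"
  have "inj_on ?f ?D"
  proof (rule inj_onI)
    fix x y assume xy: "x \<in> ?D" "y \<in> ?D" "?f x = ?f y"
    obtain i ys zs j ys' zs' where [simp]: "x = (i, ys, zs)" "y = (j, ys', zs')"
      by (metis prod_cases3)
    have a: "length ys = i" "length ys' = j" "A ys" "A ys'" "B zs" "B zs'" "\<phi> ys @ zs = \<phi> ys' @ zs'"
      using xy by auto
    let ?xs = "\<phi> ys @ zs"
    have "i \<le> length ?xs \<and> A (\<phi> (take i ?xs)) \<and> B (drop i ?xs)"
      using a(1,3,5) by (simp add: len inv)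
    moreover have "j \<le> length ?xs \<and> A (\<phi> (take j ?xs)) \<and> B (drop j ?xs)"
      unfolding a(7) using a(2,4,6) by (simp add: len inv)
    ultimately have "i = j"
      using split [OF join [OF a(3,5)]] by blast
    with a have "\<phi> ys = \<phi> ys'" "zs = zs'"
      by (metis append_eq_append_conv len)+
    then show "x = y" using \<open>i = j\<close> by simp (metis inv)
  qed
  note inj = this
  have im: "?f ` ?D = {xs. length xs = m \<and> C xs}"
  proof (intro equalityI subsetI)
    fix xs assume "xs \<in> {xs. length xs = m \<and> C xs}"
    then have xs: "length xs = m" "C xs" by auto
    obtain t where t: "t \<le> length xs" "A (\<phi> (take t xs))" "B (drop t xs)"
      using split [OF xs(2)] by blast
    have 1: "(t, \<phi> (take t xs), drop t xs) \<in> ?D"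
      using t xs by (simp add: len)
    have 2: "?f (t, \<phi> (take t xs), drop t xs) = xs"
      by (simp add: inv)
    show "xs \<in> ?f ` ?D" using imageI [OF 1, of ?f] unfolding 2 .
  qed (use join in \<open>auto simp: len\<close>)
  have "(\<Sum>xs | length xs = m \<and> C xs. \<omega> (area xs)) = (\<Sum>x\<in>?D. \<omega> (area (?f x)))"
    unfolding im [symmetric] by (simp add: sum.reindex [OF inj])
  also have "\<dots> = (\<Sum>(i, ys, zs)\<in>?D. \<omega> (area ys) * \<omega> (area zs))"
    by (rule sum.cong) (auto simp: weight)
  also have "\<dots> = (\<Sum>i=0..m. \<Sum>(ys, zs)\<in>{ys. length ys = i \<and> A ys} \<times> {zs. length zs = m - i \<and> B zs}. \<omega> (area ys) * \<omega> (area zs))"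
    by (subst sum.Sigma) auto
  also have "\<dots> = (\<Sum>i=0..m. (\<Sum>ys | length ys = i \<and> A ys. \<omega> (area ys)) * (\<Sum>zs | length zs = m - i \<and> B zs. \<omega> (area zs)))"
    by (simp add: sum_product sum.cartesian_product)
  finally have "(\<Sum>xs | length xs = m \<and> C xs. \<omega> (area xs)) / 4 ^ m =
     (\<Sum>i=0..m. (\<Sum>ys | length ys = i \<and> A ys. \<omega> (area ys)) * (\<Sum>zs | length zs = m - i \<and> B zs. \<omega> (area zs)) / 4 ^ m)"
    by (simp add: sum_divide_distrib)
  also have "\<dots> = (\<Sum>i=0..m. (\<Sum>ys | length ys = i \<and> A ys. \<omega> (area ys)) / 4 ^ i * ((\<Sum>zs | length zs = m - i \<and> B zs. \<omega> (area zs)) / 4 ^ (m - i)))"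
    by (rule sum.cong) (auto simp flip: power_add)
  finally show "gf C $ m = (gf A * gf B) $ m"
    by (simp add: gf_def fps_mult_nth)
qed

lemma gf_bridge: "gf (\<lambda>xs. height xs = 0) = gf nonneg_bridge * gf positive_bridge"
proof (rule gf_mult [where \<phi> = rev])
  show "\<exists>!t. t \<le> length xs \<and> nonneg_bridge (rev (take t xs)) \<and> positive_bridge (drop t xs)"
    if "height xs = 0" for xs using split_bridge [OF that] .
qed (auto simp: nonneg_bridge_def positive_bridge_def area_append area_rev weight_add weight_minus
    diff_conv_add_uminus simp del: add_uminus_conv_diff)

lemma gf_nonneg_bridge: "gf nonneg_bridge = gf zero_area_bridge * gf positive_bridge"
proof (rule gf_mult [where \<phi> = "\<lambda>xs. xs"])
  show "\<exists>!t. t \<le> length xs \<and> zero_area_bridge (take t xs) \<and> positive_bridge (drop t xs)"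
    if "nonneg_bridge xs" for xs using split_nonneg_bridge [OF that] .
next
  fix ys zs assume A: "zero_area_bridge ys" and B: "positive_bridge zs"
  have "area (take t zs) \<ge> 0" if "t \<le> length zs" for t
    using B that by (cases t) (auto simp: positive_bridge_def dest: spec [of _ t] intro: less_imp_le)
  then show "nonneg_bridge (ys @ zs)"
    using A B nonneg_append [of ys zs]
    by (auto simp: zero_area_bridge_def nonneg_bridge_def positive_bridge_def)
qed (auto simp: zero_area_bridge_def nonneg_bridge_def area_append weight_add weight_0)

lemma gf_nonneg_bridge_square:
  "gf nonneg_bridge * gf nonneg_bridge = gf (\<lambda>xs. height xs = 0) * gf zero_area_bridge"
  by (subst (2) gf_nonneg_bridge, subst gf_bridge) (simp add: mult_ac)

lemma gf_Nil_insert: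
  assumes "P []"
  shows "gf P = 1 + gf (\<lambda>xs. P xs \<and> xs \<noteq> [])"
proof (rule fps_ext)
  fix m show "gf P $ m = (1 + gf (\<lambda>xs. P xs \<and> xs \<noteq> [])) $ m"
  proof (cases m)
    case 0
    have "{xs :: (bool \<times> bool) list. length xs = 0 \<and> P xs} = {[]}" using assms by auto
    then show ?thesis using 0 by (simp add: gf_def weight_0)
  next
    case (Suc k)
    have "{xs. length xs = m \<and> P xs} = {xs. length xs = m \<and> P xs \<and> xs \<noteq> []}" using Suc by auto
    then show ?thesis using Suc by (simp add: gf_def)
  qed
qed

lemma gf_zero_area_bridge: "gf zero_area_bridge = 1 + gf zero_area_bridge * gf primitive_bridge"
proof -
  have "gf (\<lambda>xs. zero_area_bridge xs \<and> xs \<noteq> []) = gf zero_area_bridge * gf primitive_bridge"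
  proof (rule gf_mult [where \<phi> = "\<lambda>xs. xs"])
    show "\<exists>!t. t \<le> length xs \<and> zero_area_bridge (take t xs) \<and> primitive_bridge (drop t xs)"
      if "zero_area_bridge xs \<and> xs \<noteq> []" for xs using split_zero_area_bridge that by blast
  next
    fix ys zs assume A: "zero_area_bridge ys" and B: "primitive_bridge zs"
    show "zero_area_bridge (ys @ zs) \<and> ys @ zs \<noteq> []"
      using A B nonneg_append [of ys zs]
      by (auto simp: zero_area_bridge_def nonneg_bridge_def primitive_bridge_def area_append nonneg_def)
  qed (auto simp: zero_area_bridge_def nonneg_bridge_def area_append weight_add weight_0)
  moreover have "zero_area_bridge []"
    by (simp add: zero_area_bridge_def nonneg_bridge_def nonneg_def)
  ultimately show ?thesis using gf_Nil_insert by simp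
qed

lemma gf_height_one: "gf (\<lambda>xs. height xs = 1) = gf (\<lambda>xs. height xs = 0) * gf excursion_above"
proof (rule gf_mult [where \<phi> = "\<lambda>xs. xs"])
  show "\<exists>!t. t \<le> length xs \<and> height (take t xs) = 0 \<and> excursion_above (drop t xs)"
    if "height xs = 1" for xs using split_height_one [OF that] .
qed (auto simp: excursion_above_def area_append weight_add)

lemma gf_nonneg_height_one:
  "gf (\<lambda>xs. height xs = 1 \<and> nonneg xs) = gf nonneg_bridge * gf excursion_above"
proof (rule gf_mult [where \<phi> = "\<lambda>xs. xs"])
  fix xs assume A: "height xs = 1 \<and> nonneg xs"
  have "nonneg (take t xs)" if "t \<le> length xs" for t
    using A that unfolding nonneg_def by auto
  then have "(t \<le> length xs \<and> nonneg_bridge (take t xs) \<and> excursion_above (drop t xs)) \<longleftrightarrow>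
     (t \<le> length xs \<and> height (take t xs) = 0 \<and> excursion_above (drop t xs))" for t
    by (auto simp: nonneg_bridge_def)
  then show "\<exists>!t. t \<le> length xs \<and> nonneg_bridge (take t xs) \<and> excursion_above (drop t xs)"
    using split_height_one A by simp
next
  fix ys zs assume "nonneg_bridge ys" "excursion_above zs"
  then show "height (ys @ zs) = 1 \<and> nonneg (ys @ zs)"
    using nonneg_append_excursion [of ys zs] by (auto simp: nonneg_bridge_def excursion_above_def)
qed (auto simp: nonneg_bridge_def area_append weight_add)

text \<open>Appending a step adds the new height to the area, so a step that ends at height 0 leaves
  the area and the weight unchanged. Nonnegativity of the areas is unaffected by such a step, whence
  the restricted form of \<open>snoc\<close>.\<close>

lemma gf_last_step:
  assumes Nil: "B []" and snoc: "\<And>ys s. height ys + step s = 0 \<Longrightarrow> B (ys @ [s]) \<longleftrightarrow> B ys"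
  shows "gf (\<lambda>xs. height xs = 0 \<and> B xs) = 1 + fps_const (1 / 4) * fps_X * (2 * gf (\<lambda>xs. height xs = 0 \<and> B xs)
    + gf (\<lambda>xs. height xs = - 1 \<and> B xs) + gf (\<lambda>xs. height xs = 1 \<and> B xs))"
proof -
  let ?Q = "\<lambda>h xs. height xs = h \<and> B xs"
  let ?w = "\<lambda>m P. \<Sum>xs | length xs = m \<and> P xs. \<omega> (area xs)"
  have "?w (Suc m) (?Q 0) = 2 * ?w m (?Q 0) + ?w m (?Q (- 1)) + ?w m (?Q 1)" for m
  proof -
    let ?W = "{xs :: (bool \<times> bool) list. length xs = m}"
    have fin: "finite ?W" using finite_walks [of m "\<lambda>_. True"] by simp
    have "?w (Suc m) (?Q 0) = (\<Sum>xs | length xs = Suc m. if ?Q 0 xs then \<omega> (area xs) else 0)"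
      using finite_walks [of "Suc m" "\<lambda>_. True"] by (simp add: sum.inter_filter [symmetric])
    also have "\<dots> = (\<Sum>(ys, s)\<in>?W \<times> UNIV. if ?Q 0 (ys @ [s]) then \<omega> (area (ys @ [s])) else 0)"
    proof (rule sum.reindex_cong [where l = "\<lambda>(ys, s). ys @ [s]"])
      show "{xs :: (bool \<times> bool) list. length xs = Suc m} = (\<lambda>(ys, s). ys @ [s]) ` (?W \<times> UNIV)"
        by (auto simp: length_Suc_conv_rev image_iff)
    qed (auto simp: inj_on_def)
    also have "\<dots> = (\<Sum>s\<in>UNIV. \<Sum>ys\<in>?W. if ?Q 0 (ys @ [s]) then \<omega> (area (ys @ [s])) else 0)"
      using fin by (subst sum.swap) (simp add: sum.cartesian_product)
    also have "\<dots> = (\<Sum>s\<in>UNIV. \<Sum>ys\<in>?W. if ?Q (- step s) ys then \<omega> (area ys) else 0)"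
    proof (intro sum.cong refl)
      fix s ys
      show "(if ?Q 0 (ys @ [s]) then \<omega> (area (ys @ [s])) else 0) = (if ?Q (- step s) ys then \<omega> (area ys) else 0)"
      proof (cases "height ys + step s = 0")
        case True
        have "area (ys @ [s]) = area ys + (height ys + step s)"
          by (simp add: area_append)
        also have "\<dots> = area ys" using True by simp
        finally have "area (ys @ [s]) = area ys" .
        moreover have "height ys = - step s" using True by linarith
        ultimately show ?thesis using snoc [OF True] by simp
      next
        case False
        then have "height ys \<noteq> - step s" by linarith
        then show ?thesis using False by simp
      qed
    qed
    also have "\<dots> = (\<Sum>s\<in>UNIV. ?w m (?Q (- step s)))"
      using fin by (simp add: sum.inter_filter [symmetric])
    also have "(UNIV :: (bool \<times> bool) set) = {(False, False), (True, True), (True, False), (False, True)}"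
      by auto
    finally show ?thesis by (simp add: step_def)
  qed note rec = this
  show ?thesis
  proof (rule fps_ext)
    fix m
    show "gf (?Q 0) $ m = (1 + fps_const (1 / 4) * fps_X * (2 * gf (?Q 0) + gf (?Q (- 1)) + gf (?Q 1))) $ m"
    proof (cases m)
      case 0
      have "{xs :: (bool \<times> bool) list. length xs = 0 \<and> ?Q 0 xs} = {[]}" using Nil by auto
      then show ?thesis using 0 by (simp add: gf_def weight_0 mult.assoc)
    next
      case (Suc k)
      then show ?thesis
        by (simp add: gf_def rec mult.assoc numeral_fps_const field_simps)
    qed
  qed
qed

text \<open>Exchanging the two half-steps reflects the walk and negates its area. This symmetry is
  lost once areas must be nonnegative.\<close>

lemma gf_height_minus_one: "gf (\<lambda>xs. height xs = - 1) = gf (\<lambda>xs. height xs = 1)"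
proof (rule fps_ext)
  fix m
  let ?n = "map prod.swap :: (bool \<times> bool) list \<Rightarrow> _"
  have h: "height (?n xs) = - height xs" and a: "area (?n xs) = - area xs" for xs
    by (induction xs) (auto simp: step_def algebra_simps)
  have "(\<Sum>xs | length xs = m \<and> height xs = - 1. \<omega> (area xs)) = (\<Sum>xs | length xs = m \<and> height xs = 1. \<omega> (area xs))"
    by (rule sum.reindex_bij_witness [where i = ?n and j = ?n])
      (auto simp: h a weight_minus)
  then show "gf (\<lambda>xs. height xs = - 1) $ m = gf (\<lambda>xs. height xs = 1) $ m"
    by (simp add: gf_def)
qed

text \<open>The factor x/4 moves the index from the length n - 1 of a walk to the number n of
  vertices and the normalisation to 4^n.\<close>

definition half_bridges :: "real fps" where
  "half_bridges = fps_const (1 / 4) * fps_X * gf (\<lambda>xs. (height xs = 0 \<or> height xs = - 1) \<and> nonneg xs)"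

text \<open>Walks ending at -1 with nonnegative areas have no cut of their own. The last-step
  recurrences of R and M contain the excursions as R E and M E; eliminating E expresses the missing
  series through R and M. Multiplying by 2 R avoids division.\<close>

lemma half_bridges_eq:
  "2 * gf (\<lambda>xs. height xs = 0) * half_bridges =
     gf nonneg_bridge * gf (\<lambda>xs. height xs = 0) + gf nonneg_bridge - 2 * gf (\<lambda>xs. height xs = 0)"
proof -
  let ?R = "gf (\<lambda>xs. height xs = 0)" and ?M = "gf nonneg_bridge" and ?E = "gf excursion_above"
  let ?N = "gf (\<lambda>xs. height xs = - 1 \<and> nonneg xs)" and ?x = "fps_const (1 / 4) * fps_X :: real fps"
  have 1: "?R = 1 + ?x * (2 * ?R + 2 * (?R * ?E))"
    using gf_last_step [of "\<lambda>_. True"] by (simp add: gf_height_minus_one gf_height_one algebra_simps)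
  have "nonneg (ys @ [s]) \<longleftrightarrow> nonneg ys" if "height ys + step s = 0" for ys s
  proof
    assume "nonneg (ys @ [s])"
    then have *: "\<forall>t\<le>length ys + 1. 0 \<le> area (take t (ys @ [s]))" by (simp add: nonneg_def)
    show "nonneg ys" unfolding nonneg_def
    proof (intro allI impI)
      fix t assume "t \<le> length ys"
      then show "0 \<le> area (take t ys)" using * [rule_format, of t] by simp
    qed
  next
    assume *: "nonneg ys"
    have "area (ys @ [s]) = area ys + (height ys + step s)"
      by (simp add: area_append)
    also have "\<dots> = area ys" using that by simp
    finally have "area (ys @ [s]) = area ys" .
    moreover have "area ys \<ge> 0" using * by (auto simp: nonneg_def dest: spec [of _ "length ys"])
    ultimately show "nonneg (ys @ [s])"
      using * by (auto simp: nonneg_def le_Suc_eq)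
  qed
  moreover have "nonneg []" by (simp add: nonneg_def)
  ultimately have "gf (\<lambda>xs. height xs = 0 \<and> nonneg xs) = 1 + ?x * (2 * gf (\<lambda>xs. height xs = 0 \<and> nonneg xs)
    + ?N + gf (\<lambda>xs. height xs = 1 \<and> nonneg xs))"
    using gf_last_step [of nonneg] by blast
  moreover have M: "(\<lambda>xs. height xs = 0 \<and> nonneg xs) = nonneg_bridge"
    by (auto simp: nonneg_bridge_def)
  ultimately have 2: "?M = 1 + ?x * (2 * ?M + ?N + ?M * ?E)"
    by (simp add: gf_nonneg_height_one)
  have "gf (\<lambda>xs. (height xs = 0 \<or> height xs = - 1) \<and> nonneg xs) = ?M + ?N"
  proof (rule fps_ext)
    fix m
    have "{xs. length xs = m \<and> (height xs = 0 \<or> height xs = - 1) \<and> nonneg xs} =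
      {xs. length xs = m \<and> nonneg_bridge xs} \<union> {xs. length xs = m \<and> height xs = - 1 \<and> nonneg xs}"
      by (auto simp: nonneg_bridge_def)
    moreover have "{xs. length xs = m \<and> nonneg_bridge xs} \<inter> {xs. length xs = m \<and> height xs = - 1 \<and> nonneg xs} = {}"
      by (auto simp: nonneg_bridge_def)
    ultimately show "gf (\<lambda>xs. (height xs = 0 \<or> height xs = - 1) \<and> nonneg xs) $ m = (?M + ?N) $ m"
      by (simp add: gf_def sum.union_disjoint add_divide_distrib)
  qed
  then have H: "half_bridges = ?x * (?M + ?N)" by (simp add: half_bridges_def)
  have 3: "?R - 1 - 2 * ?x * ?R = 2 * ?x * ?R * ?E"
    using 1 by (simp add: algebra_simps)
  have 4: "?x * ?N = ?M - 1 - 2 * ?x * ?M - ?x * ?M * ?E"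
    using 2 by (simp add: algebra_simps)
  have "2 * ?R * half_bridges = 2 * ?R * ?x * ?M + 2 * ?R * (?x * ?N)"
    unfolding H by (simp add: algebra_simps)
  also have "\<dots> = 2 * ?R * ?x * ?M + 2 * ?R * (?M - 1 - 2 * ?x * ?M) - ?M * (2 * ?x * ?R * ?E)"
    unfolding 4 by (simp add: algebra_simps)
  also have "\<dots> = ?M * ?R + ?M - 2 * ?R"
    unfolding 3 [symmetric] by (simp add: algebra_simps)
  finally show ?thesis .
qed

end

section \<open>Walks with zero area\<close>

definition walks :: "nat \<Rightarrow> (bool \<times> bool) list set" where
  "walks m = {xs. length xs = m}"

lemma finite_walks_length [simp]: "finite (walks m)"
  using finite_walks [of m "\<lambda>_. True"] by (simp add: walks_def)

lemma sum_walks_Suc: "(\<Sum>xs\<in>walks (Suc m). f xs) = (\<Sum>s\<in>UNIV. \<Sum>xs\<in>walks m. f (s # xs))"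
proof -
  have "(\<Sum>xs\<in>walks (Suc m). f xs) = (\<Sum>(s, xs)\<in>UNIV \<times> walks m. f (s # xs))"
  proof (rule sum.reindex_cong [where l = "\<lambda>(s, xs). s # xs"])
    show "walks (Suc m) = (\<lambda>(s, xs). s # xs) ` (UNIV \<times> walks m)"
      by (auto simp: walks_def length_Suc_conv image_iff)
  qed (auto simp: inj_on_def)
  then show ?thesis by (simp add: sum.cartesian_product)
qed

lemma UNIV_steps: "(UNIV :: (bool \<times> bool) set) = {(False, False), (True, True), (True, False), (False, True)}"
  by auto

text \<open>The j-th step from the end is counted j times in the area, so the characteristic
  function of the area is a product over independent steps, the four values of a step giving 2 + 2
  cos.\<close>

lemma sum_cis_area:
  "(\<Sum>xs\<in>walks m. cis (\<theta> * of_int (area xs))) = of_real (\<Prod>j=1..m. 2 + 2 * cos (\<theta> * real j))"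
proof (induction m)
  case 0
  have "walks 0 = {[]}" by (auto simp: walks_def)
  then show ?case by simp
next
  case (Suc m)
  have "(\<Sum>xs\<in>walks (Suc m). cis (\<theta> * of_int (area xs)))
    = (\<Sum>s\<in>UNIV. \<Sum>xs\<in>walks m. cis (\<theta> * ((real m + 1) * of_int (step s))) * cis (\<theta> * of_int (area xs)))"
    unfolding sum_walks_Suc by (intro sum.cong refl) (simp add: walks_def cis_mult algebra_simps)
  also have "\<dots> = (\<Sum>s\<in>UNIV. cis (\<theta> * ((real m + 1) * of_int (step s)))) * (\<Sum>xs\<in>walks m. cis (\<theta> * of_int (area xs)))"
    by (simp add: sum_product)
  also have "(\<Sum>s\<in>UNIV. cis (\<theta> * ((real m + 1) * of_int (step s)))) = of_real (2 + 2 * cos (\<theta> * real (Suc m)))"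
  proof -
    have "\<theta> * (- 1 - real m) = - (\<theta> * (1 + real m))" by (simp add: algebra_simps)
    then show ?thesis by (simp add: UNIV_steps step_def complex_eq_iff add.commute)
  qed
  finally show ?case using Suc.IH by (simp add: mult_ac)
qed

text \<open>The sum is N if N divides a and 0 otherwise. The inequality needs no divisibility test:
  it only distinguishes whether the ratio of the geometric sum is 1.\<close>

lemma sum_cis_roots:
  assumes "N > 0"
  shows "Re (\<Sum>t<N. cis (2 * pi * real t / real N * of_int a)) \<ge> (if a = 0 then real N else 0)"
proof -
  have pow: "cis (2 * pi * real t / real N * of_int a) = cis (2 * pi / real N * of_int a) ^ t" for t
  proof -
    have "2 * pi * real t / real N * of_int a = real t * (2 * pi / real N * of_int a)" by simp
    then show ?thesis unfolding Complex.DeMoivre by (rule arg_cong)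
  qed
  show ?thesis
  proof (cases "cis (2 * pi / real N * of_int a) = 1")
    case True
    then show ?thesis unfolding pow by simp
  next
    case False
    have "(\<Sum>t<N. cis (2 * pi * real t / real N * of_int a)) = (\<Sum>t<N. cis (2 * pi / real N * of_int a) ^ t)"
      unfolding pow ..
    also have "\<dots> = (cis (2 * pi / real N * of_int a) ^ N - 1) / (cis (2 * pi / real N * of_int a) - 1)"
      using False by (rule geometric_sum)
    also have "cis (2 * pi / real N * of_int a) ^ N = cis (2 * pi * of_int a)"
      using assms by (simp add: Complex.DeMoivre)
    also have "\<dots> = 1" by (simp add: cis_multiple_2pi)
    finally have "(\<Sum>t<N. cis (2 * pi * real t / real N * of_int a)) = 0" by simp
    moreover have "a \<noteq> 0" using False by auto
    ultimately show ?thesis by simp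
  qed
qed

text \<open>Fourier inversion modulo \<open>N\<close>, bounding the number of walks of area 0 by the number of those whose area
  is divisible by \<open>N\<close>.\<close>

lemma card_zero_area_le:
  assumes "N > 0"
  shows "real N * real (card {xs\<in>walks m. area xs = 0})
    \<le> 4 ^ m * (\<Sum>t<N. exp (- (\<Sum>j=1..m. (sin (pi * real t / real N * real j))\<^sup>2)))"
proof -
  have "real N * real (card {xs\<in>walks m. area xs = 0}) = (\<Sum>xs\<in>walks m. if area xs = 0 then real N else 0)"
    by (simp add: sum.inter_filter [symmetric])
  also have "\<dots> \<le> (\<Sum>xs\<in>walks m. Re (\<Sum>t<N. cis (2 * pi * real t / real N * of_int (area xs))))"
    by (intro sum_mono sum_cis_roots assms)
  also have "\<dots> = Re (\<Sum>t<N. \<Sum>xs\<in>walks m. cis (2 * pi * real t / real N * of_int (area xs)))"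
    by (subst sum.swap) simp
  also have "\<dots> = (\<Sum>t<N. \<Prod>j=1..m. 2 + 2 * cos (2 * pi * real t / real N * real j))"
    unfolding sum_cis_area Re_sum by (simp only: Re_complex_of_real)
  also have "\<dots> \<le> (\<Sum>t<N. 4 ^ m * exp (- (\<Sum>j=1..m. (sin (pi * real t / real N * real j))\<^sup>2)))"
  proof (rule sum_mono)
    fix t
    let ?y = "\<lambda>j. pi * real t / real N * real j"
    \<comment> \<open>The left side is \<open>4 * (1 - s)\<close> with
      \<open>s = (sin (?y j))\<^sup>2\<close>, and \<open>1 - s \<le> exp (- s)\<close>.\<close>
    have "2 + 2 * cos (2 * ?y j) \<le> 4 * exp (- (sin (?y j))\<^sup>2)" for j
      using exp_ge_add_one_self [of "- (sin (?y j))\<^sup>2"] by (simp only: cos_double_sin) simp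
    then have "2 + 2 * cos (2 * pi * real t / real N * real j) \<le> 4 * exp (- (sin (?y j))\<^sup>2)" for j
      by (metis mult.assoc times_divide_eq_right)
    moreover have "2 + 2 * cos x \<ge> 0" for x :: real
      using cos_ge_minus_one [of x] by linarith
    ultimately have "(\<Prod>j=1..m. 2 + 2 * cos (2 * pi * real t / real N * real j)) \<le> (\<Prod>j=1..m. 4 * exp (- (sin (?y j))\<^sup>2))"
      by (intro prod_mono) auto
    also have "\<dots> = 4 ^ m * exp (- (\<Sum>j=1..m. (sin (?y j))\<^sup>2))"
      by (simp add: prod.distrib exp_sum flip: sum_negf)
    finally show "(\<Prod>j=1..m. 2 + 2 * cos (2 * pi * real t / real N * real j)) \<le> 4 ^ m * exp (- (\<Sum>j=1..m. (sin (?y j))\<^sup>2))" .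
  qed
  finally show ?thesis by (simp add: sum_distrib_left)
qed

text \<open>Jordan's inequality: on [0, pi/2] the concave sine lies above its chord.\<close>

lemma sin_ge_two_x_over_pi:
  assumes "0 \<le> x" "x \<le> 1 / 2"
  shows "2 * x \<le> sin (pi * x)"
proof -
  have "convex_on {0..pi/2} (\<lambda>x. - sin x)"
  proof (rule f''_ge0_imp_convex)
    show "((\<lambda>x. - sin x) has_real_derivative - cos x) (at x)" for x :: real
      by (auto intro!: derivative_eq_intros)
    show "((\<lambda>x. - cos x) has_real_derivative sin x) (at x)" for x :: real
      by (auto intro!: derivative_eq_intros)
    show "0 \<le> sin x" if "x \<in> {0..pi/2}" for x
      using that by (intro sin_ge_zero) auto
  qed auto
  then have "- sin ((1 - 2 * x) *\<^sub>R 0 + (2 * x) *\<^sub>R (pi / 2)) \<le> (1 - 2 * x) * - sin 0 + (2 * x) * - sin (pi / 2)"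
    using assms by (intro convex_onD) auto
  then show ?thesis by (simp add: mult.commute)
qed

text \<open>The Dirichlet kernel by telescoping, kept free of division by
  \<open>sin y\<close>.\<close>

lemma sum_cos_double:
  "2 * sin y * (\<Sum>j=1..m. cos (2 * y * real j)) = sin ((2 * real m + 1) * y) - sin y"
proof (induction m)
  case (Suc m)
  have "2 * sin y * cos (2 * y * real (Suc m)) = sin ((2 * real (Suc m) + 1) * y) - sin ((2 * real m + 1) * y)"
  proof -
    have "(2 * real (Suc m) + 1) * y = 2 * y * real (Suc m) + y" "(2 * real m + 1) * y = 2 * y * real (Suc m) - y"
      by (auto simp: algebra_simps)
    then show ?thesis by (simp only: sin_add sin_diff) simp
  qed
  then show ?case using Suc by (simp add: distrib_left)
qed simp

text \<open>For x at most 1/(2m) every argument stays in the range of Jordan's inequality, and the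
  squares sum to at least m^3/3. For larger x the sine of pi x exceeds 1/m, so the Dirichlet kernel
  bounds the cosine sum by m/2, which leaves m/4.\<close>

lemma sum_sin_squared_ge:
  assumes "0 \<le> x" "x \<le> 1 / 2" "m > 0"
  shows "(\<Sum>j=1..m. (sin (pi * x * real j))\<^sup>2) \<ge> min (real m / 4) (x\<^sup>2 * real m ^ 3)"
proof (cases "x \<le> 1 / (2 * real m)")
  case True
  have "4 * x\<^sup>2 * (real j)\<^sup>2 \<le> (sin (pi * x * real j))\<^sup>2" if "j \<in> {1..m}" for j
  proof -
    have "x * real j \<le> 1 / (2 * real m) * real m"
      using that True assms by (intro mult_mono) auto
    then have "2 * (x * real j) \<le> sin (pi * (x * real j))"
      using assms by (intro sin_ge_two_x_over_pi) auto
    then have "(2 * (x * real j))\<^sup>2 \<le> (sin (pi * (x * real j)))\<^sup>2"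
      using assms by (intro power_mono) auto
    then show ?thesis by (simp add: power_mult_distrib mult.assoc)
  qed
  then have "(\<Sum>j=1..m. 4 * x\<^sup>2 * (real j)\<^sup>2) \<le> (\<Sum>j=1..m. (sin (pi * x * real j))\<^sup>2)"
    by (rule sum_mono)
  moreover have "(\<Sum>j=1..m. (real j)\<^sup>2) \<ge> real m ^ 3 / 3" for m
  proof (induction m)
    case (Suc m)
    then show ?case by (simp add: power2_eq_square power3_eq_cube algebra_simps)
  qed simp
  then have "(\<Sum>j=1..m. 4 * x\<^sup>2 * (real j)\<^sup>2) \<ge> 4 * x\<^sup>2 * (real m ^ 3 / 3)"
    unfolding sum_distrib_left [symmetric] by (intro mult_left_mono) auto
  moreover have "4 * x\<^sup>2 * (real m ^ 3 / 3) \<ge> x\<^sup>2 * real m ^ 3"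
    by simp
  ultimately show ?thesis by linarith
next
  case False
  let ?C = "\<Sum>j=1..m. cos (2 * (pi * x) * real j)"
  have "2 * x > 1 / real m" using False assms by (simp add: field_simps)
  then have s: "sin (pi * x) > 1 / real m"
    using sin_ge_two_x_over_pi [OF assms(1,2)] by linarith
  have s0: "sin (pi * x) > 0" using s assms(3) by (smt (verit) of_nat_0_less_iff zero_less_divide_1_iff)
  have "2 * sin (pi * x) * ?C \<le> 1"
    unfolding sum_cos_double using s0 sin_le_one [of "(2 * real m + 1) * (pi * x)"] by linarith
  also have "1 \<le> sin (pi * x) * real m"
    using s assms(3) by (simp add: field_simps)
  finally have "2 * ?C \<le> real m" using s0 by (simp add: mult.assoc mult_le_cancel_left_pos mult.left_commute [of 2])
  moreover have "(\<Sum>j=1..m. (sin (pi * x * real j))\<^sup>2) = (\<Sum>j=1..m. 1 / 2 - cos (2 * (pi * x) * real j) / 2)"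
  proof (rule sum.cong)
    fix j
    show "(sin (pi * x * real j))\<^sup>2 = 1 / 2 - cos (2 * (pi * x) * real j) / 2"
      using cos_double_sin [of "pi * x * real j"] by (simp add: mult.assoc diff_divide_distrib)
  qed simp
  ultimately show ?thesis by (simp add: sum_subtractf sum_divide_distrib [symmetric])
qed

text \<open>With \<open>N\<close> of order \<open>m powr (5/4)\<close>, every nonzero frequency \<open>t / N\<close> is large enough for its
  contribution to be exponentially small in \<open>sqrt m\<close>.\<close>

lemma sum_exp_sin_squared_le:
  assumes "N > 0" "m > 0" "real N \<le> real m powr (5/4) + 1"
  shows "(\<Sum>t<N. exp (- (\<Sum>j=1..m. (sin (pi * real t / real N * real j))\<^sup>2)))
    \<le> 1 + real N * exp (- (sqrt (real m) / 4))"
proof -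
  let ?S = "\<lambda>t. \<Sum>j=1..m. (sin (pi * real t / real N * real j))\<^sup>2"
  have "?S t \<ge> sqrt (real m) / 4" if t: "t \<in> {1..<N}" for t
  proof -
    have m1: "real m \<ge> 1" using assms(2) by simp
    \<comment> \<open>The squared sines do not change under the reflection of \<open>t\<close> to
      \<open>N - t\<close>, so the frequency can be folded into [0, 1/2].\<close>
    define u where "u = (if 2 * t \<le> N then t else N - t)"
    have u: "1 \<le> u" "2 * u \<le> N" using t by (auto simp: u_def)
    have "?S t = (\<Sum>j=1..m. (sin (pi * (real u / real N) * real j))\<^sup>2)"
    proof (cases "2 * t \<le> N")
      case False
      have "(sin (pi * real t / real N * real j))\<^sup>2 = (sin (pi * (real u / real N) * real j))\<^sup>2" for j
      proof -
        have "pi * (real u / real N) * real j = real j * pi - pi * real t / real N * real j"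
          using False t assms(1) by (simp add: u_def of_nat_diff field_simps)
        then show ?thesis
          by (simp add: sin_diff power_mult_distrib flip: power_mult)
      qed
      then show ?thesis by simp
    qed (simp add: u_def)
    also have "\<dots> \<ge> min (real m / 4) ((real u / real N)\<^sup>2 * real m ^ 3)"
      using u assms by (intro sum_sin_squared_ge) (auto simp: field_simps)
    moreover have "real m / 4 \<ge> sqrt (real m) / 4"
      using m1 by (simp add: real_sqrt_le_iff real_le_lsqrt power2_eq_square)
    \<comment> \<open>The smallest nonzero frequency is 1/N, and N is at most 2 m^(5/4); the
      exponents leave 3 - 5/2 = 1/2.\<close>
    moreover have "(real u / real N)\<^sup>2 * real m ^ 3 \<ge> sqrt (real m) / 4"
    proof -
      have "real N \<le> 2 * real m powr (5/4)"
        using assms(3) ge_one_powr_ge_zero [OF m1, of "5/4"] by simp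
      then have "1 / (2 * real m powr (5/4)) \<le> real u / real N"
        using u assms by (intro frac_le) auto
      then have "(1 / (2 * real m powr (5/4)))\<^sup>2 * real m ^ 3 \<le> (real u / real N)\<^sup>2 * real m ^ 3"
        by (intro mult_right_mono power_mono) auto
      moreover have "(1 / (2 * real m powr (5/4)))\<^sup>2 * real m ^ 3 = sqrt (real m) / 4"
      proof -
        have "(real m powr (5/4))\<^sup>2 * sqrt (real m) = real m powr (5/4) * real m powr (5/4) * real m powr (1/2)"
          by (simp add: power2_eq_square powr_half_sqrt)
        also have "\<dots> = real m powr (5/4 + 5/4 + 1/2)" by (simp only: powr_add)
        also have "\<dots> = real m ^ 3" using m1 by simp
        finally have "(real m powr (5/4))\<^sup>2 * sqrt (real m) = real m ^ 3" .
        moreover have "real m powr (5/4) \<noteq> 0" using m1 by auto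
        ultimately show ?thesis by (simp add: power_divide power_mult_distrib field_simps)
      qed
      ultimately show ?thesis by simp
    qed
    ultimately show ?thesis by linarith
  qed
  then have "(\<Sum>t\<in>{1..<N}. exp (- ?S t)) \<le> (\<Sum>t\<in>{1..<N}. exp (- (sqrt (real m) / 4)))"
    by (intro sum_mono) auto
  also have "\<dots> \<le> real N * exp (- (sqrt (real m) / 4))" by simp
  finally have "(\<Sum>t\<in>{1..<N}. exp (- ?S t)) \<le> real N * exp (- (sqrt (real m) / 4))" .
  moreover have "(\<Sum>t<N. exp (- ?S t)) = exp (- ?S 0) + (\<Sum>t\<in>{1..<N}. exp (- ?S t))"
    using assms(1) by (simp add: lessThan_atLeast0 sum.atLeast_Suc_lessThan)
  ultimately show ?thesis by simp
qed

text \<open>After division by N the zero frequency contributes 1/N, and the others are bounded by a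
  null sequence times 1/N. The shift to \<open>m + 1\<close> covers \<open>m = 0\<close>, where
  \<open>0 powr (-5/4)\<close> would be 0.\<close>

lemma card_zero_area_bigo:
  obtains K where "\<And>m. real (card {xs\<in>walks m. area xs = 0}) / 4 ^ m \<le> K * (real m + 1) powr (-5/4)"
proof -
  let ?a = "\<lambda>m. real (card {xs\<in>walks m. area xs = 0}) / 4 ^ m"
  have "(\<lambda>m. (real m powr (5/4) + 1) * exp (- (sqrt (real m) / 4))) \<longlonglongrightarrow> 0"
    by real_asymp
  then have "Bseq (\<lambda>m. (real m powr (5/4) + 1) * exp (- (sqrt (real m) / 4)))"
    by (intro convergent_imp_Bseq convergentI)
  then obtain L where L: "\<And>m. norm ((real m powr (5/4) + 1) * exp (- (sqrt (real m) / 4))) \<le> L"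
    by (auto simp: Bseq_def)
  have L0: "0 \<le> L" using L [of 0] by (auto intro: order_trans [OF norm_ge_zero])
  have bound: "?a m * real m powr (5/4) \<le> 1 + L" if "m > 0" for m
  proof -
    define N where "N = nat \<lceil>real m powr (5/4)\<rceil>"
    have "real m powr (5/4) > 0" using that by simp
    then have N: "N > 0" "real N \<le> real m powr (5/4) + 1" "real m powr (5/4) \<le> real N"
      unfolding N_def by (simp, linarith+)
    have "real N * real (card {xs\<in>walks m. area xs = 0}) \<le> 4 ^ m * (1 + real N * exp (- (sqrt (real m) / 4)))"
      by (rule order_trans [OF card_zero_area_le [OF N(1)]])
        (intro mult_left_mono sum_exp_sin_squared_le N that, simp)
    also have "\<dots> \<le> 4 ^ m * (1 + (real m powr (5/4) + 1) * exp (- (sqrt (real m) / 4)))"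
      using N by (intro mult_left_mono add_left_mono mult_right_mono) auto
    also have "\<dots> \<le> 4 ^ m * (1 + L)"
      using L [of m] by (intro mult_left_mono add_left_mono) (auto simp: abs_if split: if_splits)
    finally have "real N * ?a m \<le> 1 + L" by (simp add: field_simps)
    moreover have "real m powr (5/4) * ?a m \<le> real N * ?a m"
      using N by (intro mult_right_mono) auto
    ultimately show ?thesis by (simp add: mult.commute)
  qed
  have "?a m \<le> (1 + L) * 4 * (real m + 1) powr (-5/4)" for m
  proof (cases "m = 0")
    case True
    have "{xs\<in>walks 0. area xs = 0} = {[]}" by (auto simp: walks_def)
    then show ?thesis using True L0 by simp
  next
    case False
    have p: "real m powr (5/4) > 0" using False by simp
    have "(real m + 1) powr (5/4) \<le> (2 * real m) powr (5/4)"
      using False by (intro powr_mono2) auto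
    also have "\<dots> = 2 powr (5/4) * real m powr (5/4)" by (simp add: powr_mult)
    also have "2 powr (5/4) \<le> (2::real) powr 2" by (intro powr_mono) auto
    finally have "(real m + 1) powr (5/4) \<le> 4 * real m powr (5/4)" using p by simp
    then have "?a m * (real m + 1) powr (5/4) \<le> ?a m * (4 * real m powr (5/4))"
      by (intro mult_left_mono) auto
    also have "\<dots> = 4 * (?a m * real m powr (5/4))" by simp
    also have "\<dots> \<le> 4 * (1 + L)" using bound [of m] False by (intro mult_left_mono) auto
    finally show ?thesis by (simp add: powr_minus field_simps)
  qed
  then show ?thesis using that by blast
qed

section \<open>Generating functions of bridges\<close>

text \<open>The series (1 + t x)^a. Roots and inverses are then instances of
  \<open>binomial_fps_mult\<close>, and t records the branch point -1/t.\<close>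

definition binomial_fps :: "real \<Rightarrow> real \<Rightarrow> real fps" where
  "binomial_fps a t = Abs_fps (\<lambda>n. (a gchoose n) * t ^ n)"

lemma binomial_fps_mult: "binomial_fps a t * binomial_fps b t = binomial_fps (a + b) t"
proof (rule fps_ext)
  fix n
  have "(binomial_fps a t * binomial_fps b t) $ n = (\<Sum>k=0..n. (a gchoose k) * (b gchoose (n - k)) * t ^ n)"
    unfolding binomial_fps_def fps_mult_nth fps_nth_Abs_fps
    by (rule sum.cong) (auto simp flip: power_add)
  also have "\<dots> = binomial_fps (a + b) t $ n"
    by (simp add: binomial_fps_def gbinomial_Vandermonde flip: sum_distrib_right)
  finally show "(binomial_fps a t * binomial_fps b t) $ n = binomial_fps (a + b) t $ n" .
qed

lemma binomial_fps_nth_0 [simp]: "binomial_fps a t $ 0 = 1"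
  by (simp add: binomial_fps_def)

lemma binomial_fps_0 [simp]: "binomial_fps 0 t = 1"
proof (rule fps_ext)
  fix n show "binomial_fps 0 t $ n = 1 $ n"
    by (cases n) (auto simp: binomial_fps_def gbinomial_0)
qed

lemma binomial_fps_1: "binomial_fps 1 t = 1 + fps_const t * fps_X"
proof (rule fps_ext)
  fix n
  have "(1 :: real) gchoose n = real (1 choose n)"
    using binomial_gbinomial [of 1 n, where 'a = real] by simp
  then show "binomial_fps 1 t $ n = (1 + fps_const t * fps_X) $ n"
    by (cases "n = 0"; cases "n = 1") (auto simp: binomial_fps_def binomial_eq_0)
qed

lemma abs_gbinomial_le_1:
  assumes "\<bar>a :: real\<bar> \<le> 1"
  shows "\<bar>a gchoose n\<bar> \<le> 1"
proof (induction n)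
  case (Suc n)
  have "(real n + 1) * (a gchoose Suc n) = (a - real n) * (a gchoose n)"
    using gbinomial_mult_1 [of a n] by (simp add: algebra_simps)
  then have "(real n + 1) * \<bar>a gchoose Suc n\<bar> = \<bar>a - real n\<bar> * \<bar>a gchoose n\<bar>"
    by (metis abs_mult abs_of_nonneg add_nonneg_nonneg of_nat_0_le_iff zero_le_one)
  also have "\<dots> \<le> (real n + 1) * 1"
    using assms Suc by (intro mult_mono) auto
  finally show ?case by simp
qed simp

text \<open>These are the coefficients of (1 - x)^(-1/2). The formula identifies the unsigned bridge
  series and also shows that the coefficients are nonnegative.\<close>

lemma central_binomial: "(-1/2 gchoose m) * (-1) ^ m = real (2 * m choose m) / 4 ^ m"
proof (induction m)
  case (Suc m)
  have 1: "(real m + 1) * (-1/2 gchoose Suc m) = (-1/2 - real m) * (-1/2 gchoose m)"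
    using gbinomial_mult_1 [of "-1/2 :: real" m] by (simp add: algebra_simps)
  have 2: "(real m + 1) * real (2 * Suc m choose Suc m) = 2 * (2 * real m + 1) * real (2 * m choose m)"
  proof -
    have a: "real (2 * m choose m) = fact (2 * m) / (fact m * fact m)" for m
      by (simp add: binomial_fact)
    have b: "(fact (2 * Suc m) :: real) = (2 * real m + 2) * (2 * real m + 1) * fact (2 * m)"
      by (simp add: algebra_simps)
    show ?thesis
      unfolding a b by (simp add: divide_simps del: of_nat_Suc) (simp add: algebra_simps)
  qed
  have "(real m + 1) * ((-1/2 gchoose Suc m) * (-1) ^ Suc m) = (real m + 1/2) * ((-1/2 gchoose m) * (-1) ^ m)"
  proof -
    have "(real m + 1) * ((-1/2 gchoose Suc m) * (-1) ^ Suc m) = (real m + 1) * (-1/2 gchoose Suc m) * (-1) ^ Suc m"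
      by (simp only: mult.assoc)
    moreover have "-1/2 - real m = - (real m + 1/2)" by simp
    ultimately show ?thesis unfolding 1 by (simp only: power_Suc mult_minus_left mult_minus_right mult_1_left minus_minus mult.assoc)
  qed
  also have "\<dots> = (real m + 1/2) * (real (2 * m choose m) / 4 ^ m)" by (simp only: Suc)
  also have "\<dots> = (real m + 1) * (real (2 * Suc m choose Suc m) / 4 ^ Suc m)"
    using 2 by (simp add: field_simps)
  finally show ?case by (metis add_pos_nonneg mult_left_cancel of_nat_0_le_iff less_irrefl zero_less_one add.commute)
qed simp

text \<open>Since 1/z + 2 + z = (1 + z)^2 / z, the value at (m, h) is the coefficient of z^(m + h)
  in (1 + z)^(2m). The guard is there because \<open>nat\<close> sends negative arguments to
  0.\<close>

lemma pascal_recurrence: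
  fixes f :: "nat \<Rightarrow> int \<Rightarrow> real"
  assumes "\<And>h. f 0 h = of_bool (h = 0)"
    and rec: "\<And>m h. f (Suc m) h = 2 * f m h + f m (h - 1) + f m (h + 1)"
  shows "f m h = (if h < - int m then 0 else real (2 * m choose nat (int m + h)))"
proof (induction m arbitrary: h)
  case 0
  then show ?case using assms(1) by (auto simp: binomial_eq_0)
next
  case (Suc m)
  consider "h < - int (Suc m)" | "h = - int (Suc m)" | "h = - int m" | "h > - int m" by linarith
  then show ?case
  proof cases
    case 4
    define j where "j = nat (int m + h) - 1"
    have n: "nat (int m + h) = Suc j" "nat (int m + (h - 1)) = j" "nat (int m + (h + 1)) = Suc (Suc j)"
      "nat (int (Suc m) + h) = Suc (Suc j)"
      using 4 by (auto simp: j_def)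
    have l: "\<not> h < - int m" "\<not> h - 1 < - int m" "\<not> h + 1 < - int m" "\<not> h < - int (Suc m)"
      using 4 by auto
    show ?thesis unfolding rec Suc n using l by simp
  qed (auto simp: rec Suc)
qed

context area_weight
begin

definition weight_at :: "nat \<Rightarrow> int \<Rightarrow> real" where
  "weight_at m h = (\<Sum>xs\<in>walks m. if height xs = h then \<omega> (area xs) else 0)"

lemma gf_bridge_nth: "gf (\<lambda>xs. height xs = 0) $ m = weight_at m 0 / 4 ^ m"
proof -
  have "{xs. length xs = m \<and> height xs = 0} = {xs \<in> walks m. height xs = 0}"
    by (auto simp: walks_def)
  then show ?thesis
    by (simp add: gf_def weight_at_def sum.inter_filter [symmetric])
qed

lemma weight_at_0: "weight_at 0 h = of_bool (h = 0)"
proof -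
  have "walks 0 = {[]}" by (auto simp: walks_def)
  then show ?thesis by (simp add: weight_at_def weight_0)
qed

text \<open>Here the first step is removed: it is counted m + 1 times in the area, so its weight
  depends only on the length, and the remaining walk keeps its own area.\<close>

lemma weight_at_Suc:
  "weight_at (Suc m) h = 2 * weight_at m h + \<omega> (int m + 1) * (weight_at m (h - 1) + weight_at m (h + 1))"
proof -
  have "weight_at (Suc m) h = (\<Sum>s\<in>UNIV. \<omega> ((int m + 1) * step s) * weight_at m (h - step s))"
    unfolding weight_at_def sum_walks_Suc sum_distrib_left
    by (intro sum.cong refl) (auto simp: walks_def weight_add algebra_simps)
  also have "\<dots> = 2 * weight_at m h + \<omega> (int m + 1) * weight_at m (h - 1) + \<omega> (- (int m + 1)) * weight_at m (h + 1)"
    by (simp add: UNIV_steps step_def weight_0)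
  finally show ?thesis unfolding weight_minus by (simp add: distrib_left)
qed

end

section \<open>Closed forms of the two bridge series\<close>

abbreviation parity_sign :: "int \<Rightarrow> real" where
  "parity_sign a \<equiv> (if even a then 1 else - 1)"

lemma area_weight_one: "area_weight (\<lambda>_. 1)"
  by (rule area_weight.intro) simp_all

lemma area_weight_parity_sign: "area_weight parity_sign"
  by (rule area_weight.intro) simp_all

interpretation unsigned: area_weight "\<lambda>_. 1"
  by (rule area_weight_one)

interpretation signed: area_weight parity_sign
  by (rule area_weight_parity_sign)

lemma unsigned_bridges: "unsigned.gf (\<lambda>xs. height xs = 0) = binomial_fps (-1/2) (-1)"
proof (rule fps_ext)
  fix m
  have "unsigned.weight_at m 0 = real (2 * m choose m)"
    using pascal_recurrence [of unsigned.weight_at m 0]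
    by (simp add: unsigned.weight_at_0 unsigned.weight_at_Suc)
  then show "unsigned.gf (\<lambda>xs. height xs = 0) $ m = binomial_fps (-1/2) (-1) $ m"
    by (simp only: unsigned.gf_bridge_nth binomial_fps_def central_binomial fps_nth_Abs_fps)
qed

text \<open>Signs of level factors alternate, so two steps multiply by (2 - z - 1/z)(2 + z + 1/z) =
  2 - z^2 - 1/z^2. Heights thus move by 2, and replacing z^2 by -z gives the unsigned
  recurrence.\<close>

lemma signed_weight_at_add2:
  "signed.weight_at (Suc (Suc (2 * p))) h = 2 * signed.weight_at (2 * p) h
     - signed.weight_at (2 * p) (h - 2) - signed.weight_at (2 * p) (h + 2)"
  by (simp add: signed.weight_at_Suc algebra_simps)

lemma signed_weight_at_odd: "odd h \<Longrightarrow> signed.weight_at (2 * p) h = 0"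
  by (induction p arbitrary: h) (auto simp: signed.weight_at_0 signed_weight_at_add2)

lemma signed_weight_at_even: "signed.weight_at (2 * p) 0 = real (2 * p choose p)"
proof -
  let ?f = "\<lambda>p k. parity_sign k * signed.weight_at (2 * p) (2 * k)"
  have "?f p 0 = (if (0::int) < - int p then 0 else real (2 * p choose nat (int p + 0)))"
  proof (rule pascal_recurrence)
    fix m k
    have e: "2 * (k - 1) = 2 * k - 2" "2 * (k + 1) = 2 * k + 2" for k :: int by simp_all
    show "?f (Suc m) k = 2 * ?f m k + ?f m (k - 1) + ?f m (k + 1)"
      unfolding e by (simp add: signed_weight_at_add2)
  qed (simp add: signed.weight_at_0)
  then show ?thesis by simp
qed

lemma fps_square_eq_imp_eq:
  fixes f g :: "real fps"
  assumes "f * f = g * g" "f $ 0 = 1" "g $ 0 > 0"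
  shows "f = g"
proof -
  have "(f - g) * (f + g) = 0" using assms(1) by (simp add: algebra_simps)
  then have "f = g \<or> f = - g" by (simp add: eq_neg_iff_add_eq_0)
  then show ?thesis using assms(2,3) by auto
qed

text \<open>The even coefficients are those of (1 - x^2/4)^(-1/2), and each odd one is half of its
  predecessor, which gives the factor 1 + x/2. Factoring 1 - x^2/4 shows branch points at 2 and
  -2.\<close>

lemma signed_bridges:
  "signed.gf (\<lambda>xs. height xs = 0) = binomial_fps (1/2) (1/2) * binomial_fps (-1/2) (-1/2)"
proof -
  let ?U = "binomial_fps (-1/2) (-1/4) oo fps_X\<^sup>2"
  let ?V = "binomial_fps (-1/2) (1/2) * binomial_fps (-1/2) (-1/2)"
  have U_even: "?U $ (2 * p) = real (2 * p choose p) / 16 ^ p" and U_odd: "?U $ (Suc (2 * p)) = 0" for p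
  proof -
    have nth: "?U $ n = (\<Sum>i=0..n. if n = 2 * i then binomial_fps (-1/2) (-1/4) $ i else 0)" for n
      unfolding fps_compose_nth by (rule sum.cong) (auto simp: fps_X_power_nth simp flip: power_mult)
    have "?U $ (2 * p) = (\<Sum>i=0..2*p. if i = p then binomial_fps (-1/2) (-1/4) $ i else 0)"
      unfolding nth by (rule sum.cong) auto
    also have "\<dots> = (-1/2 gchoose p) * ((-1) ^ p / 4 ^ p)"
      by (simp add: binomial_fps_def flip: power_divide)
    also have "\<dots> = real (2 * p choose p) / (4 ^ p * 4 ^ p)"
      using central_binomial [of p] by simp
    finally show "?U $ (2 * p) = real (2 * p choose p) / 16 ^ p" by (simp flip: power_mult_distrib)
    show "?U $ (Suc (2 * p)) = 0"
      unfolding nth by (rule sum.neutral) presburger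
  qed
  have x0: "(fps_X\<^sup>2 :: real fps) $ 0 = 0" by simp
  \<comment> \<open>\<open>?U\<close> and \<open>?V\<close> are compared through their squares, both
    inverse to 1 - x^2/4; constant term 1 then fixes the root.\<close>
  have "?U * ?U = binomial_fps (-1) (-1/4) oo fps_X\<^sup>2"
    by (simp add: fps_compose_mult_distrib [OF x0, symmetric] binomial_fps_mult)
  moreover have "(binomial_fps (-1) (-1/4) oo fps_X\<^sup>2) * (binomial_fps 1 (-1/4) oo fps_X\<^sup>2) = 1"
    by (simp add: fps_compose_mult_distrib [OF x0, symmetric] binomial_fps_mult)
  moreover have "binomial_fps 1 (-1/4) oo fps_X\<^sup>2 = binomial_fps 1 (1/2) * binomial_fps 1 (-1/2)"
  proof -
    have "binomial_fps 1 (-1/4) oo fps_X\<^sup>2 = 1 + fps_const (-1/4) * fps_X\<^sup>2"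
      unfolding binomial_fps_1 by (simp add: fps_compose_add_distrib fps_compose_mult_distrib [OF x0])
    also have "fps_const (-1/4 :: real) = - (fps_const (1/2) * fps_const (1/2))"
      by (simp add: fps_const_mult)
    also have "1 + - (fps_const (1/2) * fps_const (1/2)) * fps_X\<^sup>2 = (1 + fps_const (1/2) * fps_X) * (1 + - fps_const (1/2) * fps_X :: real fps)"
      by (simp add: power2_eq_square algebra_simps)
    also have "- fps_const (1/2 :: real) = fps_const (-1/2)" by simp
    finally show ?thesis by (simp only: binomial_fps_1)
  qed
  moreover have "?V * ?V * (binomial_fps 1 (1/2) * binomial_fps 1 (-1/2)) = 1"
  proof -
    have "?V * ?V * (binomial_fps 1 (1/2) * binomial_fps 1 (-1/2)) =
      (binomial_fps (-1/2) (1/2) * binomial_fps (-1/2) (1/2) * binomial_fps 1 (1/2)) *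
      (binomial_fps (-1/2) (-1/2) * binomial_fps (-1/2) (-1/2) * binomial_fps 1 (-1/2))"
      by (simp only: mult_ac)
    also have "\<dots> = 1" by (simp add: binomial_fps_mult)
    finally show ?thesis .
  qed
  ultimately have "?U * ?U = ?V * ?V"
    by (metis mult.commute mult_cancel_left mult_zero_left zero_neq_one)
  then have UV: "?U = ?V" by (rule fps_square_eq_imp_eq) simp_all
  have "signed.gf (\<lambda>xs. height xs = 0) = ?U * binomial_fps 1 (1/2)"
  proof (rule fps_ext)
    fix m
    have *: "(?U * binomial_fps 1 (1/2)) $ m = ?U $ m + (if m = 0 then 0 else ?U $ (m - 1) / 2)"
      unfolding binomial_fps_1 by (simp add: distrib_left mult.left_commute [of _ "fps_const _"])
    show "signed.gf (\<lambda>xs. height xs = 0) $ m = (?U * binomial_fps 1 (1/2)) $ m"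
    proof (cases "even m")
      case True
      then obtain p where p: "m = 2 * p" by (elim evenE)
      have "(if m = 0 then 0 else ?U $ (m - 1) / 2) = 0"
        using U_odd [of "p - 1"] p by (cases p) auto
      then show ?thesis
        unfolding * unfolding p signed.gf_bridge_nth signed_weight_at_even U_even by (simp add: power_mult)
    next
      case False
      then obtain p where p: "m = Suc (2 * p)" by (elim oddE) simp
      have "signed.weight_at (Suc (2 * p)) 0 = 2 * real (2 * p choose p)"
        by (simp add: signed.weight_at_Suc signed_weight_at_even signed_weight_at_odd)
      then show ?thesis
        unfolding * unfolding p signed.gf_bridge_nth U_odd using U_even [of p] by (simp add: power_mult)
    qed
  qed
  also have "\<dots> = binomial_fps (-1/2) (1/2) * binomial_fps 1 (1/2) * binomial_fps (-1/2) (-1/2)"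
    unfolding UV by (simp only: mult_ac)
  finally show ?thesis by (simp add: binomial_fps_mult)
qed

section \<open>Coefficient asymptotics\<close>

text \<open>With \<open>real n\<close> instead of \<open>real n + 1\<close> the bound would force a
  zero constant term, as \<open>0 powr (-5/4) = 0\<close>.\<close>

definition decaying :: "real fps \<Rightarrow> bool" where
  "decaying f \<longleftrightarrow> (\<exists>C. \<forall>n. \<bar>f $ n\<bar> \<le> C * (real n + 1) powr (-5/4))"

lemma decayingE:
  assumes "decaying f"
  obtains C where "C \<ge> 0" "\<And>n. \<bar>f $ n\<bar> \<le> C * (real n + 1) powr (-5/4)"
proof -
  obtain C where C: "\<And>n. \<bar>f $ n\<bar> \<le> C * (real n + 1) powr (-5/4)"
    using assms by (auto simp: decaying_def)
  then have "C \<ge> 0" using C [of 0] by simp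
  with C show ?thesis using that by blast
qed

lemma decaying_bound:
  assumes "decaying g" "\<And>n. \<bar>f $ n\<bar> \<le> \<bar>g $ n\<bar>"
  shows "decaying f"
  using assms unfolding decaying_def by (meson order_trans)

lemma decaying_add:
  assumes "decaying f" "decaying g"
  shows "decaying (f + g)"
proof -
  obtain C where C: "\<And>n. \<bar>f $ n\<bar> \<le> C * (real n + 1) powr (-5/4)"
    using assms(1) by (auto simp: decaying_def)
  obtain D where D: "\<And>n. \<bar>g $ n\<bar> \<le> D * (real n + 1) powr (-5/4)"
    using assms(2) by (auto simp: decaying_def)
  have "\<bar>(f + g) $ n\<bar> \<le> (C + D) * (real n + 1) powr (-5/4)" for n
    using C [of n] D [of n] by (simp add: distrib_right)
  then show ?thesis unfolding decaying_def by blast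
qed

lemma decaying_if_convergent:
  assumes "(\<lambda>n. f $ n * (real n + 1) powr (5/4)) \<longlonglongrightarrow> L"
  shows "decaying f"
proof -
  have "Bseq (\<lambda>n. f $ n * (real n + 1) powr (5/4))"
    using assms by (intro convergent_imp_Bseq convergentI)
  then obtain C where C: "\<And>n. norm (f $ n * (real n + 1) powr (5/4)) \<le> C"
    by (auto simp: Bseq_def)
  have "\<bar>f $ n\<bar> \<le> C * (real n + 1) powr (-5/4)" for n
    using C [of n] by (simp add: abs_mult powr_minus field_simps)
  then show ?thesis unfolding decaying_def by blast
qed

lemma summable_decay: "summable (\<lambda>n. (real n + 1) powr (-5/4))"
proof -
  have "summable (\<lambda>n. real n powr (-5/4))" by (simp add: summable_real_powr_iff)
  then have "summable (\<lambda>n. real (Suc n) powr (-5/4))" by (subst summable_Suc_iff)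
  then show ?thesis by (simp add: add.commute)
qed

lemma decaying_summable:
  assumes "decaying f"
  shows "summable (\<lambda>n. f $ n)"
proof -
  obtain C where C: "\<And>n. \<bar>f $ n\<bar> \<le> C * (real n + 1) powr (-5/4)"
    using assms by (auto simp: decaying_def)
  show ?thesis
    by (rule summable_comparison_test' [OF summable_mult [OF summable_decay, of C]]) (use C in auto)
qed

lemma decay_shift:
  assumes "2 * k \<le> n"
  shows "(real (n - k) + 1) powr (-5/4) \<le> 4 * (real n + 1) powr (-5/4)"
proof -
  have "(real (n - k) + 1) powr (-5/4) \<le> ((real n + 1) / 2) powr (-5/4)"
    using assms by (intro powr_mono2') (auto simp: of_nat_diff)
  also have "\<dots> = 2 powr (5/4) * (real n + 1) powr (-5/4)"
    by (simp add: powr_divide powr_minus field_simps)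
  also have "\<dots> \<le> 2 powr 2 * (real n + 1) powr (-5/4)"
    by (intro mult_right_mono powr_mono) auto
  finally show ?thesis by simp
qed

text \<open>In each term of the convolution one index is at least n/2, where the weight is at most 4
  times its value at n; the weight of the other index is summable.\<close>

lemma decaying_mult:
  assumes "decaying f" "decaying g"
  shows "decaying (f * g)"
proof -
  define w where "w n = (real n + 1) powr (-5/4)" for n :: nat
  obtain C where C: "C \<ge> 0" "\<And>n. \<bar>f $ n\<bar> \<le> C * w n"
    using decayingE [OF assms(1)] unfolding w_def by blast
  obtain D where D: "D \<ge> 0" "\<And>n. \<bar>g $ n\<bar> \<le> D * w n"
    using decayingE [OF assms(2)] unfolding w_def by blast
  have w0: "w n \<ge> 0" for n by (simp add: w_def)
  have "\<bar>(f * g) $ n\<bar> \<le> C * D * (8 * suminf w) * w n" for n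
  proof -
    have ww: "w k * w (n - k) \<le> 4 * w n * (w k + w (n - k))" if "k \<le> n" for k
    proof (cases "2 * k \<le> n")
      case True
      then have "w (n - k) \<le> 4 * w n" unfolding w_def by (rule decay_shift)
      then have "w k * w (n - k) \<le> w k * (4 * w n)" by (intro mult_left_mono w0)
      also have "\<dots> \<le> 4 * w n * (w k + w (n - k))" using w0 [of n] w0 [of "n - k"] by (simp add: algebra_simps)
      finally show ?thesis .
    next
      case False
      then have "w (n - (n - k)) \<le> 4 * w n" unfolding w_def by (intro decay_shift) auto
      then have "w k \<le> 4 * w n" using that by simp
      then have "w k * w (n - k) \<le> 4 * w n * w (n - k)" by (intro mult_right_mono w0)
      also have "\<dots> \<le> 4 * w n * (w k + w (n - k))" using w0 [of n] w0 [of k] by (simp add: algebra_simps)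
      finally show ?thesis .
    qed
    have "\<bar>(f * g) $ n\<bar> \<le> (\<Sum>k=0..n. \<bar>f $ k * g $ (n - k)\<bar>)"
      unfolding fps_mult_nth by (rule sum_abs)
    also have "\<dots> \<le> (\<Sum>k=0..n. C * D * (w k * w (n - k)))"
    proof (rule sum_mono)
      fix k
      have "\<bar>f $ k\<bar> * \<bar>g $ (n - k)\<bar> \<le> (C * w k) * (D * w (n - k))"
        using C D w0 by (intro mult_mono) auto
      then show "\<bar>f $ k * g $ (n - k)\<bar> \<le> C * D * (w k * w (n - k))"
        by (simp add: abs_mult mult_ac)
    qed
    also have "\<dots> \<le> (\<Sum>k=0..n. C * D * (4 * w n * (w k + w (n - k))))"
      using C D ww by (intro sum_mono mult_left_mono) auto
    also have "\<dots> = C * D * (4 * w n * ((\<Sum>k=0..n. w k) + (\<Sum>k=0..n. w (n - k))))"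
      by (simp only: sum_distrib_left [symmetric] sum.distrib)
    also have "(\<Sum>k=0..n. w (n - k)) = (\<Sum>k=0..n. w k)"
      using sum.atLeastAtMost_rev [of w 0 n] by simp
    also have "C * D * (4 * w n * ((\<Sum>k=0..n. w k) + (\<Sum>k=0..n. w k))) = C * D * (8 * (\<Sum>k=0..n. w k)) * w n"
      by simp
    also have "\<dots> \<le> C * D * (8 * suminf w) * w n"
    proof (intro mult_right_mono mult_left_mono w0)
      show "sum w {0..n} \<le> suminf w"
        using summable_decay by (intro sum_le_suminf) (auto simp: w_def [abs_def])
    qed (use C D in auto)
    finally show ?thesis .
  qed
  then show ?thesis unfolding decaying_def w_def by blast
qed

text \<open>Dominated convergence for series: for fixed k, the coefficient of g at n - k behaves
  like that at n, so the k-th term tends to L times the k-th coefficient of f. The half of the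
  convolution in which the index of f is large has to vanish in the limit.\<close>

lemma decaying_mult_asymptotics:
  assumes "decaying f" and lim: "(\<lambda>n. g $ n * (real n + 1) powr (3/4)) \<longlonglongrightarrow> L"
  shows "(\<lambda>n. (f * g) $ n * (real n + 1) powr (3/4)) \<longlonglongrightarrow> L * (\<Sum>n. f $ n)"
proof -
  define w where "w n = (real n + 1) powr (-5/4)" for n :: nat
  define v where "v n = (real n + 1) powr (3/4)" for n :: nat
  obtain C where C: "C \<ge> 0" "\<And>n. \<bar>f $ n\<bar> \<le> C * w n"
    using decayingE [OF assms(1)] unfolding w_def by blast
  have "Bseq (\<lambda>n. g $ n * v n)"
    using lim unfolding v_def by (intro convergent_imp_Bseq convergentI)
  then obtain B where B': "B > 0" "\<And>n. norm (g $ n * v n) \<le> B"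
    by (auto simp: Bseq_def)
  have v0: "v n > 0" for n by (simp add: v_def)
  have B: "\<bar>g $ n\<bar> * v n \<le> B" for n
    using B'(2) [of n] v0 [of n] by (simp add: abs_mult)
  \<comment> \<open>The convolution is cut in the middle, and k is the smaller index in both
    families. The strict inequality in \<open>a2\<close> counts the middle term once.\<close>
  define a1 where "a1 k n = (if 2 * k \<le> n then f $ k * g $ (n - k) * v n else 0)" for k n
  define a2 where "a2 k n = (if 2 * k < n then f $ (n - k) * g $ k * v n else 0)" for k n
  have split: "(f * g) $ n * v n = (\<Sum>k. a1 k n + a2 k n)" for n
  proof -
    have "(\<Sum>k. a1 k n + a2 k n) = (\<Sum>k=0..n. a1 k n + a2 k n)"
      by (rule suminf_finite) (auto simp: a1_def a2_def)
    also have "\<dots> = (\<Sum>k=0..n. a1 k n) + (\<Sum>k=0..n. a2 (n - k) n)"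
      using sum.atLeastAtMost_rev [of "\<lambda>k. a2 k n" 0 n] by (simp add: sum.distrib)
    also have "\<dots> = (\<Sum>k=0..n. f $ k * g $ (n - k) * v n)"
      unfolding sum.distrib [symmetric]
      by (rule sum.cong) (auto simp: a1_def a2_def)
    finally show ?thesis by (simp add: fps_mult_nth sum_distrib_right)
  qed
  have bound1: "\<bar>a1 k n\<bar> \<le> 2 * C * B * w k" for k n
  proof (cases "2 * k \<le> n")
    case True
    have "v n \<le> (2 * (real (n - k) + 1)) powr (3/4)"
      unfolding v_def using True by (intro powr_mono2) (auto simp: of_nat_diff)
    also have "\<dots> = 2 powr (3/4) * v (n - k)"
      unfolding v_def by (rule powr_mult; simp)
    also have "\<dots> \<le> 2 powr 1 * v (n - k)"
      using v0 [of "n - k"] by (intro mult_right_mono powr_mono) auto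
    finally have "v n \<le> 2 * v (n - k)" by simp
    then have "\<bar>g $ (n - k)\<bar> * v n \<le> \<bar>g $ (n - k)\<bar> * (2 * v (n - k))"
      by (intro mult_left_mono) auto
    also have "\<dots> \<le> 2 * B" using B [of "n - k"] by simp
    finally have G: "\<bar>g $ (n - k)\<bar> * v n \<le> 2 * B" .
    have "\<bar>f $ k\<bar> * (\<bar>g $ (n - k)\<bar> * v n) \<le> (C * w k) * (2 * B)"
      by (rule mult_mono [OF C(2) G]) (use C(1) v0 [of n] in \<open>auto simp: w_def\<close>)
    then show ?thesis using True v0 [of n] by (simp add: a1_def abs_mult mult_ac)
  next
    case False
    then show ?thesis using C B' by (simp add: a1_def w_def)
  qed
  have bound2: "\<bar>a2 k n\<bar> \<le> 4 * C * B * ((real n + 1) powr (-1/2) * (real k + 1) powr (-3/4))" for k n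
  proof (cases "2 * k < n")
    case True
    have "\<bar>f $ (n - k)\<bar> \<le> C * w (n - k)" by (rule C)
    also have "\<dots> \<le> C * (4 * w n)"
      unfolding w_def using True by (intro mult_left_mono C decay_shift) auto
    finally have f: "\<bar>f $ (n - k)\<bar> \<le> 4 * C * w n" by simp
    have g: "\<bar>g $ k\<bar> \<le> B * (real k + 1) powr (-3/4)"
      using B [of k] by (simp add: v_def powr_minus field_simps)
    have "\<bar>f $ (n - k)\<bar> * \<bar>g $ k\<bar> * v n \<le> (4 * C * w n) * (B * (real k + 1) powr (-3/4)) * v n"
      using f g v0 [of n] C by (intro mult_right_mono mult_mono) (auto simp: w_def)
    also have "\<dots> = 4 * C * B * ((w n * v n) * (real k + 1) powr (-3/4))" by simp
    also have "w n * v n = (real n + 1) powr (-1/2)"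
      unfolding w_def v_def by (simp flip: powr_add)
    finally show ?thesis using True v0 [of n] by (simp add: a2_def abs_mult)
  next
    case False
    then show ?thesis using C B' by (simp add: a2_def)
  qed
  \<comment> \<open>Decay in n is traded for summability in k: as k < n, (n + 1)^(-1/2) is at most
    (k + 1)^(-1/2), and 1/2 + 3/4 = 5/4.\<close>
  have bound2': "\<bar>a2 k n\<bar> \<le> 4 * C * B * w k" for k n
  proof (cases "2 * k < n")
    case True
    have "(real n + 1) powr (-1/2) * (real k + 1) powr (-3/4) \<le> (real k + 1) powr (-1/2) * (real k + 1) powr (-3/4)"
      using True by (intro mult_right_mono powr_mono2') auto
    also have "\<dots> = w k" unfolding w_def by (simp flip: powr_add)
    finally have "4 * C * B * ((real n + 1) powr (-1/2) * (real k + 1) powr (-3/4)) \<le> 4 * C * B * w k"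
      using C B' by (intro mult_left_mono) auto
    then show ?thesis using bound2 [of k n] by linarith
  next
    case False
    then show ?thesis using C B' by (simp add: a2_def w_def)
  qed
  have lim1: "(\<lambda>n. a1 k n) \<longlonglongrightarrow> f $ k * L" for k
  proof -
    have "(\<lambda>n. ((real n + real k + 1) / (real n + 1)) powr (3/4)) \<longlonglongrightarrow> 1" by real_asymp
    then have "(\<lambda>n. f $ k * (g $ n * v n * ((real n + real k + 1) / (real n + 1)) powr (3/4))) \<longlonglongrightarrow> f $ k * (L * 1)"
      using lim unfolding v_def by (intro tendsto_intros)
    moreover have "eventually (\<lambda>n. f $ k * (g $ n * v n * ((real n + real k + 1) / (real n + 1)) powr (3/4)) = a1 k (n + k)) sequentially"
      using eventually_ge_at_top [of k]
    proof eventually_elim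
      case (elim n)
      have "v n * ((real n + real k + 1) / (real n + 1)) powr (3/4) = v (n + k)"
        unfolding v_def by (simp add: powr_divide)
      then show ?case using elim by (simp add: a1_def mult.assoc)
    qed
    ultimately have "(\<lambda>n. a1 k (n + k)) \<longlonglongrightarrow> f $ k * (L * 1)"
      by (rule Lim_transform_eventually)
    then show ?thesis by (simp add: LIMSEQ_offset)
  qed
  have lim2: "(\<lambda>n. a2 k n) \<longlonglongrightarrow> 0" for k
  proof (rule Lim_null_comparison)
    show "eventually (\<lambda>n. norm (a2 k n) \<le> 4 * C * B * ((real n + 1) powr (-1/2) * (real k + 1) powr (-3/4))) sequentially"
      using bound2 by auto
    have "(\<lambda>n. (real n + 1) powr (-1/2)) \<longlonglongrightarrow> 0" by real_asymp
    then have "(\<lambda>n. 4 * C * B * ((real n + 1) powr (-1/2) * (real k + 1) powr (-3/4))) \<longlonglongrightarrow> 4 * C * B * (0 * (real k + 1) powr (-3/4))"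
      by (intro tendsto_intros)
    then show "(\<lambda>n. 4 * C * B * ((real n + 1) powr (-1/2) * (real k + 1) powr (-3/4))) \<longlonglongrightarrow> 0" by simp
  qed
  have "(\<lambda>n. \<Sum>k. a1 k n + a2 k n) \<longlonglongrightarrow> (\<Sum>k. f $ k * L + 0)"
  proof (rule tannerys_theorem [THEN conjunct2, THEN conjunct2])
    show "(\<lambda>n. a1 k n + a2 k n) \<longlonglongrightarrow> f $ k * L + 0" for k
      by (intro tendsto_add lim1 lim2)
    have "norm (a1 k n + a2 k n) \<le> 6 * C * B * w k" for k n
      using bound1 [of k n] bound2' [of k n] by (simp add: algebra_simps)
    then show "\<forall>\<^sub>F (k, n) in at_top \<times>\<^sub>F sequentially. norm (a1 k n + a2 k n) \<le> 6 * C * B * w k"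
      by (intro always_eventually) auto
    show "summable (\<lambda>k. 6 * C * B * w k)"
      unfolding w_def by (intro summable_mult summable_decay)
  qed simp
  then show ?thesis
    unfolding split [symmetric] unfolding v_def
    using suminf_mult [OF decaying_summable [OF assms(1)], of L] by (simp add: mult.commute)
qed

lemma decaying_imp_null:
  assumes "decaying f"
  shows "(\<lambda>n. f $ n * (real n + 1) powr (3/4)) \<longlonglongrightarrow> 0"
proof -
  obtain C where C: "C \<ge> 0" "\<And>n. \<bar>f $ n\<bar> \<le> C * (real n + 1) powr (-5/4)"
    using decayingE [OF assms] by blast
  show ?thesis
  proof (rule Lim_null_comparison)
    show "\<forall>\<^sub>F n in sequentially. norm (f $ n * (real n + 1) powr (3/4)) \<le> C * (real n + 1) powr (-1/2)"
    proof (intro always_eventually allI)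
      fix n
      have "\<bar>f $ n\<bar> * (real n + 1) powr (3/4) \<le> C * (real n + 1) powr (-5/4) * (real n + 1) powr (3/4)"
        by (intro mult_right_mono C) auto
      also have "\<dots> = C * (real n + 1) powr (-1/2)"
        by (simp add: mult.assoc flip: powr_add)
      finally show "norm (f $ n * (real n + 1) powr (3/4)) \<le> C * (real n + 1) powr (-1/2)"
        by (simp add: abs_mult)
    qed
    show "(\<lambda>n. C * (real n + 1) powr (-1/2)) \<longlonglongrightarrow> 0" by real_asymp
  qed
qed

lemma binomial_fps_asymptotics:
  "(\<lambda>n. binomial_fps a (-1) $ n * (real n + 1) powr (a + 1)) \<longlonglongrightarrow> inverse (Gamma (- a))"
proof -
  have 1: "(\<lambda>n. (a gchoose n) / ((-1) ^ n / exp ((a + 1) * ln (real n)))) \<longlonglongrightarrow> inverse (Gamma (- a))"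
    using gbinomial_asymptotic [of a] by simp
  have 2: "(\<lambda>n. ((real n + 1) / real n) powr (a + 1)) \<longlonglongrightarrow> 1 powr (a + 1)"
    by (intro tendsto_powr tendsto_const) (real_asymp, simp)
  have "(\<lambda>n. (a gchoose n) / ((-1) ^ n / exp ((a + 1) * ln (real n))) * ((real n + 1) / real n) powr (a + 1))
    \<longlonglongrightarrow> inverse (Gamma (- a)) * 1 powr (a + 1)"
    by (intro tendsto_mult 1 2)
  moreover have "eventually (\<lambda>n. (a gchoose n) / ((-1) ^ n / exp ((a + 1) * ln (real n))) * ((real n + 1) / real n) powr (a + 1)
     = binomial_fps a (-1) $ n * (real n + 1) powr (a + 1)) sequentially"
    using eventually_gt_at_top [of 0]
  proof eventually_elim
    case (elim n)
    have 1: "exp ((a + 1) * ln (real n)) = real n powr (a + 1)" using elim by (simp add: powr_def)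
    have 2: "((real n + 1) / real n) powr (a + 1) = (real n + 1) powr (a + 1) / real n powr (a + 1)"
      by (simp add: powr_divide)
    have 3: "real n powr (a + 1) \<noteq> 0" using elim by simp
    have 4: "x / ((-1) ^ n / P) * (Q / P) = x * (-1) ^ n * Q" if "P \<noteq> 0" for x P Q :: real
      using that by (cases "even n") auto
    show ?case
      by (simp only: 1 2 4 [OF 3] binomial_fps_def fps_nth_Abs_fps)
  qed
  ultimately have "(\<lambda>n. binomial_fps a (-1) $ n * (real n + 1) powr (a + 1)) \<longlonglongrightarrow> inverse (Gamma (- a)) * 1 powr (a + 1)"
    by (rule Lim_transform_eventually)
  then show ?thesis by simp
qed

lemma decaying_binomial_fps_quarter: "decaying (binomial_fps (1/4) (-1))"
  using binomial_fps_asymptotics [of "1/4"] by (intro decaying_if_convergent) simp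

lemma decaying_binomial_fps_half:
  assumes "\<bar>a\<bar> \<le> 1" "\<bar>t\<bar> = 1/2"
  shows "decaying (binomial_fps a t)"
proof (rule decaying_bound)
  have "(\<lambda>n. (1/2) ^ n * (real n + 1) powr (5/4)) \<longlonglongrightarrow> 0" by real_asymp
  then show "decaying (Abs_fps (\<lambda>n. (1/2) ^ n))"
    by (intro decaying_if_convergent [where L = 0]) simp
  fix n
  have "\<bar>a gchoose n\<bar> * \<bar>t\<bar> ^ n \<le> 1 * \<bar>t\<bar> ^ n"
    by (intro mult_right_mono abs_gbinomial_le_1 assms) simp
  then have "\<bar>a gchoose n\<bar> * \<bar>t\<bar> ^ n \<le> (1/2) ^ n" unfolding assms(2) by simp
  then show "\<bar>binomial_fps a t $ n\<bar> \<le> \<bar>Abs_fps (\<lambda>n. (1/2) ^ n) $ n\<bar>"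
    by (simp add: binomial_fps_def abs_mult power_abs)
qed

lemma decaying_one: "decaying 1"
proof -
  have "\<bar>(1 :: real fps) $ n\<bar> \<le> 1 * (real n + 1) powr (-5/4)" for n by simp
  then show ?thesis unfolding decaying_def by blast
qed

lemma decaying_const_mult:
  assumes "decaying f"
  shows "decaying (fps_const c * f)"
proof -
  obtain C where C: "\<And>n. \<bar>f $ n\<bar> \<le> C * (real n + 1) powr (-5/4)"
    using assms by (auto simp: decaying_def)
  have "\<bar>(fps_const c * f) $ n\<bar> \<le> (\<bar>c\<bar> * C) * (real n + 1) powr (-5/4)" for n
    using mult_left_mono [OF C [of n], of "\<bar>c\<bar>"] by (simp add: abs_mult mult.assoc)
  then show ?thesis unfolding decaying_def by blast
qed

section \<open>The square root of the zero-area generating function\<close>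

context area_weight
begin

definition root_zero_area :: "real fps" where
  "root_zero_area = binomial_fps (-1/2) (-1) oo gf primitive_bridge"

lemma gf_primitive_nth_0: "gf primitive_bridge $ 0 = 0"
  by (simp add: gf_def primitive_bridge_def)

lemma root_zero_area_square: "root_zero_area * root_zero_area = gf zero_area_bridge"
proof -
  let ?\<zeta> = "gf primitive_bridge" and ?Z = "gf zero_area_bridge"
  note distrib = fps_compose_mult_distrib [OF gf_primitive_nth_0]
  have sq: "root_zero_area * root_zero_area = binomial_fps (-1) (-1) oo ?\<zeta>"
    by (simp add: root_zero_area_def distrib [symmetric] binomial_fps_mult)
  have 1: "binomial_fps 1 (-1) oo ?\<zeta> = 1 - ?\<zeta>"
    by (simp add: binomial_fps_1 fps_compose_add_distrib distrib gf_primitive_nth_0)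
      (simp add: fps_eq_iff)
  have 2: "(binomial_fps (-1) (-1) oo ?\<zeta>) * (binomial_fps 1 (-1) oo ?\<zeta>) = 1"
    by (simp add: distrib [symmetric] binomial_fps_mult)
  have 3: "?Z * (1 - ?\<zeta>) = 1"
    using gf_zero_area_bridge by (simp add: algebra_simps)
  have "binomial_fps (-1) (-1) oo ?\<zeta> = (binomial_fps (-1) (-1) oo ?\<zeta>) * (?Z * (1 - ?\<zeta>))"
    unfolding 3 by simp
  also have "\<dots> = (binomial_fps (-1) (-1) oo ?\<zeta>) * (1 - ?\<zeta>) * ?Z"
    by (simp only: mult_ac)
  also have "\<dots> = ?Z"
    using 2 unfolding 1 by simp
  finally show ?thesis unfolding sq .
qed

lemma root_zero_area_nth_0 [simp]: "root_zero_area $ 0 = 1"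
  by (simp add: root_zero_area_def)

lemma gf_nonneg_bridge_nth_0: "gf nonneg_bridge $ 0 = 1"
proof -
  have "{xs :: (bool \<times> bool) list. length xs = 0 \<and> nonneg_bridge xs} = {[]}"
    by (auto simp: nonneg_bridge_def nonneg_def)
  then show ?thesis by (simp add: gf_def weight_0)
qed

text \<open>The inverse \<open>\<rho>'\<close> is a parameter because in both applications it is a
  \<open>binomial_fps\<close> product with opposite exponents. Of the two roots of M^2 the constant
  term selects \<open>\<rho> * root_zero_area\<close>.\<close>

lemma half_bridges_eq_root:
  assumes R: "gf (\<lambda>xs. height xs = 0) = \<rho> * \<rho>" and "\<rho> $ 0 = 1" and inv: "\<rho> * \<rho>' = 1"
  shows "half_bridges = fps_const (1/2) * (\<rho> * root_zero_area) + fps_const (1/2) * (\<rho>' * root_zero_area) + fps_const (- 1) * 1"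
proof -
  let ?M = "gf nonneg_bridge" and ?R = "gf (\<lambda>xs. height xs = 0)"
  have "?M * ?M = (\<rho> * root_zero_area) * (\<rho> * root_zero_area)"
    unfolding gf_nonneg_bridge_square R root_zero_area_square [symmetric] by (simp only: mult_ac)
  then have M: "?M = \<rho> * root_zero_area"
    by (rule fps_square_eq_imp_eq) (use assms in \<open>auto simp: gf_nonneg_bridge_nth_0\<close>)
  have "2 * half_bridges = 2 * (\<rho> * \<rho>' * (\<rho> * \<rho>')) * half_bridges"
    by (simp add: inv)
  also have "\<dots> = (\<rho>' * \<rho>') * (2 * ?R * half_bridges)"
    unfolding R by (simp only: mult_ac)
  also have "\<dots> = (\<rho> * \<rho>') * (\<rho> * \<rho>') * \<rho> * root_zero_area + (\<rho> * \<rho>') * \<rho>' * root_zero_area - 2 * ((\<rho> * \<rho>') * (\<rho> * \<rho>'))"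
    unfolding half_bridges_eq unfolding M unfolding R by (simp add: algebra_simps)
  also have "\<dots> = \<rho> * root_zero_area + \<rho>' * root_zero_area - 2"
    by (simp add: inv)
  finally have *: "2 * half_bridges = \<rho> * root_zero_area + \<rho>' * root_zero_area - 2" .
  show ?thesis
  proof (rule fps_ext)
    fix n
    have "2 * half_bridges $ n = (\<rho> * root_zero_area + \<rho>' * root_zero_area - 2) $ n"
      unfolding * [symmetric] by (simp add: numeral_fps_const)
    then show "half_bridges $ n = (fps_const (1/2) * (\<rho> * root_zero_area) + fps_const (1/2) * (\<rho>' * root_zero_area) + fps_const (- 1) * 1) $ n"
      by (cases "n = 0") (simp_all add: fps_numeral_nth)
  qed
qed

lemma half_bridges_nth:
  assumes "n > 0"
  shows "half_bridges $ n = (\<Sum>xs | length xs = n - 1 \<and> (height xs = 0 \<or> height xs = - 1) \<and> nonneg xs. \<omega> (area xs)) / 4 ^ n"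
  using assms by (cases n) (simp_all add: half_bridges_def gf_def mult.assoc)

end

lemma power_dominated:
  fixes f g :: "real fps"
  assumes "\<And>n. \<bar>f $ n\<bar> \<le> g $ n"
  shows "\<bar>(f ^ i) $ n\<bar> \<le> (g ^ i) $ n"
proof (induction i arbitrary: n)
  case (Suc i)
  have "\<bar>(f ^ Suc i) $ n\<bar> \<le> (\<Sum>k=0..n. \<bar>f $ k * (f ^ i) $ (n - k)\<bar>)"
    unfolding power_Suc fps_mult_nth by (rule sum_abs)
  also have "\<dots> \<le> (\<Sum>k=0..n. g $ k * (g ^ i) $ (n - k))"
    unfolding abs_mult using assms Suc
    by (intro sum_mono mult_mono) (auto intro: order_trans [OF abs_ge_zero])
  finally show ?case by (simp add: fps_mult_nth)
qed auto

text \<open>The outer series has nonnegative coefficients, so a majorant of the inner series remains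
  one after composition.\<close>

lemma signed_root_le: "\<bar>signed.root_zero_area $ n\<bar> \<le> unsigned.root_zero_area $ n"
proof -
  have prim: "\<bar>signed.gf primitive_bridge $ n\<bar> \<le> unsigned.gf primitive_bridge $ n" for n
  proof -
    have "\<bar>\<Sum>xs | length xs = n \<and> primitive_bridge xs. parity_sign (area xs)\<bar>
      \<le> (\<Sum>xs | length xs = n \<and> primitive_bridge xs. \<bar>parity_sign (area xs)\<bar>)"
      by (rule sum_abs)
    also have "\<dots> = (\<Sum>xs | length xs = n \<and> primitive_bridge xs. 1)"
      by (rule sum.cong) auto
    finally show ?thesis
      by (simp add: signed.gf_def unsigned.gf_def divide_right_mono)
  qed
  have "binomial_fps (-1/2) (-1) $ i \<ge> 0" for i
    by (simp only: binomial_fps_def fps_nth_Abs_fps central_binomial) simp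
  then have "\<bar>\<Sum>i=0..n. binomial_fps (-1/2) (-1) $ i * (signed.gf primitive_bridge ^ i) $ n\<bar>
    \<le> (\<Sum>i=0..n. binomial_fps (-1/2) (-1) $ i * (unsigned.gf primitive_bridge ^ i) $ n)"
    by (intro order_trans [OF sum_abs] sum_mono)
      (simp add: abs_mult mult_left_mono power_dominated prim)
  then show ?thesis
    by (simp add: signed.root_zero_area_def unsigned.root_zero_area_def fps_compose_nth)
qed

lemma unsigned_root_nonneg: "unsigned.root_zero_area $ n \<ge> 0"
  using signed_root_le [of n] by linarith

text \<open>With nonnegative coefficients and g_0 = 1, the term g_0 g_m of the convolution square is
  at most Z_m, which the Fourier estimate bounds.\<close>

lemma decaying_unsigned_root: "decaying unsigned.root_zero_area"
proof -
  let ?g = "unsigned.root_zero_area"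
  obtain K where K: "\<And>m. real (card {xs\<in>walks m. area xs = 0}) / 4 ^ m \<le> K * (real m + 1) powr (-5/4)"
    using card_zero_area_bigo by blast
  have "\<bar>?g $ m\<bar> \<le> K * (real m + 1) powr (-5/4)" for m
  proof -
    have "?g $ m = ?g $ 0 * ?g $ (m - 0)" by simp
    also have "\<dots> \<le> (\<Sum>k=0..m. ?g $ k * ?g $ (m - k))"
      by (rule member_le_sum) (auto simp: unsigned_root_nonneg)
    also have "\<dots> = unsigned.gf zero_area_bridge $ m"
      unfolding unsigned.root_zero_area_square [symmetric] fps_mult_nth ..
    also have "\<dots> = real (card {xs. length xs = m \<and> zero_area_bridge xs}) / 4 ^ m"
      by (simp add: unsigned.gf_def)
    also have "\<dots> \<le> real (card {xs\<in>walks m. area xs = 0}) / 4 ^ m"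
      by (intro divide_right_mono of_nat_mono card_mono) (auto simp: zero_area_bridge_def walks_def)
    finally show ?thesis using K [of m] unsigned_root_nonneg [of m] by simp
  qed
  then show ?thesis unfolding decaying_def by blast
qed

lemma decaying_signed_root: "decaying signed.root_zero_area"
  using decaying_unsigned_root by (rule decaying_bound) (rule order_trans [OF signed_root_le abs_ge_self])

section \<open>Asymptotics of half-bridges\<close>

lemma unsigned_half_bridges_asymptotics:
  "(\<lambda>n. unsigned.half_bridges $ n * (real n + 1) powr (3/4))
     \<longlonglongrightarrow> (\<Sum>n. unsigned.root_zero_area $ n) / (2 * Gamma (1/4))"
proof -
  let ?g = "unsigned.root_zero_area"
  have 1: "(\<lambda>n. (?g * binomial_fps (-1/4) (-1)) $ n * (real n + 1) powr (3/4)) \<longlonglongrightarrow> inverse (Gamma (1/4)) * (\<Sum>n. ?g $ n)"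
    using binomial_fps_asymptotics [of "-1/4"]
    by (intro decaying_mult_asymptotics decaying_unsigned_root) simp
  \<comment> \<open>\<open>?d\<close> is M/(2R) - 1. Dividing by R turns the exponent -1/4 into 1/4,
    hence the smaller order.\<close>
  have "decaying (fps_const (1/2) * (binomial_fps (1/4) (-1) * ?g) + fps_const (- 1) * 1)" (is "decaying ?d")
    by (intro decaying_add decaying_const_mult decaying_mult decaying_binomial_fps_quarter decaying_unsigned_root decaying_one)
  then have 2: "(\<lambda>n. ?d $ n * (real n + 1) powr (3/4)) \<longlonglongrightarrow> 0"
    by (rule decaying_imp_null)
  have 3: "(\<lambda>n. 1 / 2 * ((?g * binomial_fps (-1/4) (-1)) $ n * (real n + 1) powr (3/4)) + ?d $ n * (real n + 1) powr (3/4))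
    \<longlonglongrightarrow> 1 / 2 * (inverse (Gamma (1/4)) * (\<Sum>n. ?g $ n)) + 0"
    by (intro tendsto_add [OF tendsto_mult [OF tendsto_const 1] 2])
  have H: "unsigned.half_bridges = fps_const (1/2) * (binomial_fps (-1/4) (-1) * ?g) + fps_const (1/2) * (binomial_fps (1/4) (-1) * ?g) + fps_const (- 1) * 1"
  proof (rule unsigned.half_bridges_eq_root)
    show "unsigned.gf (\<lambda>xs. height xs = 0) = binomial_fps (-1/4) (-1) * binomial_fps (-1/4) (-1)"
      by (simp add: unsigned_bridges binomial_fps_mult)
  qed (simp_all add: binomial_fps_mult)
  have E: "unsigned.half_bridges $ n * v = 1 / 2 * ((?g * binomial_fps (-1/4) (-1)) $ n * v) + ?d $ n * v" for n v
    unfolding H mult.commute [of "binomial_fps (-1/4) (-1)" ?g] fps_add_nth fps_mult_left_const_nth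
    by (simp only: distrib_right add.assoc mult.assoc)
  have "1 / 2 * (inverse G * S) + 0 = S / (2 * G)" for S G :: real
    by (simp add: field_simps)
  with 3 show ?thesis unfolding E by (simp only:)
qed

lemma signed_half_bridges_asymptotics:
  "(\<lambda>n. signed.half_bridges $ n * (real n + 1) powr (3/4)) \<longlonglongrightarrow> 0"
proof (rule decaying_imp_null)
  let ?g = "signed.root_zero_area"
  \<comment> \<open>The root of \<open>signed_bridges\<close> and its inverse: all factors have
    branch points at distance 2 from 0, so their coefficients decay geometrically.\<close>
  let ?\<rho> = "binomial_fps (1/4) (1/2) * binomial_fps (-1/4) (-1/2)"
  let ?\<rho>' = "binomial_fps (-1/4) (1/2) * binomial_fps (1/4) (-1/2)"
  have "signed.half_bridges = fps_const (1/2) * (?\<rho> * ?g) + fps_const (1/2) * (?\<rho>' * ?g) + fps_const (- 1) * 1"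
  proof (rule signed.half_bridges_eq_root)
    have "?\<rho> * ?\<rho> = (binomial_fps (1/4) (1/2) * binomial_fps (1/4) (1/2)) * (binomial_fps (-1/4) (-1/2) * binomial_fps (-1/4) (-1/2))"
      by (simp only: mult_ac)
    then show "signed.gf (\<lambda>xs. height xs = 0) = ?\<rho> * ?\<rho>"
      by (simp add: signed_bridges binomial_fps_mult)
    have "?\<rho> * ?\<rho>' = (binomial_fps (1/4) (1/2) * binomial_fps (-1/4) (1/2)) * (binomial_fps (-1/4) (-1/2) * binomial_fps (1/4) (-1/2))"
      by (simp only: mult_ac)
    then show "?\<rho> * ?\<rho>' = 1"
      by (simp add: binomial_fps_mult)
  qed simp
  then show "decaying signed.half_bridges"
    by (simp only:)
      (intro decaying_add decaying_const_mult decaying_mult decaying_signed_root decaying_one decaying_binomial_fps_half, auto)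
qed

lemma even_half_bridges_asymptotics:
  obtains c where "c > 0"
    "(\<lambda>n. real (card {xs\<in>walks (n - 1). (height xs = 0 \<or> height xs = - 1) \<and> nonneg xs \<and> even (area xs)}) / 4 ^ n
        * (real n + 1) powr (3/4)) \<longlonglongrightarrow> c"
proof -
  let ?g = "unsigned.root_zero_area"
  let ?c = "((\<Sum>n. ?g $ n) / (2 * Gamma (1/4)) + 0) / 2"
  let ?S = "\<lambda>n. {xs. length xs = n - 1 \<and> (height xs = 0 \<or> height xs = - 1) \<and> nonneg xs}"
  \<comment> \<open>Positivity of the limit: the coefficients of g are nonnegative and the constant
    one is 1.\<close>
  have "1 = sum (($) ?g) {0}" by simp
  also have "\<dots> \<le> (\<Sum>n. ?g $ n)"
    by (rule sum_le_suminf) (auto simp: unsigned_root_nonneg decaying_summable decaying_unsigned_root)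
  finally have pos: "?c > 0" using Gamma_real_pos [of "1/4"] by simp
  have lim: "(\<lambda>n. (unsigned.half_bridges $ n * (real n + 1) powr (3/4) + signed.half_bridges $ n * (real n + 1) powr (3/4)) / 2) \<longlonglongrightarrow> ?c"
    by (intro tendsto_divide tendsto_add unsigned_half_bridges_asymptotics signed_half_bridges_asymptotics tendsto_const) simp
  have ev: "eventually (\<lambda>n. (unsigned.half_bridges $ n * (real n + 1) powr (3/4) + signed.half_bridges $ n * (real n + 1) powr (3/4)) / 2
    = real (card {xs\<in>walks (n - 1). (height xs = 0 \<or> height xs = - 1) \<and> nonneg xs \<and> even (area xs)}) / 4 ^ n
        * (real n + 1) powr (3/4)) sequentially"
    using eventually_gt_at_top [of 0]
  proof eventually_elim
    case (elim n)
    have "(\<Sum>xs\<in>?S n. 1 + parity_sign (area xs)) = (\<Sum>xs\<in>?S n. if even (area xs) then 2 else 0)"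
      by (rule sum.cong) auto
    also have "\<dots> = 2 * real (card {xs\<in>?S n. even (area xs)})"
      by (simp add: sum.inter_filter [symmetric])
    also have "{xs\<in>?S n. even (area xs)} = {xs\<in>walks (n - 1). (height xs = 0 \<or> height xs = - 1) \<and> nonneg xs \<and> even (area xs)}"
      by (auto simp: walks_def)
    finally have "(unsigned.half_bridges $ n + signed.half_bridges $ n) / 2 =
      real (card {xs\<in>walks (n - 1). (height xs = 0 \<or> height xs = - 1) \<and> nonneg xs \<and> even (area xs)}) / 4 ^ n"
      unfolding unsigned.half_bridges_nth [OF elim] signed.half_bridges_nth [OF elim]
      by (simp add: sum.distrib field_simps)
    moreover have "(u * v + s * v) / 2 = (u + s) / 2 * v" for u s v :: real
      by (simp add: distrib_right)
    ultimately show ?case by (simp only:)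
  qed
  show ?thesis
    by (rule that [OF pos Lim_transform_eventually [OF lim ev]])
qed

section \<open>The Erdos--Gallai inequalities as an area condition\<close>

definition erdos_gallai :: "nat \<Rightarrow> (nat \<Rightarrow> int) \<Rightarrow> bool" where
  "erdos_gallai n a \<longleftrightarrow>
     (\<forall>k\<le>n. (\<Sum>i<k. a i) \<le> int k * (int k - 1) + (\<Sum>i\<in>{k..<n}. min (a i) (int k)))"

text \<open>For \<open>c = t + 1 - n\<close> this is the area of the prefix of length \<open>t\<close> of the walk that encodes \<open>a\<close>: the first sum
  collects the areas of the up half-steps, the second those of the down half-steps.\<close>

definition area_profile :: "nat \<Rightarrow> (nat \<Rightarrow> int) \<Rightarrow> int \<Rightarrow> int" where
  "area_profile n a c = (\<Sum>i<n. max 0 (min (a i) (c + int i))) - (\<Sum>i<n. max 0 (c + a i - int i))"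

lemma double_sum_lessThan: "2 * (\<Sum>i<k. int i) = int k * (int k - 1)"
  by (induction k) (auto simp: algebra_simps)

lemma double_sum_diff_lessThan: "2 * (\<Sum>i<k. int k - int i) = int k * (int k + 1)"
  using double_sum_lessThan [of k] by (simp add: sum_subtractf algebra_simps)

lemma sum_lessThan_split:
  assumes "k \<le> (n::nat)"
  shows "(\<Sum>i<n. f i) = (\<Sum>i<k. f i) + (\<Sum>i\<in>{k..<n}. f i :: int)"
  using assms by (simp add: lessThan_atLeast0 sum.atLeastLessThan_concat)

lemma sum_from_shift: "(\<Sum>i\<in>{p..<p + k::nat}. f i) = (\<Sum>i<k. f (p + i) :: int)"
  using sum.shift_bounds_nat_ivl [of f 0 p k] by (simp add: lessThan_atLeast0 add.commute)

text \<open>This bounds the cost of replacing the cap \<open>c + i\<close> by \<open>k\<close> in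
  \<open>area_profile\<close>. The first \<open>- c\<close> terms are at most k, the next ones run
  down k, k - 1, ..., 1, and the rest vanish.\<close>

lemma loss_bound:
  assumes "c \<le> 0"
  shows "2 * (\<Sum>i<n. max 0 (min (int k) (int k - c - int i))) \<le> int k * (int k + 1) - 2 * c * int k"
proof -
  define p where "p = nat (- c)"
  have c: "c = - int p" using assms by (simp add: p_def)
  let ?f = "\<lambda>i. max 0 (min (int k) (int k - c - int i))"
  have "sum ?f {..<n} \<le> sum ?f ({..<n} \<union> {..<p + k})"
    by (rule sum_mono2) auto
  also have "\<dots> = sum ?f {..<p + k}"
    by (rule sum.mono_neutral_right) (auto simp: c)
  also have "\<dots> = sum ?f {..<p} + (\<Sum>i<k. ?f (p + i))"
    by (simp add: sum_lessThan_split [of p "p + k"] sum_from_shift)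
  also have "sum ?f {..<p} = (\<Sum>i<p. int k)"
    by (rule sum.cong) (auto simp: c)
  also have "(\<Sum>i<k. ?f (p + i)) = (\<Sum>i<k. int k - int i)"
    by (rule sum.cong) (auto simp: c)
  finally show ?thesis
    using double_sum_diff_lessThan [of k] by (simp add: c algebra_simps)
qed

lemma first_index:
  obtains k where "k \<le> n" "\<And>i. i < k \<Longrightarrow> \<not> P i" "k < n \<Longrightarrow> P (k::nat)"
proof -
  define k where "k = (LEAST k. k = n \<or> P k)"
  have 1: "k = n \<or> P k" unfolding k_def by (rule LeastI [of _ n]) simp
  have 2: "k \<le> n" unfolding k_def by (rule Least_le) simp
  have 3: "\<not> P i" if "i < k" for i using not_less_Least that unfolding k_def by blast
  show ?thesis by (rule that [OF 2 3]) (use 1 in auto)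
qed

locale decreasing_sequence =
  fixes n :: nat and a :: "nat \<Rightarrow> int"
  assumes decreasing: "i \<le> j \<Longrightarrow> j < n \<Longrightarrow> a j \<le> a i"
    and nonnegative: "i < n \<Longrightarrow> 0 \<le> a i"
begin

text \<open>With \<open>k\<close> the number of positive terms in the subtracted sum, that sum is
  linear in the first k entries. The quadratic terms of \<open>loss_bound\<close> then combine
  exactly into the Erdos-Gallai inequality for this \<open>k\<close>.\<close>

lemma erdos_gallai_imp_area_profile_nonneg:
  assumes eg: "erdos_gallai n a" and c: "c \<le> 0"
  shows "area_profile n a c \<ge> 0"
proof -
  obtain k where k: "k \<le> n" "\<And>i. i < k \<Longrightarrow> \<not> c + a i - int i \<le> 0" "k < n \<Longrightarrow> c + a k - int k \<le> 0"
    using first_index [of n "\<lambda>k. c + a k - int k \<le> 0"] by blast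
  have "(\<Sum>i<n. max 0 (c + a i - int i)) = (\<Sum>i<k. max 0 (c + a i - int i)) + (\<Sum>i\<in>{k..<n}. max 0 (c + a i - int i))"
    by (rule sum_lessThan_split [OF k(1)])
  also have "(\<Sum>i\<in>{k..<n}. max 0 (c + a i - int i)) = 0"
  proof (rule sum.neutral, rule ballI)
    fix i assume i: "i \<in> {k..<n}"
    then have "a i \<le> a k" by (intro decreasing) auto
    then show "max 0 (c + a i - int i) = 0" using k(3) i by auto
  qed
  also have "(\<Sum>i<k. max 0 (c + a i - int i)) = (\<Sum>i<k. c + a i - int i)"
    by (rule sum.cong) (use k(2) in \<open>auto simp: not_le\<close>)
  finally have B: "2 * (\<Sum>i<n. max 0 (c + a i - int i)) = 2 * c * int k + 2 * (\<Sum>i<k. a i) - int k * (int k - 1)"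
    using double_sum_lessThan [of k] by (simp add: sum.distrib sum_subtractf algebra_simps)
  have "(\<Sum>i<n. min (a i) (int k) - max 0 (min (int k) (int k - c - int i))) \<le> (\<Sum>i<n. max 0 (min (a i) (c + int i)))"
    by (rule sum_mono) (use nonnegative in \<open>fastforce simp: min_def max_def\<close>)
  then have A: "(\<Sum>i<n. max 0 (min (a i) (c + int i))) \<ge> (\<Sum>i<n. min (a i) (int k)) - (\<Sum>i<n. max 0 (min (int k) (int k - c - int i)))"
    by (simp add: sum_subtractf)
  have "min (a i) (int k) = int k" if "i < k" for i
  proof -
    have "a (k - 1) \<le> a i" using that k(1) by (intro decreasing) auto
    moreover have "a (k - 1) \<ge> int k" using k(2) [of "k - 1"] that c by auto
    ultimately show ?thesis by simp
  qed
  then have "(\<Sum>i<n. min (a i) (int k)) = int k * int k + (\<Sum>i\<in>{k..<n}. min (a i) (int k))"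
    using sum_lessThan_split [OF k(1), of "\<lambda>i. min (a i) (int k)"] by simp
  moreover have "(\<Sum>i<k. a i) \<le> int k * (int k - 1) + (\<Sum>i\<in>{k..<n}. min (a i) (int k))"
    using eg k(1) by (simp add: erdos_gallai_def)
  ultimately have "2 * area_profile n a c \<ge> 0"
    using A B loss_bound [OF c, of k n] unfolding area_profile_def by (simp add: algebra_simps)
  then show ?thesis by simp
qed

lemma area_profile_nonneg_imp_inequality:
  assumes J: "\<And>c. 1 - int n \<le> c \<Longrightarrow> c \<le> 0 \<Longrightarrow> area_profile n a c \<ge> 0"
    and k: "0 < k" "k \<le> n" "a (k - 1) \<ge> int k"
  shows "(\<Sum>i<k. a i) \<le> int k * (int k - 1) + (\<Sum>i\<in>{k..<n}. min (a i) (int k))"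
proof -
  \<comment> \<open>The inequality for \<open>k\<close> is read off the profile at \<open>c = k - m\<close>, \<open>m\<close> the number of entries \<open>\<ge> k\<close>.\<close>
  obtain m where m: "m \<le> n" "\<And>i. i < m \<Longrightarrow> \<not> a i < int k" "m < n \<Longrightarrow> a m < int k"
    using first_index [of n "\<lambda>m. a m < int k"] by blast
  have km: "k \<le> m"
  proof (rule ccontr)
    assume "\<not> k \<le> m"
    then have "m \<le> k - 1" "k - 1 < n" "m < n" using k by auto
    then show False using m(3) k(3) decreasing [of m "k - 1"] by linarith
  qed
  define c where "c = int k - int m"
  have c: "1 - int n \<le> c" "c \<le> 0" using km m(1) k by (auto simp: c_def)
  have "(\<Sum>i<n. max 0 (min (a i) (c + int i))) = (\<Sum>i<m. max 0 (min (a i) (c + int i))) + (\<Sum>i\<in>{m..<n}. max 0 (min (a i) (c + int i)))"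
    by (rule sum_lessThan_split [OF m(1)])
  also have "(\<Sum>i\<in>{m..<n}. max 0 (min (a i) (c + int i))) = (\<Sum>i\<in>{m..<n}. a i)"
  proof (rule sum.cong)
    fix i assume i: "i \<in> {m..<n}"
    then have "a i \<le> a m" by (intro decreasing) auto
    then show "max 0 (min (a i) (c + int i)) = a i"
      using m(3) i nonnegative [of i] by (auto simp: c_def)
  qed simp
  \<comment> \<open>As \<open>c + m = k\<close>, the cap \<open>c + i\<close> is below
    \<open>k\<close>, hence below \<open>a i\<close>, for every \<open>i < m\<close>.\<close>
  also have "(\<Sum>i<m. max 0 (min (a i) (c + int i))) = (\<Sum>i<m. max 0 (c + int i))"
    by (rule sum.cong) (use m(2) in \<open>force simp: c_def\<close>)+
  also have "\<dots> = (\<Sum>i<m - k. max 0 (c + int i)) + (\<Sum>i\<in>{m - k..<m}. max 0 (c + int i))"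
    by (rule sum_lessThan_split) simp
  also have "(\<Sum>i<m - k. max 0 (c + int i)) = 0"
    by (rule sum.neutral) (auto simp: c_def)
  also have "(\<Sum>i\<in>{m - k..<m}. max 0 (c + int i)) = (\<Sum>i<k. int i)"
    using sum_from_shift [of "\<lambda>i. max 0 (c + int i)" "m - k" k] km by (simp add: c_def of_nat_diff)
  finally have A: "2 * (\<Sum>i<n. max 0 (min (a i) (c + int i))) = int k * (int k - 1) + 2 * (\<Sum>i\<in>{m..<n}. a i)"
    using double_sum_lessThan [of k] by simp
  \<comment> \<open>A lower bound for the subtracted sum suffices here, so positive parts are
    dropped and only the first k indices kept.\<close>
  have "(\<Sum>i<k. c + a i - int i) \<le> (\<Sum>i<k. max 0 (c + a i - int i))"
    by (rule sum_mono) simp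
  also have "\<dots> \<le> (\<Sum>i<n. max 0 (c + a i - int i))"
    using k by (intro sum_mono2) auto
  finally have B: "2 * c * int k + 2 * (\<Sum>i<k. a i) - int k * (int k - 1) \<le> 2 * (\<Sum>i<n. max 0 (c + a i - int i))"
    using double_sum_lessThan [of k] by (simp add: sum.distrib sum_subtractf algebra_simps)
  have "(\<Sum>i\<in>{k..<n}. min (a i) (int k)) = (\<Sum>i\<in>{k..<m}. min (a i) (int k)) + (\<Sum>i\<in>{m..<n}. min (a i) (int k))"
    using km m(1) by (simp add: sum.atLeastLessThan_concat)
  also have "(\<Sum>i\<in>{k..<m}. min (a i) (int k)) = (\<Sum>i\<in>{k..<m}. int k)"
    by (rule sum.cong) (use m(2) in force)+
  also have "(\<Sum>i\<in>{m..<n}. min (a i) (int k)) = (\<Sum>i\<in>{m..<n}. a i)"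
  proof (rule sum.cong)
    fix i assume i: "i \<in> {m..<n}"
    then have "a i \<le> a m" by (intro decreasing) auto
    then show "min (a i) (int k) = a i" using m(3) i by auto
  qed simp
  finally have M: "(\<Sum>i\<in>{k..<n}. min (a i) (int k)) = (int m - int k) * int k + (\<Sum>i\<in>{m..<n}. a i)"
    using km by (simp add: of_nat_diff)
  have "0 \<le> 2 * area_profile n a c" using J [OF c] by simp
  then have "2 * (\<Sum>i<k. a i) \<le> 2 * (int k * (int k - 1) + (\<Sum>i\<in>{k..<n}. min (a i) (int k)))"
    using A B unfolding area_profile_def M by (simp add: c_def algebra_simps)
  then show ?thesis by simp
qed

lemma area_profile_nonneg_imp_erdos_gallai:
  assumes J: "\<And>c. 1 - int n \<le> c \<Longrightarrow> c \<le> 0 \<Longrightarrow> area_profile n a c \<ge> 0"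
  shows "erdos_gallai n a"
proof -
  \<comment> \<open>\<open>D\<close> is the size of the Durfee square; beyond it the slack of the inequalities only grows.\<close>
  let ?E = "\<lambda>k. (\<Sum>i<k. a i) \<le> int k * (int k - 1) + (\<Sum>i\<in>{k..<n}. min (a i) (int k))"
  obtain D where D: "D \<le> n" "\<And>i. i < D \<Longrightarrow> \<not> a i \<le> int i" "D < n \<Longrightarrow> a D \<le> int D"
    using first_index [of n "\<lambda>i. a i \<le> int i"] by blast
  have small: "?E k" if "k \<le> D" for k
  proof (cases "k = 0")
    case True
    have "(\<Sum>i\<in>{0..<n}. min (a i) 0) = 0" by (rule sum.neutral) (use nonnegative in auto)
    then show ?thesis using True by simp
  next
    case False
    then have "k - 1 < D" "int (k - 1) = int k - 1" using that by auto
    then have "a (k - 1) \<ge> int k" using D(2) [of "k - 1"] by linarith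
    then show ?thesis
      using False that D(1) by (intro area_profile_nonneg_imp_inequality J) auto
  qed
  have large: "k \<le> n \<longrightarrow> ?E k" if "D \<le> k" for k
    using that
  proof (induction k rule: dec_induct)
    case base
    then show ?case using small by simp
  next
    case (step k)
    show ?case
    proof
      assume kn: "Suc k \<le> n"
      have ai: "a i \<le> int D" if "i \<in> {D..<n}" for i
        using decreasing [of D i] D(3) that by auto
      have aik: "a i \<le> int k" if "i \<in> {k..<n}" for i
      proof -
        have "i \<in> {D..<n}" using that step by auto
        then show ?thesis using ai [of i] step by linarith
      qed
      have aik': "a i \<le> int (Suc k)" if "i \<in> {Suc k..<n}" for i
        using aik [of i] that by simp
      \<comment> \<open>From k to k + 1 the left side grows by \<open>a k\<close>, while the right
        side gains 2k and loses \<open>a k\<close> from its tail; \<open>a k \<le> k\<close> settles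
        it.\<close>
      have "(\<Sum>i\<in>{k..<n}. min (a i) (int k)) = (\<Sum>i\<in>{k..<n}. a i)"
        by (rule sum.cong [OF refl], rule min_absorb1, rule aik)
      moreover have "(\<Sum>i\<in>{Suc k..<n}. min (a i) (int (Suc k))) = (\<Sum>i\<in>{Suc k..<n}. a i)"
        by (rule sum.cong [OF refl], rule min_absorb1, rule aik')
      moreover have "(\<Sum>i\<in>{k..<n}. a i) = a k + (\<Sum>i\<in>{Suc k..<n}. a i)"
        using kn by (simp add: sum.atLeast_Suc_lessThan)
      moreover have "a k \<le> int k" using kn by (intro aik) auto
      ultimately show "?E (Suc k)"
        using step kn by (simp add: algebra_simps)
    qed
  qed
  show ?thesis
    unfolding erdos_gallai_def using small large by (metis nat_le_linear)
qed

lemma erdos_gallai_iff: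
  "erdos_gallai n a \<longleftrightarrow> (\<forall>c. 1 - int n \<le> c \<and> c \<le> 0 \<longrightarrow> area_profile n a c \<ge> 0)"
  using erdos_gallai_imp_area_profile_nonneg area_profile_nonneg_imp_erdos_gallai by blast

text \<open>At c = 0 the i-th contribution is min(a_i, i) minus the positive part of a_i - i, which
  is a_i minus twice that positive part.\<close>

lemma even_area_profile: "even (area_profile n a 0) \<longleftrightarrow> even (\<Sum>i<n. a i)"
proof -
  have "area_profile n a 0 = (\<Sum>i<n. a i - 2 * max 0 (a i - int i))"
    unfolding area_profile_def sum_subtractf [symmetric]
    by (rule sum.cong) (use nonnegative in \<open>auto simp: min_def max_def\<close>)
  also have "\<dots> = (\<Sum>i<n. a i) - 2 * (\<Sum>i<n. max 0 (a i - int i))"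
    by (simp only: sum_subtractf sum_distrib_left)
  finally show ?thesis by simp
qed

end

section \<open>Decreasing sequences as walks\<close>

lemma height_take: "t \<le> length xs \<Longrightarrow> height (take t xs) = (\<Sum>j<t. step (xs ! j))"
  by (induction t) (auto simp: height_take_Suc)

lemma area_take: "t \<le> length xs \<Longrightarrow> area (take t xs) = (\<Sum>j<t. (int t - int j) * step (xs ! j))"
proof (induction t)
  case (Suc t)
  have "(\<Sum>j<Suc t. (int (Suc t) - int j) * step (xs ! j)) = (\<Sum>j<Suc t. (int t - int j) * step (xs ! j)) + (\<Sum>j<Suc t. step (xs ! j))"
    unfolding sum.distrib [symmetric] by (rule sum.cong) (auto simp: algebra_simps)
  also have "\<dots> = area (take t xs) + height (take (Suc t) xs)"
    using Suc by (simp add: height_take del: take_Suc)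
  finally show ?case using Suc.prems by (simp add: area_take_Suc)
qed simp

text \<open>The indicator word of U is the boundary path of a Young diagram. The walk folds it at n:
  each step pairs a position with its mirror image, and n itself is not read.\<close>

definition set_walk :: "nat \<Rightarrow> int set \<Rightarrow> (bool \<times> bool) list" where
  "set_walk n U = map (\<lambda>j. (int (Suc j) \<notin> U, 2 * int n - int (Suc j) \<in> U)) [0..<n - 1]"

lemma length_set_walk [simp]: "length (set_walk n U) = n - 1"
  by (simp add: set_walk_def)

lemma step_set_walk: "j < n - 1 \<Longrightarrow> step (set_walk n U ! j) = 1 - of_bool (int (Suc j) \<in> U) - of_bool (2 * int n - int (Suc j) \<in> U)"
  by (simp add: set_walk_def step_def)

lemma sum_of_bool_mem_low:
  assumes "finite U" "U \<subseteq> {1..}"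
  shows "(\<Sum>j<t. f (int (Suc j)) * of_bool (int (Suc j) \<in> U)) = (\<Sum>u\<in>U. if u \<le> int t then f u else (0::int))"
proof -
  have "(\<Sum>j<t. f (int (Suc j)) * of_bool (int (Suc j) \<in> U)) = (\<Sum>j | j < t \<and> int (Suc j) \<in> U. f (int (Suc j)))"
    by (rule sum.mono_neutral_cong_right) auto
  also have "\<dots> = (\<Sum>u | u \<in> U \<and> u \<le> int t. f u)"
    by (rule sum.reindex_bij_witness [where i = "\<lambda>u. nat (u - 1)" and j = "\<lambda>j. int (Suc j)"])
      (use assms in auto)
  also have "\<dots> = (\<Sum>u\<in>U. if u \<le> int t then f u else 0)"
    using assms(1) by (simp add: sum.inter_filter)
  finally show ?thesis .
qed

lemma sum_of_bool_mem_high: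
  assumes "finite U" "U \<subseteq> {..2 * int n - 1}"
  shows "(\<Sum>j<t. f (int (Suc j)) * of_bool (2 * int n - int (Suc j) \<in> U)) = (\<Sum>u\<in>U. if 2 * int n - u \<le> int t then f (2 * int n - u) else (0::int))"
proof -
  let ?r = "\<lambda>u. 2 * int n - u"
  have "(\<Sum>j<t. f (int (Suc j)) * of_bool (int (Suc j) \<in> ?r ` U)) = (\<Sum>u\<in>?r ` U. if u \<le> int t then f u else 0)"
    by (rule sum_of_bool_mem_low) (use assms in auto)
  moreover have "x \<in> ?r ` U \<longleftrightarrow> ?r x \<in> U" for x
    by (auto simp: image_iff) (metis diff_diff_eq2 add_diff_cancel_left')
  moreover have "inj_on ?r U" by (auto simp: inj_on_def)
  ultimately show ?thesis by (simp add: sum.reindex)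
qed

text \<open>Every element except n lies in exactly one half and lowers the height by 1 from its
  value n - 1 for the empty set.\<close>

lemma height_set_walk:
  assumes "U \<subseteq> {1..2 * int n - 1}" and pos: "n > 0"
  shows "height (set_walk n U) = int n - 1 - int (card (U - {int n}))"
proof -
  have fin: "finite U" using assms finite_subset by blast
  have "height (set_walk n U) = (\<Sum>j<n - 1. step (set_walk n U ! j))"
    using height_take [of "n - 1" "set_walk n U"] by simp
  also have "\<dots> = (\<Sum>j<n - 1. 1 - 1 * of_bool (int (Suc j) \<in> U) - 1 * of_bool (2 * int n - int (Suc j) \<in> U))"
    by (rule sum.cong) (auto simp: step_set_walk)
  also have "\<dots> = int (n - 1) - (\<Sum>j<n - 1. 1 * of_bool (int (Suc j) \<in> U)) - (\<Sum>j<n - 1. 1 * of_bool (2 * int n - int (Suc j) \<in> U))"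
    by (simp only: sum_subtractf) simp
  also have "(\<Sum>j<n - 1. 1 * of_bool (int (Suc j) \<in> U)) = (\<Sum>u\<in>U. if u \<le> int (n - 1) then 1 else (0::int))"
    using sum_of_bool_mem_low [of U "\<lambda>_. 1" "n - 1"] fin assms by fastforce
  also have "(\<Sum>j<n - 1. 1 * of_bool (2 * int n - int (Suc j) \<in> U)) = (\<Sum>u\<in>U. if 2 * int n - u \<le> int (n - 1) then 1 else (0::int))"
    using sum_of_bool_mem_high [of U n "\<lambda>_. 1" "n - 1"] fin assms by fastforce
  finally have "height (set_walk n U) = int (n - 1) - ((\<Sum>u\<in>U. if u \<le> int (n - 1) then 1 else 0) + (\<Sum>u\<in>U. if 2 * int n - u \<le> int (n - 1) then 1 else 0))"
    by simp
  also have "(\<Sum>u\<in>U. if u \<le> int (n - 1) then 1 else (0::int)) + (\<Sum>u\<in>U. if 2 * int n - u \<le> int (n - 1) then 1 else 0)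
    = (\<Sum>u\<in>U. if u \<noteq> int n then 1 else 0)"
    unfolding sum.distrib [symmetric] by (rule sum.cong) (use pos in auto)
  also have "\<dots> = int (card {u\<in>U. u \<noteq> int n})"
    using fin by (simp add: sum.inter_filter [symmetric])
  also have "{u\<in>U. u \<noteq> int n} = U - {int n}" by auto
  finally show ?thesis using pos by (simp add: of_nat_diff)
qed

lemma area_set_walk:
  assumes "U \<subseteq> {1..2 * int n - 1}" "t < n"
  shows "area (take t (set_walk n U)) =
    (\<Sum>j<t. int t - int j) - (\<Sum>u\<in>U. max 0 (int t + 1 - u)) - (\<Sum>u\<in>U. max 0 (int t + 1 - 2 * int n + u))"
proof -
  have fin: "finite U" using assms finite_subset by blast
  let ?f = "\<lambda>u. int t + 1 - u"
  have "area (take t (set_walk n U)) = (\<Sum>j<t. (int t - int j) * step (set_walk n U ! j))"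
    using assms by (intro area_take) auto
  also have "\<dots> = (\<Sum>j<t. (int t - int j) - ?f (int (Suc j)) * of_bool (int (Suc j) \<in> U) - ?f (int (Suc j)) * of_bool (2 * int n - int (Suc j) \<in> U))"
    using assms by (intro sum.cong refl, subst step_set_walk) (auto simp: algebra_simps)
  also have "\<dots> = (\<Sum>j<t. int t - int j) - (\<Sum>j<t. ?f (int (Suc j)) * of_bool (int (Suc j) \<in> U)) - (\<Sum>j<t. ?f (int (Suc j)) * of_bool (2 * int n - int (Suc j) \<in> U))"
    by (simp only: sum_subtractf)
  also have "(\<Sum>j<t. ?f (int (Suc j)) * of_bool (int (Suc j) \<in> U)) = (\<Sum>u\<in>U. if u \<le> int t then ?f u else 0)"
    using fin assms by (intro sum_of_bool_mem_low) auto
  also have "\<dots> = (\<Sum>u\<in>U. max 0 (int t + 1 - u))"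
    by (rule sum.cong) auto
  also have "(\<Sum>j<t. ?f (int (Suc j)) * of_bool (2 * int n - int (Suc j) \<in> U)) = (\<Sum>u\<in>U. if 2 * int n - u \<le> int t then ?f (2 * int n - u) else 0)"
    using fin assms by (intro sum_of_bool_mem_high) auto
  also have "\<dots> = (\<Sum>u\<in>U. max 0 (int t + 1 - 2 * int n + u))"
    by (rule sum.cong) auto
  finally show ?thesis .
qed

lemma sum_max_shift:
  assumes "t < n"
  shows "(\<Sum>j<t. int t - int j) = (\<Sum>i<n. max 0 (int t + 1 - int n + int i))"
proof -
  have "(\<Sum>i<n. max 0 (int t + 1 - int n + int i)) = (\<Sum>i | i < n \<and> n - 1 - t < i. int t + 1 - int n + int i)"
    by (rule sum.mono_neutral_cong_right) (use assms in \<open>auto simp: of_nat_diff\<close>)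
  also have "\<dots> = (\<Sum>j<t. int t - int j)"
    by (rule sum.reindex_bij_witness [where i = "\<lambda>j. n - 1 - j" and j = "\<lambda>i. n - 1 - i"])
      (use assms in \<open>auto simp: of_nat_diff\<close>)
  finally show ?thesis by simp
qed

lemma area_set_walk_profile:
  assumes U: "U = (\<lambda>i. a i + int n - int i) ` {..<n}" "U \<subseteq> {1..2 * int n - 1}"
    and inj: "inj_on (\<lambda>i. a i + int n - int i) {..<n}"
    and a: "\<And>i. i < n \<Longrightarrow> 0 \<le> a i" and t: "t < n"
  shows "area (take t (set_walk n U)) = area_profile n a (int t + 1 - int n)"
proof -
  let ?c = "int t + 1 - int n"
  have "area (take t (set_walk n U)) = (\<Sum>i<n. max 0 (?c + int i)) - (\<Sum>i<n. max 0 (int t + 1 - (a i + int n - int i)))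
     - (\<Sum>i<n. max 0 (int t + 1 - 2 * int n + (a i + int n - int i)))"
    unfolding area_set_walk [OF U(2) t] sum_max_shift [OF t] unfolding U(1) sum.reindex [OF inj] by simp
  also have "\<dots> = (\<Sum>i<n. max 0 (?c + int i) - max 0 (int t + 1 - (a i + int n - int i))) - (\<Sum>i<n. max 0 (?c + a i - int i))"
    by (simp add: sum_subtractf algebra_simps)
  \<comment> \<open>The second argument is \<open>?c + i - a i\<close>; for
    \<open>a i \<ge> 0\<close> the difference of the two positive parts is the positive part of the
    minimum.\<close>
  also have "(\<Sum>i<n. max 0 (?c + int i) - max 0 (int t + 1 - (a i + int n - int i))) = (\<Sum>i<n. max 0 (min (a i) (?c + int i)))"
    by (rule sum.cong) (use a in \<open>force simp: min_def max_def\<close>)+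
  finally show ?thesis by (simp add: area_profile_def)
qed

section \<open>Decreasing lists, n-subsets and walks\<close>

definition decreasing_lists :: "nat \<Rightarrow> int list set" where
  "decreasing_lists n = {d. length d = n \<and> sorted_wrt (\<ge>) d \<and> (\<forall>x\<in>set d. 0 \<le> x \<and> x \<le> int n - 1)}"

text \<open>These are the beta numbers of a partition: the shift makes the entries distinct. Indices
  start at 0, so n - i runs from n down to 1.\<close>

definition list_set :: "nat \<Rightarrow> int list \<Rightarrow> int set" where
  "list_set n d = (\<lambda>i. d ! i + int n - int i) ` {..<n}"

lemma decreasing_lists_locale:
  assumes "d \<in> decreasing_lists n"
  shows "decreasing_sequence n ((!) d)"
proof
  fix i j assume "i \<le> j" "j < n"
  then show "d ! j \<le> d ! i"
    using assms sorted_wrt_nth_less [of "(\<ge>)" d i j] by (cases "i = j") (auto simp: decreasing_lists_def)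
qed (use assms in \<open>auto simp: decreasing_lists_def\<close>)

lemma list_set_strict:
  assumes "d \<in> decreasing_lists n" "i < j" "j < n"
  shows "d ! j + int n - int j < d ! i + int n - int i"
  using decreasing_sequence.decreasing [OF decreasing_lists_locale [OF assms(1)], of i j] assms by auto

lemma inj_on_list_set:
  assumes "d \<in> decreasing_lists n"
  shows "inj_on (\<lambda>i. d ! i + int n - int i) {..<n}"
proof (rule inj_onI)
  fix i j assume ij: "i \<in> {..<n}" "j \<in> {..<n}" "d ! i + int n - int i = d ! j + int n - int j"
  show "i = j"
    using list_set_strict [OF assms, of i j] list_set_strict [OF assms, of j i] ij
    by (cases i j rule: linorder_cases) auto
qed

lemma list_set_bounds:
  assumes "d \<in> decreasing_lists n"
  shows "list_set n d \<subseteq> {1..2 * int n - 1}" "card (list_set n d) = n"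
proof -
  show "card (list_set n d) = n"
    unfolding list_set_def by (simp add: card_image inj_on_list_set [OF assms])
  show "list_set n d \<subseteq> {1..2 * int n - 1}"
  proof
    fix u assume "u \<in> list_set n d"
    then obtain i where i: "i < n" "u = d ! i + int n - int i" by (auto simp: list_set_def)
    then have "d ! i \<in> set d" using assms by (simp add: decreasing_lists_def)
    then have "0 \<le> d ! i \<and> d ! i \<le> int n - 1" using assms by (simp add: decreasing_lists_def)
    then show "u \<in> {1..2 * int n - 1}" using i by auto
  qed
qed

lemma bij_betw_list_set:
  "bij_betw (list_set n) (decreasing_lists n) {U. U \<subseteq> {1..2 * int n - 1} \<and> card U = n}"
  unfolding bij_betw_def
proof
  define e where "e d = map (\<lambda>i. d ! i + int n - int i) [0..<n]" for d :: "int list"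
  have set_e: "set (e d) = list_set n d" for d
    by (auto simp: e_def list_set_def)
  have sorted_e: "sorted_wrt (<) (rev (e d))" if "d \<in> decreasing_lists n" for d
    unfolding sorted_wrt_iff_nth_less
  proof (intro allI impI)
    fix i j assume "i < j" "j < length (rev (e d))"
    then show "rev (e d) ! i < rev (e d) ! j"
      using list_set_strict [OF that, of "n - Suc j" "n - Suc i"] by (simp add: e_def rev_nth)
  qed
  show "inj_on (list_set n) (decreasing_lists n)"
  proof (rule inj_onI)
    fix d d' assume d: "d \<in> decreasing_lists n" "d' \<in> decreasing_lists n" "list_set n d = list_set n d'"
    have "set (rev (e d')) = set (rev (e d))" using d by (simp add: set_e)
    then have "rev (e d') = rev (e d)"
      by (rule strict_sorted_equal [OF sorted_e [OF d(1)] sorted_e [OF d(2)]])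
    then have e: "e d = e d'" by simp
    show "d = d'"
    proof (rule nth_equalityI)
      show "length d = length d'" using d by (simp add: decreasing_lists_def)
      fix i assume "i < length d"
      then have "i < n" using d by (simp add: decreasing_lists_def)
      then show "d ! i = d' ! i" using arg_cong [OF e, of "\<lambda>l. l ! i"] by (simp add: e_def)
    qed
  qed
  show "list_set n ` decreasing_lists n = {U. U \<subseteq> {1..2 * int n - 1} \<and> card U = n}"
  proof (intro equalityI subsetI)
    fix U assume "U \<in> {U. U \<subseteq> {1..2 * int n - 1} \<and> card U = n}"
    then have U: "U \<subseteq> {1..2 * int n - 1}" "card U = n" "finite U" by (auto intro: finite_subset)
    define L where "L = rev (sorted_list_of_set U)"
    have L: "length L = n" "set L = U" using U by (auto simp: L_def)
    have dec: "sorted_wrt (>) L"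
      unfolding L_def sorted_wrt_rev by simp
    define d where "d = map (\<lambda>i. L ! i - int n + int i) [0..<n]"
    have nth: "d ! i = L ! i - int n + int i" if "i < n" for i using that by (simp add: d_def)
    have sorted: "sorted_wrt (\<ge>) d"
    proof -
      have "transp ((\<ge>) :: int \<Rightarrow> int \<Rightarrow> bool)" by (auto intro: transpI)
      moreover have "d ! i \<ge> d ! Suc i" if "Suc i < length d" for i
        using sorted_wrt_nth_less [OF dec, of i "Suc i"] that L nth [of i] nth [of "Suc i"] by (simp add: d_def)
      ultimately show ?thesis by (simp add: sorted_wrt_iff_nth_Suc_transp)
    qed
    have "0 \<le> d ! i \<and> d ! i \<le> int n - 1" if i: "i < n" for i
    proof -
      have "d ! i \<le> d ! 0" using sorted_wrt_nth_less [OF sorted, of 0 i] i by (cases i) (auto simp: d_def)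
      moreover have "d ! (n - 1) \<le> d ! i"
        using sorted_wrt_nth_less [OF sorted, of i "n - 1"] i by (cases "i = n - 1") (auto simp: d_def)
      moreover have "L ! 0 \<in> U" "L ! (n - 1) \<in> U"
        using nth_mem [of 0 L] nth_mem [of "n - 1" L] L i by auto
      ultimately show ?thesis using U(1) nth [of 0] nth [of "n - 1"] i by (auto simp: of_nat_diff)
    qed
    then have "d \<in> decreasing_lists n"
      using sorted by (auto simp: decreasing_lists_def d_def in_set_conv_nth)
    moreover have "list_set n d = U"
      using L by (auto simp: list_set_def nth in_set_conv_nth image_iff simp flip: L(2))
    ultimately show "U \<in> list_set n ` decreasing_lists n" by blast
  qed (use list_set_bounds in auto)
qed

text \<open>The walk determines U except at n, and the cardinality decides membership of n: final
  height 0 means that n belongs to U, and -1 that it does not.\<close>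

lemma bij_betw_set_walk:
  assumes "n > 0"
  shows "bij_betw (set_walk n) {U. U \<subseteq> {1..2 * int n - 1} \<and> card U = n}
    {xs. length xs = n - 1 \<and> (height xs = 0 \<or> height xs = - 1)}"
  unfolding bij_betw_def
proof
  have mem: "U \<subseteq> {1..2 * int n - 1} \<Longrightarrow> u \<noteq> int n \<Longrightarrow> u \<in> U \<longleftrightarrow>
     (1 \<le> u \<and> u < int n \<and> \<not> fst (set_walk n U ! nat (u - 1))) \<or>
     (int n < u \<and> u \<le> 2 * int n - 1 \<and> snd (set_walk n U ! nat (2 * int n - 1 - u)))" for U u
  proof -
    assume U: "U \<subseteq> {1..2 * int n - 1}" and u: "u \<noteq> int n"
    have "fst (set_walk n U ! nat (u - 1)) \<longleftrightarrow> u \<notin> U" if "1 \<le> u" "u < int n"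
    proof -
      have "nat (u - 1) < n - 1" "int (Suc (nat (u - 1))) = u" using that by auto
      then show ?thesis by (simp add: set_walk_def del: of_nat_Suc)
    qed
    moreover have "snd (set_walk n U ! nat (2 * int n - 1 - u)) \<longleftrightarrow> u \<in> U" if "int n < u" "u \<le> 2 * int n - 1"
    proof -
      have "nat (2 * int n - 1 - u) < n - 1" "2 * int n - int (Suc (nat (2 * int n - 1 - u))) = u" using that by auto
      then show ?thesis by (simp add: set_walk_def del: of_nat_Suc)
    qed
    moreover have "1 \<le> u \<and> u \<le> 2 * int n - 1" if "u \<in> U" using U that by auto
    ultimately show ?thesis using u by (meson linorder_less_linear)
  qed
  show "inj_on (set_walk n) {U. U \<subseteq> {1..2 * int n - 1} \<and> card U = n}"
  proof (rule inj_onI)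
    fix U V assume UV: "U \<in> {U. U \<subseteq> {1..2 * int n - 1} \<and> card U = n}"
      "V \<in> {U. U \<subseteq> {1..2 * int n - 1} \<and> card U = n}" "set_walk n U = set_walk n V"
    have iff: "u \<in> U \<longleftrightarrow> u \<in> V" if "u \<noteq> int n" for u
      using mem [of U u] mem [of V u] UV that by simp
    then have eq: "U - {int n} = V - {int n}" by blast
    have fin: "finite U" "finite V" using UV by (auto intro: finite_subset)
    have "card (U - {int n}) = card U - of_bool (int n \<in> U)" "card (V - {int n}) = card V - of_bool (int n \<in> V)"
      using fin by (auto simp: card_Diff_singleton_if)
    then have "int n \<in> U \<longleftrightarrow> int n \<in> V" using UV eq assms by (auto simp: of_bool_def split: if_splits)
    then have "u \<in> U \<longleftrightarrow> u \<in> V" for u using iff [of u] by (cases "u = int n") auto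
    then show "U = V" by blast
  qed
  show "set_walk n ` {U. U \<subseteq> {1..2 * int n - 1} \<and> card U = n} = {xs. length xs = n - 1 \<and> (height xs = 0 \<or> height xs = - 1)}"
  proof (intro equalityI subsetI)
    fix xs assume "xs \<in> set_walk n ` {U. U \<subseteq> {1..2 * int n - 1} \<and> card U = n}"
    then obtain U where U: "U \<subseteq> {1..2 * int n - 1}" "card U = n" "xs = set_walk n U" by blast
    have "finite U" using U by (auto intro: finite_subset)
    then have "card (U - {int n}) = n - of_bool (int n \<in> U)"
      using U by (auto simp: card_Diff_singleton_if)
    then show "xs \<in> {xs. length xs = n - 1 \<and> (height xs = 0 \<or> height xs = - 1)}"
      using U height_set_walk [OF U(1) assms] assms by (auto simp: of_nat_diff)
  next
    fix xs :: "(bool \<times> bool) list"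
    assume "xs \<in> {xs. length xs = n - 1 \<and> (height xs = 0 \<or> height xs = - 1)}"
    then have xs: "length xs = n - 1" "height xs = 0 \<or> height xs = - 1" by auto
    define U where "U = {u. (1 \<le> u \<and> u < int n \<and> \<not> fst (xs ! nat (u - 1))) \<or>
     (int n < u \<and> u \<le> 2 * int n - 1 \<and> snd (xs ! nat (2 * int n - 1 - u)))}"
    have U: "U \<subseteq> {1..2 * int n - 1}" "int n \<notin> U" using assms by (auto simp: U_def)
    have fin: "finite U" using U by (auto intro: finite_subset)
    have walk: "set_walk n V = xs" if "V - {int n} = U" for V
    proof (rule nth_equalityI)
      fix j assume "j < length (set_walk n V)"
      then have j: "j < n - 1" by simp
      have V: "v \<in> V \<longleftrightarrow> v \<in> U" if "v \<noteq> int n" for v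
        using \<open>V - {int n} = U\<close> that by blast
      have "int (Suc j) \<in> V \<longleftrightarrow> \<not> fst (xs ! j)"
        using j by (subst V) (auto simp: U_def)
      moreover have "2 * int n - int (Suc j) \<in> V \<longleftrightarrow> snd (xs ! j)"
        using j by (subst V) (auto simp: U_def)
      ultimately show "set_walk n V ! j = xs ! j"
        using j by (simp add: set_walk_def prod_eq_iff)
    qed (use xs in simp)
    have h: "height xs = int n - 1 - int (card U)"
      using height_set_walk [OF U(1) assms] walk [of U] U by simp
    show "xs \<in> set_walk n ` {U. U \<subseteq> {1..2 * int n - 1} \<and> card U = n}"
    proof (cases "height xs = 0")
      case True
      then have "card (insert (int n) U) = n" using h U fin by simp
      moreover have "set_walk n (insert (int n) U) = xs" using U by (intro walk) auto
      moreover have "insert (int n) U \<subseteq> {1..2 * int n - 1}" using U assms by auto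
      ultimately show ?thesis by blast
    next
      case False
      then have "card U = n" using h xs by simp
      moreover have "set_walk n U = xs" using U by (intro walk) auto
      ultimately show ?thesis using U by blast
    qed
  qed
qed

lemma card_filter_bij_betw:
  assumes "bij_betw f A B" "\<And>x. x \<in> A \<Longrightarrow> P x \<longleftrightarrow> Q (f x)"
  shows "card {x \<in> A. P x} = card {y \<in> B. Q y}"
proof -
  have "{y \<in> B. Q y} = f ` {x \<in> A. P x}"
    using assms(2) bij_betw_imp_surj_on [OF assms(1)] by blast
  moreover have "inj_on f {x \<in> A. P x}"
    using bij_betw_imp_inj_on [OF assms(1)] by (rule inj_on_subset) auto
  ultimately show ?thesis by (simp add: card_image)
qed

lemma card_erdos_gallai_lists:
  assumes "n > 0"
  shows "card {d \<in> decreasing_lists n. even (sum_list d) \<and> erdos_gallai n ((!) d)} =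
    card {xs. length xs = n - 1 \<and> (height xs = 0 \<or> height xs = - 1) \<and> nonneg xs \<and> even (area xs)}"
proof -
  let ?W = "{xs. length xs = n - 1 \<and> (height xs = 0 \<or> height xs = - 1)}"
  let ?f = "set_walk n \<circ> list_set n"
  have bij: "bij_betw ?f (decreasing_lists n) ?W"
    by (rule bij_betw_trans [OF bij_betw_list_set bij_betw_set_walk [OF assms]])
  have iff: "even (sum_list d) \<and> erdos_gallai n ((!) d) \<longleftrightarrow> nonneg (?f d) \<and> even (area (?f d))"
    if d: "d \<in> decreasing_lists n" for d
  proof -
    interpret decreasing_sequence n "(!) d" by (rule decreasing_lists_locale [OF d])
    have area: "area (take t (?f d)) = area_profile n ((!) d) (int t + 1 - int n)" if "t < n" for t
      using area_set_walk_profile [OF list_set_def list_set_bounds(1) [OF d] inj_on_list_set [OF d] nonnegative that] by simp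
    have len: "length (?f d) = n - 1" by simp
    have "area (?f d) = area_profile n ((!) d) 0"
      using area [of "n - 1"] assms len by (simp add: of_nat_diff)
    moreover have "sum_list d = (\<Sum>i<n. d ! i)"
      using d by (simp add: sum_list_sum_nth decreasing_lists_def lessThan_atLeast0)
    moreover have "nonneg (?f d) \<longleftrightarrow> (\<forall>c. 1 - int n \<le> c \<and> c \<le> 0 \<longrightarrow> area_profile n ((!) d) c \<ge> 0)"
    proof
      assume nn: "nonneg (?f d)"
      show "\<forall>c. 1 - int n \<le> c \<and> c \<le> 0 \<longrightarrow> area_profile n ((!) d) c \<ge> 0"
      proof (intro allI impI)
        fix c assume c: "1 - int n \<le> c \<and> c \<le> 0"
        define t where "t = nat (c + int n - 1)"
        have t: "t < n" "int t + 1 - int n = c" using c assms by (auto simp: t_def)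
        then have "t \<le> length (?f d)" by simp
        then show "area_profile n ((!) d) c \<ge> 0"
          using nn area [OF t(1)] t(2) unfolding nonneg_def by metis
      qed
    next
      assume J: "\<forall>c. 1 - int n \<le> c \<and> c \<le> 0 \<longrightarrow> area_profile n ((!) d) c \<ge> 0"
      show "nonneg (?f d)"
        unfolding nonneg_def
      proof (intro allI impI)
        fix t assume "t \<le> length (?f d)"
        then have "t < n" using len assms by simp
        then show "0 \<le> area (take t (?f d))"
          unfolding area [OF \<open>t < n\<close>] by (intro J [rule_format]) auto
      qed
    qed
    ultimately show ?thesis by (simp only: erdos_gallai_iff even_area_profile conj_ac)
  qed
  have "card {d \<in> decreasing_lists n. even (sum_list d) \<and> erdos_gallai n ((!) d)} = card {xs \<in> ?W. nonneg xs \<and> even (area xs)}"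
    by (rule card_filter_bij_betw [where Q = "\<lambda>xs. nonneg xs \<and> even (area xs)", OF bij iff])
  then show ?thesis by (simp add: conj_assoc)
qed

section \<open>The Erdos--Gallai theorem\<close>

abbreviation deg :: "'a set set \<Rightarrow> 'a \<Rightarrow> int" where
  "deg E v \<equiv> int (vertex_degree E v)"

lemma simple_graph_finite: "simple_graph V E \<Longrightarrow> finite E"
  unfolding simple_graph_def by (meson Pow_iff finite_Pow_iff finite_subset subsetI)

lemma simple_graph_edge: "simple_graph V E \<Longrightarrow> {u, v} \<in> E \<Longrightarrow> u \<noteq> v \<and> u \<in> V \<and> v \<in> V"
  unfolding simple_graph_def by fastforce

lemma deg_insert:
  assumes "finite E" "e \<notin> E"
  shows "deg (insert e E) v = deg E v + of_bool (v \<in> e)"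
proof -
  have "{e' \<in> insert e E. v \<in> e'} = (if v \<in> e then insert e {e' \<in> E. v \<in> e'} else {e' \<in> E. v \<in> e'})" by auto
  then show ?thesis using assms by (simp add: vertex_degree_def)
qed

lemma deg_delete:
  assumes "finite E" "e \<in> E"
  shows "deg (E - {e}) v = deg E v - of_bool (v \<in> e)"
  using deg_insert [of "E - {e}" e v] assms by (simp add: insert_absorb)

lemma deg_eq_sum:
  assumes G: "simple_graph V E" and f: "bij_betw f {..<n::nat} V" and i: "i < n"
  shows "deg E (f i) = (\<Sum>j<n. of_bool ({f i, f j} \<in> E))"
proof -
  let ?N = "{j. j < n \<and> {f i, f j} \<in> E}"
  have inj: "inj_on f {..<n}" and V: "f ` {..<n} = V" using f by (auto simp: bij_betw_def)
  have "{e \<in> E. f i \<in> e} = (\<lambda>j. {f i, f j}) ` ?N"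
  proof (intro equalityI subsetI)
    fix e assume "e \<in> {e \<in> E. f i \<in> e}"
    then have e: "e \<in> E" "f i \<in> e" by auto
    then have "e \<subseteq> V" "card e = 2" using G by (auto simp: simple_graph_def)
    then obtain w where w: "e = {f i, w}" using e(2) by (auto simp: card_2_iff doubleton_eq_iff)
    then have "w \<in> V" using \<open>e \<subseteq> V\<close> by simp
    then obtain j where "j < n" "w = f j" using V by auto
    then show "e \<in> (\<lambda>j. {f i, f j}) ` ?N" using w e by auto
  qed auto
  moreover have "inj_on (\<lambda>j. {f i, f j}) ?N"
    using inj unfolding inj_on_def by (auto simp: doubleton_eq_iff)
  ultimately have "deg E (f i) = int (card ?N)"
    by (simp add: vertex_degree_def card_image)
  also have "\<dots> = (\<Sum>j | j < n \<and> {f i, f j} \<in> E. 1)" by simp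
  also have "\<dots> = (\<Sum>j<n. of_bool ({f i, f j} \<in> E))"
    by (rule sum.mono_neutral_cong_left) auto
  finally show ?thesis .
qed

lemma even_sum_symmetric:
  fixes x :: "nat \<Rightarrow> nat \<Rightarrow> int"
  assumes "\<And>i j. x i j = x j i" "\<And>i. x i i = 0"
  shows "even (\<Sum>i<n. \<Sum>j<n. x i j)"
proof (induction n)
  case (Suc n)
  have "(\<Sum>i<Suc n. \<Sum>j<Suc n. x i j) = (\<Sum>i<n. \<Sum>j<n. x i j) + 2 * (\<Sum>i<n. x i n)"
    using assms(1) [of n] by (simp add: sum.distrib assms(2))
  then show ?case using Suc by simp
qed simp

lemma sum_deg_split:
  assumes G: "simple_graph V E" and f: "bij_betw f {..<n::nat} V" and k: "k \<le> n"
  shows "(\<Sum>i<k. deg E (f i)) = (\<Sum>i<k. \<Sum>j<k. of_bool ({f i, f j} \<in> E)) + (\<Sum>j\<in>{k..<n}. \<Sum>i<k. of_bool ({f i, f j} \<in> E))"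
proof -
  have "(\<Sum>i<k. deg E (f i)) = (\<Sum>i<k. (\<Sum>j<k. of_bool ({f i, f j} \<in> E)) + (\<Sum>j\<in>{k..<n}. of_bool ({f i, f j} \<in> E)))"
    using deg_eq_sum [OF G f] k by (intro sum.cong refl) (simp add: sum_lessThan_split [OF k])
  then show ?thesis by (subst sum.swap) (simp add: sum.distrib)
qed

lemma even_sum_deg:
  assumes G: "simple_graph V E" and f: "bij_betw f {..<n::nat} V"
  shows "even (\<Sum>i<n. deg E (f i))"
proof -
  have "(\<Sum>i<n. deg E (f i)) = (\<Sum>i<n. \<Sum>j<n. of_bool ({f i, f j} \<in> E))"
    by (intro sum.cong refl deg_eq_sum [OF G f]) simp
  moreover have "{v, v} \<notin> E" for v using simple_graph_edge [OF G] by blast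
  then have "even (\<Sum>i<n. \<Sum>j<n. of_bool ({f i, f j} \<in> E) :: int)"
    by (intro even_sum_symmetric) (auto simp: insert_commute)
  ultimately show ?thesis by simp
qed

text \<open>Each of the first k vertices has at most k - 1 neighbours among them, and a later vertex
  sends them at most min(deg, k) edges.\<close>

lemma erdos_gallai_necessary:
  assumes G: "simple_graph V E" and f: "bij_betw f {..<n::nat} V"
  shows "erdos_gallai n (\<lambda>i. deg E (f i))"
  unfolding erdos_gallai_def
proof (intro allI impI)
  fix k assume k: "k \<le> n"
  have loop: "{v, v} \<notin> E" for v using simple_graph_edge [OF G] by blast
  have "(\<Sum>i<k. \<Sum>j<k. of_bool ({f i, f j} \<in> E)) \<le> (\<Sum>i<k. int k - 1)"
  proof (rule sum_mono)
    fix i assume i: "i \<in> {..<k}"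
    have "(\<Sum>j<k. of_bool ({f i, f j} \<in> E)) = (\<Sum>j\<in>{..<k} - {i}. of_bool ({f i, f j} \<in> E) :: int)"
      by (rule sum.mono_neutral_right) (use loop in auto)
    also have "\<dots> \<le> (\<Sum>j\<in>{..<k} - {i}. 1)" by (rule sum_mono) simp
    also have "\<dots> = int k - 1" using i by (simp add: of_nat_diff)
    finally show "(\<Sum>j<k. of_bool ({f i, f j} \<in> E)) \<le> int k - 1" .
  qed
  moreover have "(\<Sum>j\<in>{k..<n}. \<Sum>i<k. of_bool ({f i, f j} \<in> E)) \<le> (\<Sum>j\<in>{k..<n}. min (deg E (f j)) (int k))"
  proof (rule sum_mono)
    fix j assume j: "j \<in> {k..<n}"
    have "(\<Sum>i<k. of_bool ({f i, f j} \<in> E)) \<le> (\<Sum>i<n. of_bool ({f i, f j} \<in> E) :: int)"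
      by (rule sum_mono2) (use k in auto)
    also have "\<dots> = deg E (f j)"
      using j by (subst deg_eq_sum [OF G f]) (auto simp: insert_commute)
    finally have "(\<Sum>i<k. of_bool ({f i, f j} \<in> E)) \<le> deg E (f j)" .
    moreover have "(\<Sum>i<k. of_bool ({f i, f j} \<in> E) :: int) \<le> (\<Sum>i<k. 1)"
      by (rule sum_mono) simp
    ultimately show "(\<Sum>i<k. of_bool ({f i, f j} \<in> E)) \<le> min (deg E (f j)) (int k)" by simp
  qed
  ultimately show "(\<Sum>i<k. deg E (f i)) \<le> int k * (int k - 1) + (\<Sum>i\<in>{k..<n}. min (deg E (f i)) (int k))"
    unfolding sum_deg_split [OF G f k] by simp
qed

section \<open>Sufficiency of the Erdos-Gallai inequalities\<close>

lemma exists_private_neighbour: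
  assumes G: "simple_graph V E" and less: "deg E r < deg E i" and "i \<noteq> r"
  obtains u where "{u, i} \<in> E" "u \<noteq> r" "{u, r} \<notin> E"
proof -
  have fin: "finite E" by (rule simple_graph_finite [OF G])
  define N where "N v = {u. {u, v} \<in> E}" for v
  have fV: "finite V" using G by (simp add: simple_graph_def)
  have card_N: "card (N v) = vertex_degree E v" for v
  proof -
    have "{e \<in> E. v \<in> e} = (\<lambda>u. {u, v}) ` N v"
    proof (intro equalityI subsetI)
      fix e assume "e \<in> {e \<in> E. v \<in> e}"
      then have e: "e \<in> E" "v \<in> e" "card e = 2" using G by (auto simp: simple_graph_def)
      then obtain w where "e = {w, v}" by (auto simp: card_2_iff doubleton_eq_iff)
      then show "e \<in> (\<lambda>u. {u, v}) ` N v" using e by (auto simp: N_def)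
    qed (auto simp: N_def)
    moreover have "inj_on (\<lambda>u. {u, v}) (N v)" by (auto simp: inj_on_def doubleton_eq_iff)
    ultimately show ?thesis by (simp add: vertex_degree_def card_image)
  qed
  have fin_N: "finite (N v)" for v
    using finite_subset [OF _ fV, of "N v"] simple_graph_edge [OF G] by (auto simp: N_def)
  have iff: "r \<in> N i \<longleftrightarrow> i \<in> N r" by (simp add: N_def insert_commute)
  have "card (N r) < card (N i)" using less by (simp add: card_N)
  moreover have "0 < card (N r)" if "i \<in> N r" using that fin_N card_gt_0_iff by blast
  \<comment> \<open>By symmetry of adjacency either both removals delete an element or neither does,
    so the strict inequality survives.\<close>
  ultimately have "card (N r - {i}) < card (N i - {r})"
    using iff fin_N by (cases "r \<in> N i") auto
  then have "\<not> N i - {r} \<subseteq> N r - {i}"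
    using card_mono [of "N r - {i}" "N i - {r}"] fin_N by auto
  then obtain u where u: "{u, i} \<in> E" "u \<noteq> r" "{u, r} \<notin> E \<or> u = i"
    by (auto simp: N_def)
  then show ?thesis using that simple_graph_edge [OF G, of u i] by blast
qed

context decreasing_sequence
begin

text \<open>Following Tripathi, Venugopalan and West: the degrees before the critical index \<open>r\<close> are already
  right, none is too large, and the vertices after \<open>r\<close> form an independent set.\<close>

definition subrealization :: "nat \<Rightarrow> nat set set \<Rightarrow> bool" where
  "subrealization r E \<longleftrightarrow> simple_graph {..<n} E \<and> (\<forall>i<n. deg E i \<le> a i) \<and> (\<forall>i<r. deg E i = a i) \<and>
     (\<forall>e\<in>E. \<exists>i\<le>r. i \<in> e)"

text \<open>\<open>A\<close> lists the added edges with an endpoint at most \<open>r\<close> in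
  first place, so that the later vertices stay independent; deletions are unrestricted.\<close>

lemma subrealization_modify:
  assumes "subrealization r E" "E' \<subseteq> (\<lambda>(x, y). {x, y}) ` A \<union> E"
    and "\<And>x y. (x, y) \<in> A \<Longrightarrow> x \<noteq> y \<and> x < n \<and> y < n \<and> x \<le> r"
    and deg: "\<And>i. i < n \<Longrightarrow> deg E' i \<le> a i" "\<And>i. i < r \<Longrightarrow> deg E' i = deg E i"
  shows "subrealization r E'"
  unfolding subrealization_def simple_graph_def
proof (intro conjI ballI allI impI)
  have E: "e \<subseteq> {..<n} \<and> card e = 2 \<and> (\<exists>i\<le>r. i \<in> e)" if "e \<in> E'" for e
  proof (cases "e \<in> E")
    case True
    then show ?thesis using assms(1) by (simp add: subrealization_def simple_graph_def)
  next
    case False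
    then have "e \<in> (\<lambda>(x, y). {x, y}) ` A" using that assms(2) by blast
    then obtain x y where "e = {x, y}" "(x, y) \<in> A" by auto
    then show ?thesis using assms(3) by force
  qed
  fix e assume "e \<in> E'"
  then show "e \<subseteq> {..<n}" "card e = 2" "\<exists>i\<le>r. i \<in> e" using E by auto
next
  fix i assume "i < r"
  then show "deg E' i = a i" using deg(2) assms(1) by (simp add: subrealization_def)
qed (use deg in auto)

text \<open>Four kinds of switch are tried. If none applies, 0, ..., r form a clique and each later
  k has min(a_k, r + 1) neighbours in it; the degrees then attain the Erdos-Gallai bound for r + 1,
  which leaves no room for a deficient r.\<close>

lemma subrealization_improve:
  assumes eg: "erdos_gallai n a" and even_sum: "even (\<Sum>i<n. a i)" and r: "r < n"
    and sub: "subrealization r E" and less: "deg E r < a r"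
  shows "\<exists>E'. subrealization r E' \<and> deg E r < deg E' r"
proof -
  have G: "simple_graph {..<n} E" and le: "\<And>i. i < n \<Longrightarrow> deg E i \<le> a i"
    and full: "\<And>i. i < r \<Longrightarrow> deg E i = a i" and indep: "\<And>e. e \<in> E \<Longrightarrow> \<exists>i\<le>r. i \<in> e"
    using sub by (auto simp: subrealization_def)
  have fin: "finite E" by (rule simple_graph_finite [OF G])
  have edge: "u \<noteq> v \<and> u < n \<and> v < n" if "{u, v} \<in> E" for u v
    using simple_graph_edge [OF G that] by simp
  have id: "bij_betw (\<lambda>i. i) {..<n} {..<n}" by (simp add: bij_betw_def)
  have deg_sum: "deg E i = (\<Sum>j<n. of_bool ({i, j} \<in> E))" if "i < n" for i
    using deg_eq_sum [OF G id that] .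
  have priv: "\<exists>u. {u, i} \<in> E \<and> u \<noteq> r \<and> {u, r} \<notin> E" if "i < r" for i
  proof -
    have "deg E r < deg E i" using full [OF that] decreasing [of i r] r less that by simp
    then show ?thesis using exists_private_neighbour [OF G, of r i] that by (metis less_irrefl)
  qed
  show ?thesis
  proof (cases "\<exists>k. r < k \<and> k < n \<and> deg E k < a k \<and> {r, k} \<notin> E")
    case True
    then obtain k where k: "r < k" "k < n" "deg E k < a k" "{r, k} \<notin> E" by blast
    let ?E = "insert {r, k} E"
    have D: "deg ?E v = deg E v + of_bool (v = r \<or> v = k)" for v
      using fin k by (simp add: deg_insert)
    have "subrealization r ?E"
      by (rule subrealization_modify [OF sub, of _ "{(r, k)}"]) (use k r le less in \<open>auto simp: D\<close>)
    then show ?thesis using D [of r] by auto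
  next
    case case0: False
    show ?thesis
    proof (cases "\<exists>i<r. {i, r} \<notin> E")
      case True
      then obtain i where i: "i < r" "{i, r} \<notin> E" by blast
      obtain u where u: "{u, i} \<in> E" "u \<noteq> r" "{u, r} \<notin> E" using priv [OF i(1)] by blast
      have ur: "{r, u} \<notin> E" using u(3) by (simp add: insert_commute)
      have ui: "u \<noteq> i" "u < n" using edge [OF u(1)] by auto
      show ?thesis
      proof (cases "deg E r + 2 \<le> a r")
        case True
        \<comment> \<open>The edge at i and u is rerouted through r: i and u keep their degrees, and
          r gains 2.\<close>
        let ?E = "insert {r, u} (insert {i, r} (E - {{u, i}}))"
        have D: "deg ?E v = deg E v + (if v = r then 2 else 0)" for v
          using fin u ur ui i by (auto simp: deg_insert deg_delete doubleton_eq_iff)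
        have "subrealization r ?E"
          by (rule subrealization_modify [OF sub, of _ "{(r, u), (i, r)}"])
            (use u ui i r le True in \<open>auto simp: D\<close>)
        then show ?thesis using D [of r] by auto
      next
        case False
        \<comment> \<open>The deficiency of r is 1, so parity of the two degree sums forces another
          deficient vertex, necessarily beyond r.\<close>
        have "\<exists>k. r < k \<and> k < n \<and> deg E k < a k"
        proof (rule ccontr)
          assume "\<not> ?thesis"
          then have "deg E k = a k" if "k < n" "k \<noteq> r" for k
            using full [of k] le [of k] that by (metis linorder_neqE_nat order_le_less)
          then have "(\<Sum>i<n. a i) = (\<Sum>i<n. deg E i + of_bool (i = r))"
            using False less by (intro sum.cong) auto
          also have "\<dots> = (\<Sum>i<n. deg E i) + 1"
            using r by (simp add: sum.distrib of_bool_def)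
          finally show False using even_sum even_sum_deg [OF G id] by simp
        qed
        then obtain k where k: "r < k" "k < n" "deg E k < a k" "{r, k} \<in> E" using case0 by blast
        have uk: "u \<noteq> k" using u k by (auto simp: insert_commute)
        \<comment> \<open>The previous switch would overshoot by 1; giving up the edge from r to the
          deficient k corrects this.\<close>
        let ?E = "insert {r, u} (insert {i, r} (E - {{u, i}} - {{r, k}}))"
        have D: "deg ?E v = deg E v + (if v = r then 1 else if v = k then - 1 else 0)" for v
          using fin u ur ui i k uk by (auto simp: deg_insert deg_delete doubleton_eq_iff)
        have "subrealization r ?E"
          by (rule subrealization_modify [OF sub, of _ "{(r, u), (i, r)}"])
            (use u ui i r le less k in \<open>auto simp: D\<close>)
        then show ?thesis using D [of r] by auto
      qed
    next
      case case1: False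
      have above: "u > r" if "u \<noteq> r" "{u, r} \<notin> E" for u
        using that case1 by (meson linorder_neqE_nat)
      have deg_above: "deg E k = (\<Sum>i<Suc r. of_bool ({i, k} \<in> E))" if "r < k" "k < n" for k
      proof -
        have "deg E k = (\<Sum>i<n. of_bool ({i, k} \<in> E))"
          unfolding deg_sum [OF that(2)] by (simp add: insert_commute)
        also have "\<dots> = (\<Sum>i<Suc r. of_bool ({i, k} \<in> E))"
          by (rule sum.mono_neutral_right) (use r that indep in fastforce)+
        finally show ?thesis .
      qed
      show ?thesis
      proof (cases "\<exists>k. r < k \<and> k < n \<and> deg E k \<noteq> min (a k) (int (Suc r))")
        case True
        then obtain k where k: "r < k" "k < n" "deg E k \<noteq> min (a k) (int (Suc r))" by blast
        have "(\<Sum>i<Suc r. of_bool ({i, k} \<in> E) :: int) \<le> (\<Sum>i<Suc r. 1)"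
          by (rule sum_mono) simp
        then have "deg E k \<le> int (Suc r)" unfolding deg_above [OF k(1,2)] by simp
        then have dk: "deg E k < a k" "deg E k < int (Suc r)" using k(3) le [OF k(2)] by auto
        have rk: "{r, k} \<in> E" using case0 k dk by blast
        obtain i where i: "i < Suc r" "{i, k} \<notin> E"
        proof (rule ccontr)
          assume "\<not> thesis"
          then have "{i, k} \<in> E" if "i < Suc r" for i using that \<open>\<And>i. i < Suc r \<Longrightarrow> {i, k} \<notin> E \<Longrightarrow> thesis\<close> by blast
          then have "deg E k = int (Suc r)" unfolding deg_above [OF k(1,2)] by simp
          then show False using dk by simp
        qed
        have ir: "i < r" using i rk by (metis less_antisym)
        obtain u where u: "{u, i} \<in> E" "u \<noteq> r" "{u, r} \<notin> E" using priv [OF ir] by blast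
        have ur: "{r, u} \<notin> E" using u(3) by (simp add: insert_commute)
        have ui: "u \<noteq> i" "u < n" using edge [OF u(1)] by auto
        have uk: "u \<noteq> k" using u rk by (auto simp: insert_commute)
        \<comment> \<open>Both r and k gain 1; each is deficient, so no degree exceeds its
          target.\<close>
        let ?E = "insert {r, u} (insert {i, k} (E - {{u, i}}))"
        have D: "deg ?E v = deg E v + (if v = r \<or> v = k then 1 else 0)" for v
          using fin u ur ui i ir k uk by (auto simp: deg_insert deg_delete doubleton_eq_iff)
        have "subrealization r ?E"
          by (rule subrealization_modify [OF sub, of _ "{(r, u), (i, k)}"])
            (use u ui ir r le less k dk in \<open>auto simp: D\<close>)
        then show ?thesis using D [of r] by auto
      next
        case case2: False
        show ?thesis
        proof (cases "\<exists>i j. i < j \<and> j < r \<and> {i, j} \<notin> E")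
          case True
          then obtain i j where ij: "i < j" "j < r" "{i, j} \<notin> E" by blast
          have ir: "i < r" using ij by simp
          obtain u where u: "{u, i} \<in> E" "u \<noteq> r" "{u, r} \<notin> E" using priv [OF ir] by blast
          have ur: "{r, u} \<notin> E" using u(3) by (simp add: insert_commute)
          obtain w where w: "{w, j} \<in> E" "w \<noteq> r" "{w, r} \<notin> E" using priv [OF ij(2)] by blast
          have ui: "u < n" "u > r" "w < n" "w > r" using edge [OF u(1)] edge [OF w(1)] above u w by auto
          \<comment> \<open>Only w loses degree, which is allowed as w lies beyond r. The case u = w
            is included.\<close>
          let ?E = "insert {r, u} (insert {i, j} (E - {{u, i}} - {{w, j}}))"
          have D: "deg ?E v = deg E v + (if v = r then 1 else if v = w then - 1 else 0)" for v
            using fin u ur w ui ij ir by (auto simp: deg_insert deg_delete doubleton_eq_iff)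
          have "subrealization r ?E"
            by (rule subrealization_modify [OF sub, of _ "{(r, u), (i, j)}"])
              (use ui ij ir r le less in \<open>auto simp: D intro: order_trans [OF _ le]\<close>)
          then show ?thesis using D [of r] by auto
        next
          case False
          have clique: "{i, j} \<in> E" if "i < Suc r" "j < Suc r" "i \<noteq> j" for i j
            using that False case1 by (metis insert_commute less_antisym linorder_neqE_nat)
          have loop: "{v, v} \<notin> E" for v using edge [of v v] by blast
          have "(\<Sum>i<Suc r. \<Sum>j<Suc r. of_bool ({i, j} \<in> E)) = (\<Sum>i<Suc r. int r)"
          proof (rule sum.cong)
            fix i assume i: "i \<in> {..<Suc r}"
            have "(\<Sum>j<Suc r. of_bool ({i, j} \<in> E)) = (\<Sum>j\<in>{..<Suc r} - {i}. 1 :: int)"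
              by (rule sum.mono_neutral_cong_right) (use loop clique i in auto)
            then show "(\<Sum>j<Suc r. of_bool ({i, j} \<in> E)) = int r" using i by simp
          qed simp
          moreover have "(\<Sum>k\<in>{Suc r..<n}. \<Sum>i<Suc r. of_bool ({i, k} \<in> E)) = (\<Sum>k\<in>{Suc r..<n}. min (a k) (int (Suc r)))"
          proof (rule sum.cong)
            fix k assume "k \<in> {Suc r..<n}"
            then have "r < k" "k < n" by auto
            then show "(\<Sum>i<Suc r. of_bool ({i, k} \<in> E)) = min (a k) (int (Suc r))"
              using case2 deg_above [of k] by metis
          qed simp
          ultimately have "(\<Sum>i<Suc r. deg E i) = int (Suc r) * int r + (\<Sum>k\<in>{Suc r..<n}. min (a k) (int (Suc r)))"
            using sum_deg_split [OF G id, of "Suc r"] r by simp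
          moreover have "(\<Sum>i<Suc r. a i) \<le> int (Suc r) * int r + (\<Sum>k\<in>{Suc r..<n}. min (a k) (int (Suc r)))"
            using eg [unfolded erdos_gallai_def, rule_format, of "Suc r"] r by simp
          moreover have "(\<Sum>i<r. deg E i) = (\<Sum>i<r. a i)" using full by (intro sum.cong) auto
          ultimately show ?thesis using less by simp
        qed
      qed
    qed
  qed
qed

text \<open>Degrees at r are bounded by \<open>a r\<close>, so a subrealization of maximal degree at
  r exists, and \<open>subrealization_improve\<close> shows that it meets the target. Moving on to r
  + 1 only shrinks the set that must be independent.\<close>

lemma subrealization_exists:
  assumes eg: "erdos_gallai n a" and even_sum: "even (\<Sum>i<n. a i)" and "r \<le> n"
  shows "\<exists>E. subrealization r E"
  using assms(3)
proof (induction r)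
  case 0
  have "subrealization 0 {}"
    by (simp add: subrealization_def simple_graph_def vertex_degree_def nonnegative)
  then show ?case by blast
next
  case (Suc r)
  then obtain E0 where "subrealization r E0" by auto
  moreover have "vertex_degree E r < Suc (nat (a r))" if "subrealization r E" for E
    using that Suc.prems by (auto simp: subrealization_def less_Suc_eq_le le_nat_iff nonnegative)
  ultimately obtain E where E: "subrealization r E"
    and max: "\<And>E'. subrealization r E' \<Longrightarrow> vertex_degree E' r \<le> vertex_degree E r"
    using ex_has_greatest_nat [of "subrealization r" E0 "\<lambda>E. vertex_degree E r" "Suc (nat (a r))"]
    by blast
  have "deg E r = a r"
  proof (rule ccontr)
    assume "deg E r \<noteq> a r"
    moreover have "deg E r \<le> a r" using E Suc.prems by (simp add: subrealization_def)
    ultimately have "deg E r < a r" by simp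
    then show False
      using subrealization_improve [OF eg even_sum _ E] Suc.prems max by fastforce
  qed
  moreover have "\<forall>e\<in>E. \<exists>i\<le>Suc r. i \<in> e"
    using E unfolding subrealization_def by (meson le_SucI)
  ultimately have "subrealization (Suc r) E"
    using E unfolding subrealization_def by (auto simp: less_Suc_eq)
  then show ?case by blast
qed

end

lemma graphic_sequences_eq:
  "graphic_sequences n = {d \<in> decreasing_lists n. even (sum_list d) \<and> erdos_gallai n ((!) d)}"
proof -
  have "(\<exists>(V :: nat set) E. simple_graph V E \<and> card V = n \<and> is_degree_sequence V E d)
    \<longleftrightarrow> even (sum_list d) \<and> erdos_gallai n ((!) d)" if d: "d \<in> decreasing_lists n" for d
  proof -
    interpret decreasing_sequence n "(!) d" by (rule decreasing_lists_locale [OF d])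
    have len: "length d = n" using d by (simp add: decreasing_lists_def)
    have sum: "sum_list d = (\<Sum>i<n. d ! i)"
      using len by (simp add: sum_list_sum_nth lessThan_atLeast0)
    show ?thesis
    proof
      assume "\<exists>(V :: nat set) E. simple_graph V E \<and> card V = n \<and> is_degree_sequence V E d"
      then obtain V :: "nat set" and E where G: "simple_graph V E" and V: "card V = n"
        and mset: "mset d = image_mset (\<lambda>v. deg E v) (mset_set V)"
        by (auto simp: is_degree_sequence_def)
      have fin: "finite V" using G by (simp add: simple_graph_def)
      define vs where "vs = sorted_list_of_set V"
      have vs: "length vs = n" "distinct vs" "set vs = V"
        using fin V by (auto simp: vs_def)
      then have "mset vs = mset_set V" using mset_set_set [of vs] by simp
      then have "mset d = mset (map (deg E) vs)" using mset by simp
      \<comment> \<open>The permutation turns equality of multisets into an enumeration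
        \<open>f\<close> of V along which the degrees appear in the order of
        \<open>d\<close>.\<close>
      then obtain p where p: "p permutes {..<length (map (deg E) vs)}" "permute_list p (map (deg E) vs) = d"
        by (rule mset_eq_permutation)
      define f where "f i = vs ! p i" for i
      have p': "p permutes {..<n}" using p vs by simp
      have "bij_betw ((!) vs) {..<n} V"
        using bij_betw_nth [OF vs(2)] vs by simp
      then have f: "bij_betw f {..<n::nat} V"
        unfolding f_def using bij_betw_trans [OF permutes_imp_bij [OF p']] by (simp add: comp_def)
      have nth: "d ! i = deg E (f i)" if "i < n" for i
        using permute_list_nth [OF p(1), of i] p(2) permutes_in_image [OF p', of i] that vs by (simp add: f_def)
      have "erdos_gallai n ((!) d)"
        using erdos_gallai_necessary [OF G f] unfolding erdos_gallai_def by (simp add: nth)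
      moreover have "sum_list d = (\<Sum>i<n. deg E (f i))" unfolding sum by (rule sum.cong) (auto simp: nth)
      ultimately show "even (sum_list d) \<and> erdos_gallai n ((!) d)"
        using even_sum_deg [OF G f] by simp
    next
      assume "even (sum_list d) \<and> erdos_gallai n ((!) d)"
      then obtain E where E: "subrealization n E"
        using subrealization_exists [of n] sum by auto
      have "mset d = mset (map ((!) d) [0..<n])" using map_nth [of d] len by simp
      also have "\<dots> = image_mset ((!) d) (mset_set {..<n})"
        by (simp only: mset_map mset_upt lessThan_atLeast0)
      also have "\<dots> = image_mset (\<lambda>v. deg E v) (mset_set {..<n})"
        by (rule image_mset_cong) (use E in \<open>auto simp: subrealization_def\<close>)
      finally have "is_degree_sequence {..<n} E d" by (simp add: is_degree_sequence_def)
      then show "\<exists>(V :: nat set) E. simple_graph V E \<and> card V = n \<and> is_degree_sequence V E d"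
        using E by (intro exI [of _ "{..<n}"] exI [of _ E]) (simp add: subrealization_def)
    qed
  qed
  then show ?thesis by (auto simp: graphic_sequences_def decreasing_lists_def)
qed

section \<open>Counting graphic sequences\<close>

lemma num_graphic_sequences_eq:
  assumes "n > 0"
  shows "num_graphic_sequences n =
    card {xs \<in> walks (n - 1). (height xs = 0 \<or> height xs = - 1) \<and> nonneg xs \<and> even (area xs)}"
proof -
  have "num_graphic_sequences n = card {xs. length xs = n - 1 \<and> (height xs = 0 \<or> height xs = - 1) \<and> nonneg xs \<and> even (area xs)}"
    unfolding num_graphic_sequences_def graphic_sequences_eq by (rule card_erdos_gallai_lists [OF assms])
  then show ?thesis by (simp add: walks_def)
qed

theorem theorem1p1:
  shows "\<exists>c::real. c > 0 \<and> (\<exists>\<epsilon> :: nat \<Rightarrow> real. \<epsilon> \<in> o(\<lambda>_. 1) \<and>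
    (\<forall>n\<ge>1. real (num_graphic_sequences n) = (c + \<epsilon> n) * (4 ^ n / real n powr (3/4))))"
proof -
  let ?w = "\<lambda>n. real (card {xs\<in>walks (n - 1). (height xs = 0 \<or> height xs = - 1) \<and> nonneg xs \<and> even (area xs)}) / 4 ^ n"
  obtain c where c: "c > 0" and lim: "(\<lambda>n. ?w n * (real n + 1) powr (3/4)) \<longlonglongrightarrow> c"
    by (rule even_half_bridges_asymptotics)
  \<comment> \<open>Defined as the exact error, so the identity holds for every positive n;
    asymptotics enter only in its limit, after n + 1 is replaced by n.\<close>
  define \<epsilon> where "\<epsilon> n = real (num_graphic_sequences n) / 4 ^ n * real n powr (3/4) - c" for n
  have "(\<lambda>n. (real n / (real n + 1)) powr (3/4)) \<longlonglongrightarrow> 1" by real_asymp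
  then have "(\<lambda>n. ?w n * (real n + 1) powr (3/4) * (real n / (real n + 1)) powr (3/4) - c) \<longlonglongrightarrow> c * 1 - c"
    by (intro tendsto_diff tendsto_mult lim tendsto_const)
  moreover have "eventually (\<lambda>n. ?w n * (real n + 1) powr (3/4) * (real n / (real n + 1)) powr (3/4) - c = \<epsilon> n) sequentially"
    using eventually_gt_at_top [of 0]
  proof eventually_elim
    case (elim n)
    have "(real n + 1) powr (3/4) * (real n / (real n + 1)) powr (3/4) = real n powr (3/4)"
      by (simp add: powr_divide)
    then show ?case
      unfolding \<epsilon>_def num_graphic_sequences_eq [OF elim] by (simp only: mult.assoc)
  qed
  ultimately have "\<epsilon> \<longlonglongrightarrow> c * 1 - c" by (rule Lim_transform_eventually)
  then have "\<epsilon> \<in> o(\<lambda>_. 1)" by (intro smalloI_tendsto) auto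
  moreover have "real (num_graphic_sequences n) = (c + \<epsilon> n) * (4 ^ n / real n powr (3/4))" if "n \<ge> 1" for n
    using that by (simp add: \<epsilon>_def)
  ultimately show ?thesis using c by blast
qed

end
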